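(* Let $\alpha\in(0,1)$ be irrational, $Tx=x+\alpha$ on $\mathbb T$, and let $\Phi:\mathbb T\to\mathbb R^d$ be a step function whose coordinates have integral zero, with discontinuities $x_1,\dots,x_D$. If $\Phi$ has well separated discontinuities, then the group of essential values $\mathcal E(\Phi)$ (over $T$) includes the set $\{\sigma_i: i=1,\dots,D\}$ of jumps of $\Phi$ at its discontinuities. Moreover, $\Phi$ is regular over $T$.
   Context: $\mathbb T=[0,1)$ is the additive circle (addition mod $1$) with Lebesgue measure $\mu$. A step function is a function that is constant on each interval of a finite partition of $\mathbb T$ into intervals; discontinuities are taken on the circle. The jump at $x_i$ is $\sigma_i=\Phi(x_i^+)-\Phi(x_i^-)\in\mathbb R^d$. Let $(q_n)$ be the denominators of the convergents of $\alpha$. For $n\ge1$ the points $\{x_i-k\alpha\}$, $1\le i\le D$, $0\le k<n$, are assumed distinct; list them in increasing order as $\gamma_{n,1}<\dots<\gamma_{n,Dn}<1$ and put $\gamma_{n,Dn+1}=\gamma_{n,1}$ (the difference $\gamma_{n,Dn+1}-\gamma_{n,Dn}$ being understood mod $1$, i.e. as the length of the corresponding arc). $\Phi$ has well separated discontinuities if there are $c>0$ and an infinite set $\mathcal Q$ of denominators $q_n$ of $\alpha$ such that $\gamma_{q,\ell+1}-\gamma_{q,\ell}\ge c/q$ for all $q\in\mathcal Q$ and all $\ell\in\{1,\dots,Dq\}$. A cocycle over $T$ is a measurable $\Phi:\mathbb T\to\mathbb R^d$; $\Phi_n(x)=\sum_{k=0}^{n-1}\Phi(T^kx)$ for $n\ge1$,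 extended to $n\in\mathbb Z$ by $\Phi_{n+k}(x)=\Phi_n(x)+\Phi_k(T^nx)$. $g\in\mathbb R^d$ is an essential value, $g\in\mathcal E(\Phi)$, if for every open neighborhood $U$ of $g$ and every Borel $A$ with $\mu(A)>0$ there is $N\in\mathbb Z$ with $\mu(A\cap T^{-N}A\cap\{\Phi_N\in U\})>0$. $\mathcal E(\Phi)$ is a closed subgroup. Two cocycles are cohomologous if their difference is $f-f\circ T$ a.e. for a measurable $f:\mathbb T\to\mathbb R^d$. $\Phi$ is regular if it is cohomologous to a cocycle $\Psi$ with values in a closed subgroup $H\subset\mathbb R^d$ such that $(x,h)\mapsto(Tx,h+\Psi(x))$ is ergodic on $\mathbb T\times H$ for $\mu\times$ Haar measure. *)

theory Defs
  imports "HOL-Analysis.Analysis"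
begin

section \<open>The circle and rotations\<close>

text \<open>The circle is represented by the fundamental domain \<open>[0,1)\<close>; functions on it are functions on
  the reals of which only the values on \<open>{0..<1}\<close> matter.  The measurable sets are the Borel
  subsets of \<open>[0,1)\<close>.\<close>

definition torus :: "real measure" where
  "torus = restrict_space lborel {0..<1}"

definition rot :: "real \<Rightarrow> real \<Rightarrow> real" where
  "rot \<alpha> x = frac (x + \<alpha>)"

text \<open>For an integer \<open>N\<close>, the power \<open>T\<^sup>N\<close> of \<open>T = rot \<alpha>\<close> is \<open>rot (of_int N * \<alpha>)\<close>;
  the next three facts justify this.\<close>

lemma rot_rot: "rot b (rot a x) = rot (a + b) x"
proof -
  have "frac (frac (x + a) + b) = frac (x + (a + b))"
    by (metis (no_types, lifting) frac_1_eq add.assoc add.commute frac_add_simps(1))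
  then show ?thesis by (simp add: rot_def)
qed

lemma rot_funpow:
  assumes "x \<in> {0..<1}" shows "(rot \<alpha> ^^ n) x = rot (of_int (int n) * \<alpha>) x"
  using assms by (induction n) (auto simp: rot_rot algebra_simps, auto simp: rot_def frac_eq)

lemma rot_inverse:
  assumes "x \<in> {0..<1}" shows "rot (- a) (rot a x) = x" "rot a (rot (- a) x) = x"
  using assms by (auto simp: rot_rot) (auto simp: rot_def frac_eq)


section \<open>Denominators of the convergents\<close>

text \<open>Complete quotients \<open>\<zeta>\<^sub>0 = \<alpha>\<close>, \<open>\<zeta>\<^sub>n\<^sub>+\<^sub>1 = 1 / {\<zeta>\<^sub>n}\<close>, partial quotients \<open>a\<^sub>n = \<lfloor>\<zeta>\<^sub>n\<rfloor>\<close>, and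
  \<open>q\<^sub>0 = 1\<close>, \<open>q\<^sub>1 = a\<^sub>1\<close>, \<open>q\<^sub>n\<^sub>+\<^sub>2 = a\<^sub>n\<^sub>+\<^sub>2 q\<^sub>n\<^sub>+\<^sub>1 + q\<^sub>n\<close>.\<close>

fun cf_complete :: "real \<Rightarrow> nat \<Rightarrow> real" where
  "cf_complete \<alpha> 0 = \<alpha>"
| "cf_complete \<alpha> (Suc n) = 1 / frac (cf_complete \<alpha> n)"

definition cf_partial :: "real \<Rightarrow> nat \<Rightarrow> int" where
  "cf_partial \<alpha> n = \<lfloor>cf_complete \<alpha> n\<rfloor>"

fun conv_denom :: "real \<Rightarrow> nat \<Rightarrow> nat" where
  "conv_denom \<alpha> 0 = 1"
| "conv_denom \<alpha> (Suc 0) = nat (cf_partial \<alpha> 1)"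
| "conv_denom \<alpha> (Suc (Suc n)) =
     nat (cf_partial \<alpha> (Suc (Suc n))) * conv_denom \<alpha> (Suc n) + conv_denom \<alpha> n"


section \<open>Step functions and their discontinuities\<close>

text \<open>The intervals of the partition may be open, closed, half-open or single points.  An arc
  through 0 is the union of two intervals of \<open>[0,1)\<close>, so cutting the circle at 0 is harmless.\<close>

definition step_function :: "(real \<Rightarrow> 'a) \<Rightarrow> bool" where
  "step_function \<Phi> \<longleftrightarrow>
     (\<exists>P. finite P \<and> partition_on {0..<1} P \<and> (\<forall>I\<in>P. is_interval I \<and> \<Phi> constant_on I))"

text \<open>Continuity and one-sided limits on the circle are those of the 1-periodic extension.\<close>

definition discontinuities :: "(real \<Rightarrow> 'a::topological_space) \<Rightarrow> real set" where
  "discontinuities \<Phi> = {x \<in> {0..<1}. \<not> isCont (\<lambda>t. \<Phi> (frac t)) x}"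

definition jump :: "(real \<Rightarrow> 'a::real_normed_vector) \<Rightarrow> real \<Rightarrow> 'a" where
  "jump \<Phi> x = Lim (at_right x) (\<lambda>t. \<Phi> (frac t)) - Lim (at_left x) (\<lambda>t. \<Phi> (frac t))"

definition disc_orbit :: "real \<Rightarrow> (nat \<Rightarrow> real) \<Rightarrow> nat \<Rightarrow> nat \<Rightarrow> real list" where
  "disc_orbit \<alpha> x D n = [frac (x i - real k * \<alpha>). i \<leftarrow> [1..<Suc D], k \<leftarrow> [0..<n]]"

text \<open>\<open>disc_gamma \<alpha> x D n l\<close> is \<open>\<gamma>\<^sub>n\<^sub>,\<^sub>l\<close>, meaningful for \<open>1 \<le> l \<le> D n\<close>.\<close>

definition disc_gamma :: "real \<Rightarrow> (nat \<Rightarrow> real) \<Rightarrow> nat \<Rightarrow> nat \<Rightarrow> nat \<Rightarrow> real" where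
  "disc_gamma \<alpha> x D n l = sort (disc_orbit \<alpha> x D n) ! (l - 1)"

text \<open>The last gap is the length of the arc from \<open>\<gamma>\<^sub>n\<^sub>,\<^sub>D\<^sub>n\<close> through 0 to \<open>\<gamma>\<^sub>n\<^sub>,\<^sub>1\<close>
  (which is 1 when there is only one point).\<close>

definition disc_gap :: "real \<Rightarrow> (nat \<Rightarrow> real) \<Rightarrow> nat \<Rightarrow> nat \<Rightarrow> nat \<Rightarrow> real" where
  "disc_gap \<alpha> x D n l =
     (if l < D * n then disc_gamma \<alpha> x D n (l + 1) - disc_gamma \<alpha> x D n l
      else disc_gamma \<alpha> x D n 1 + 1 - disc_gamma \<alpha> x D n l)"

definition well_separated :: "real \<Rightarrow> (nat \<Rightarrow> real) \<Rightarrow> nat \<Rightarrow> bool" where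
  "well_separated \<alpha> x D \<longleftrightarrow>
     (\<exists>c>0. \<exists>Q. infinite Q \<and> Q \<subseteq> range (conv_denom \<alpha>) \<and>
        (\<forall>q\<in>Q. \<forall>l\<in>{1..D * q}. disc_gap \<alpha> x D q l \<ge> c / real q))"


section \<open>Cocycles and essential values\<close>

text \<open>For \<open>N \<ge> 0\<close> the second sum is empty, for \<open>N \<le> 0\<close> the first one is.\<close>

definition cocycle_sum :: "real \<Rightarrow> (real \<Rightarrow> 'a::ab_group_add) \<Rightarrow> int \<Rightarrow> real \<Rightarrow> 'a" where
  "cocycle_sum \<alpha> \<Phi> N x =
     (\<Sum>k\<in>{0..<N}. \<Phi> (rot (of_int k * \<alpha>) x)) - (\<Sum>k\<in>{N..<0}. \<Phi> (rot (of_int k * \<alpha>) x))"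

lemma cocycle_sum_nat:
  assumes "x \<in> {0..<1}"
  shows "cocycle_sum \<alpha> \<Phi> (int n) x = (\<Sum>k<n. \<Phi> ((rot \<alpha> ^^ k) x))"
proof -
  have "(\<Sum>k\<in>{0..<int n}. \<Phi> (rot (of_int k * \<alpha>) x)) = (\<Sum>k<n. \<Phi> (rot (of_int (int k) * \<alpha>) x))"
    by (rule sum.reindex_bij_witness[of _ int nat]) auto
  then show ?thesis
    using assms by (simp add: cocycle_sum_def rot_funpow)
qed

lemma cocycle_sum_Suc:
  "cocycle_sum \<alpha> \<Phi> (N + 1) x = cocycle_sum \<alpha> \<Phi> N x + \<Phi> (rot (of_int N * \<alpha>) x)"
proof (cases "N \<ge> 0")
  case True
  then have "{0..<N + 1} = insert N {0..<N}" by auto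
  then show ?thesis using True by (simp add: cocycle_sum_def)
next
  case False
  then have "{N..<0} = insert N {N + 1..<0}" by auto
  then show ?thesis using False by (simp add: cocycle_sum_def)
qed

lemma cocycle_sum_add:
  "cocycle_sum \<alpha> \<Phi> (n + k) x = cocycle_sum \<alpha> \<Phi> n x + cocycle_sum \<alpha> \<Phi> k (rot (of_int n * \<alpha>) x)"
proof (induction k rule: int_induct[where k = 0])
  case base
  then show ?case by (simp add: cocycle_sum_def)
next
  case (step1 i)
  then show ?case
    using cocycle_sum_Suc[of \<alpha> \<Phi> "n + i" x]
      cocycle_sum_Suc[of \<alpha> \<Phi> i "rot (of_int n * \<alpha>) x"]
    by (simp add: rot_rot algebra_simps)
next
  case (step2 i)
  then show ?case
    using cocycle_sum_Suc[of \<alpha> \<Phi> "n + i - 1" x]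
      cocycle_sum_Suc[of \<alpha> \<Phi> "i - 1" "rot (of_int n * \<alpha>) x"]
    by (simp add: rot_rot algebra_simps)
qed

definition essential_values :: "real \<Rightarrow> (real \<Rightarrow> 'a::euclidean_space) \<Rightarrow> 'a set" where
  "essential_values \<alpha> \<Phi> =
     {g. \<forall>U A. open U \<longrightarrow> g \<in> U \<longrightarrow> A \<in> sets torus \<longrightarrow> emeasure torus A > 0 \<longrightarrow>
        (\<exists>N::int. emeasure torus
           {x \<in> A. rot (of_int N * \<alpha>) x \<in> A \<and> cocycle_sum \<alpha> \<Phi> N x \<in> U} > 0)}"


section \<open>Regular cocycles\<close>

definition cohomologous :: "real \<Rightarrow> (real \<Rightarrow> 'a::euclidean_space) \<Rightarrow> (real \<Rightarrow> 'a) \<Rightarrow> bool" where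
  "cohomologous \<alpha> \<Phi> \<Psi> \<longleftrightarrow>
     (\<exists>f\<in>borel_measurable torus. AE x in torus. \<Phi> x - \<Psi> x = f x - f (rot \<alpha> x))"

definition closed_subgroup :: "'a::euclidean_space set \<Rightarrow> bool" where
  "closed_subgroup H \<longleftrightarrow> closed H \<and> 0 \<in> H \<and> (\<forall>g\<in>H. \<forall>h\<in>H. g + h \<in> H) \<and> (\<forall>h\<in>H. - h \<in> H)"

text \<open>A Haar measure on \<open>H\<close>: a nonzero, translation-invariant Borel measure that is finite on compact
  sets.  (Regularity is automatic on closed subgroups of a Euclidean space.)  It is unique up to a
  positive constant factor.\<close>

definition haar_measure_on :: "'a::euclidean_space set \<Rightarrow> 'a measure \<Rightarrow> bool" where
  "haar_measure_on H \<nu> \<longleftrightarrow>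
     sets \<nu> = sets (restrict_space borel H) \<and>
     emeasure \<nu> H \<noteq> 0 \<and>
     (\<forall>h\<in>H. \<forall>A\<in>sets \<nu>. emeasure \<nu> ((\<lambda>y. h + y) ` A) = emeasure \<nu> A) \<and>
     (\<forall>K. compact K \<longrightarrow> K \<subseteq> H \<longrightarrow> emeasure \<nu> K < \<infinity>)"

definition ergodic_on :: "'a measure \<Rightarrow> ('a \<Rightarrow> 'a) \<Rightarrow> bool" where
  "ergodic_on M S \<longleftrightarrow>
     S \<in> measurable M M \<and> distr M M S = M \<and>
     (\<forall>A\<in>sets M. S -` A \<inter> space M = A \<longrightarrow> A \<in> null_sets M \<or> space M - A \<in> null_sets M)"

definition skew_product ::
  "real \<Rightarrow> (real \<Rightarrow> 'a::euclidean_space) \<Rightarrow> real \<times> 'a \<Rightarrow> real \<times> 'a" where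
  "skew_product \<alpha> \<Psi> = (\<lambda>(x, h). (rot \<alpha> x, h + \<Psi> x))"

definition regular_cocycle :: "real \<Rightarrow> (real \<Rightarrow> 'a::euclidean_space) \<Rightarrow> bool" where
  "regular_cocycle \<alpha> \<Phi> \<longleftrightarrow>
     (\<exists>\<Psi> H. \<Psi> \<in> borel_measurable torus \<and> closed_subgroup H \<and> (\<forall>x\<in>{0..<1}. \<Psi> x \<in> H) \<and>
        cohomologous \<alpha> \<Phi> \<Psi> \<and>
        (\<exists>\<nu>. haar_measure_on H \<nu> \<and> ergodic_on (torus \<Otimes>\<^sub>M \<nu>) (skew_product \<alpha> \<Psi>)))"

end

theory Submission imports Defs begin

text \<open>Along denominators \<open>q\<close> of \<open>\<alpha>\<close> the sums \<open>\<Phi>\<^sub>q\<close> are bounded (Denjoy-Koksma) and \<open>T\<^sup>q\<close> tends to the identity,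
  so a value that \<open>\<Phi>\<^sub>q\<close> approaches on a set of measure bounded below, for infinitely many \<open>q\<close>, is essential.
  Well separated discontinuities give arcs of total length \<open>c\<close> on both sides of the points \<open>x\<^sub>i - k\<alpha>\<close>
  on which \<open>\<Phi>\<^sub>q\<close> takes pairs of values \<open>g\<close>, \<open>g + \<sigma>\<^sub>i\<close>; hence \<open>\<sigma>\<^sub>i\<close> is a difference of essential values.

  Modulo \<open>H = \<E>(\<Phi>)\<close> the cocycle is therefore a constant \<open>v\<close>.  Boundedness of \<open>\<Phi>\<^sub>q\<close> forces \<open>v \<in> \<alpha> w + H\<close>
  for some \<open>w \<in> H\<close>, so subtracting the coboundary of \<open>x \<mapsto> -x w\<close> gives an \<open>H\<close>-valued cocycle \<open>\<Psi>\<close> with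
  \<open>H \<subseteq> \<E>(\<Psi>)\<close>.  Sets invariant under its skew product are then invariant under all translations by \<open>H\<close>,
  and ergodicity follows from that of \<open>T\<close>.\<close>

section \<open>Rotations of the circle\<close>

text \<open>The values of \<open>\<Phi>\<^sub>q\<close> form a finite set that may move with
  \<open>q\<close>, so no single value can be followed along the denominators. Essential values are
  therefore reached by contradiction: a \<open>g\<close> that is not essential has a neighbourhood
  in which \<open>\<Phi>\<^sub>q\<close> lies only on sets of vanishing measure, and compactness of
  the Denjoy-Koksma ball combines finitely many such neighbourhoods. The second obstacle is that
  \<open>H\<close> may mix lines with a lattice, and that \<open>v\<close> is known only modulo
  \<open>H\<close>. The vector \<open>w\<close> arises as the slope of a line: limits of vectors in
  \<open>n v + H\<close> with \<open>n \<alpha>\<close> tending to 0 modulo 1 are again essential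
  values, so the closed group recording pairs of rotation and value has only \<open>H\<close> on its
  vertical axis, while the bounded sums supply small elements off that axis. Haar measure on
  \<open>H\<close> is built from Lebesgue measure of the ambient space, so that continuity of
  Lebesgue measure under small translations is available for the fibres of the skew product.\<close>

lemma small_translation_open:
  fixes E :: "'a::euclidean_space set"
  assumes "open E" and fin: "emeasure lborel E < \<infinity>" and "0 < (e::real)"
  shows "\<exists>\<delta>>0. \<forall>u. norm u < \<delta> \<longrightarrow> emeasure lborel {z \<in> E. z + u \<notin> E} < e"
proof -
  \<comment> \<open>The open \<open>1/(n+1)\<close>-neighbourhood of the complement. A shift of
    smaller norm can only push points of \<open>E \<inter> B n\<close> out of \<open>E\<close>, and
    these sets decrease to the empty set because \<open>E\<close> is open.\<close>
  define B where "B n = (\<Union>w\<in>- E. ball w (1 / real (Suc n)))" for n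
  have opB: "open (B n)" for n by (auto simp: B_def)
  have [measurable]: "B n \<in> sets borel" "E \<in> sets borel" for n using opB assms(1) by auto
  have "(\<lambda>n. emeasure lborel (E \<inter> B n)) \<longlonglongrightarrow> emeasure lborel (\<Inter>n. E \<inter> B n)"
  proof (rule Lim_emeasure_decseq)
    show "range (\<lambda>n. E \<inter> B n) \<subseteq> sets lborel" by auto
    show "decseq (\<lambda>n. E \<inter> B n)"
    proof (rule decseq_SucI)
      fix n
      have "1 / real (Suc (Suc n)) \<le> 1 / real (Suc n)" by (simp add: field_simps)
      then have "B (Suc n) \<subseteq> B n"
        unfolding B_def by (auto intro!: UN_mono subset_ball)
      then show "E \<inter> B (Suc n) \<subseteq> E \<inter> B n" by auto
    qed
    have "emeasure lborel (E \<inter> B n) \<le> emeasure lborel E" for n by (rule emeasure_mono) auto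
    then show "emeasure lborel (E \<inter> B n) \<noteq> \<infinity>" for n
      using fin by (metis infinity_ennreal_def leD top_greatest order.strict_trans1)
  qed
  moreover have "(\<Inter>n. E \<inter> B n) = {}"
  proof (rule ccontr)
    assume "(\<Inter>n. E \<inter> B n) \<noteq> {}"
    then obtain z where z: "z \<in> E" "\<And>n. z \<in> B n" by auto
    obtain r where r: "r > 0" "ball z r \<subseteq> E" using assms(1) z(1) openE by blast
    obtain n where n: "1 / real (Suc n) < r" using r(1) nat_approx_posE by blast
    from z(2)[of n] obtain w where w: "w \<notin> E" "dist w z < 1 / real (Suc n)" by (auto simp: B_def)
    then have "w \<in> ball z r" using n by (auto simp: dist_commute)
    then show False using w r by auto
  qed
  ultimately have "(\<lambda>n. emeasure lborel (E \<inter> B n)) \<longlonglongrightarrow> 0" by simp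
  then have "\<forall>\<^sub>F n in sequentially. emeasure lborel (E \<inter> B n) < ennreal e"
    using assms(3) by (intro order_tendstoD) auto
  then obtain n where n: "emeasure lborel (E \<inter> B n) < ennreal e"
    by (auto simp: eventually_sequentially)
  show ?thesis
  proof (intro exI[of _ "1 / real (Suc n)"] conjI allI impI)
    fix u :: 'a assume u: "norm u < 1 / real (Suc n)"
    have "{z \<in> E. z + u \<notin> E} \<subseteq> E \<inter> B n"
      unfolding B_def using u by (auto simp: dist_norm intro!: bexI[of _ "_ + u"])
    then have "emeasure lborel {z \<in> E. z + u \<notin> E} \<le> emeasure lborel (E \<inter> B n)"
      by (intro emeasure_mono) auto
    then show "emeasure lborel {z \<in> E. z + u \<notin> E} < e" using n by simp
  qed simp
qed

lemma emeasure_lborel_translate: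
  fixes A :: "'a::euclidean_space set"
  assumes "A \<in> sets borel"
  shows "emeasure lborel {z. z + u \<in> A} = emeasure lborel A"
proof -
  have "emeasure lborel A = emeasure (distr lborel borel ((+) u)) A"
    by (simp add: lborel_distr_plus)
  also have "\<dots> = emeasure lborel ((+) u -` A \<inter> space lborel)"
    using assms by (intro emeasure_distr) auto
  also have "(+) u -` A \<inter> space lborel = {z. z + u \<in> A}" by (auto simp: add.commute)
  finally show ?thesis by simp
qed

text \<open>Approximate \<open>A\<close> from outside by an open \<open>U\<close>. One half of
  \<open>e\<close> pays for points leaving \<open>U\<close>, the other for points landing in
  \<open>U - A\<close>, a set whose translates have the same measure.\<close>

lemma small_translation:
  fixes A :: "'a::euclidean_space set"
  assumes A[measurable]: "A \<in> sets borel" and fin: "emeasure lborel A < \<infinity>" and "0 < (e::real)"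
  shows "\<exists>\<delta>>0. \<forall>u. norm u < \<delta> \<longrightarrow> emeasure lborel {z \<in> A. z + u \<notin> A} < e"
proof -
  obtain U where U: "open U" "A \<subseteq> U" "emeasure lborel (U - A) < e/2"
    using outer_regular_lborel[OF A, of "e/2"] assms(3) by auto
  have [measurable]: "U \<in> sets borel" using U by auto
  have "emeasure lborel U \<le> emeasure lborel A + emeasure lborel (U - A)"
    using U(2) by (subst plus_emeasure) (auto simp: Un_absorb1)
  also have "\<dots> < \<infinity>" using fin U(3) by (auto simp: less_top[symmetric])
  finally obtain \<delta> where d: "\<delta> > 0" "\<And>u. norm u < \<delta> \<Longrightarrow> emeasure lborel {z \<in> U. z + u \<notin> U} < e/2"
    using small_translation_open[OF U(1), of "e/2"] assms(3) by auto
  show ?thesis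
  proof (intro exI[of _ \<delta>] conjI allI impI d(1))
    fix u :: 'a assume u: "norm u < \<delta>"
    have "emeasure lborel {z \<in> A. z + u \<notin> A}
        \<le> emeasure lborel ({z \<in> U. z + u \<notin> U} \<union> {z. z + u \<in> U - A})"
      using U(2) by (intro emeasure_mono) auto
    also have "\<dots> \<le> emeasure lborel {z \<in> U. z + u \<notin> U} + emeasure lborel {z. z + u \<in> U - A}"
      by (intro emeasure_subadditive) auto
    also have "emeasure lborel {z. z + u \<in> U - A} = emeasure lborel (U - A)"
      by (rule emeasure_lborel_translate) auto
    also have "emeasure lborel {z \<in> U. z + u \<notin> U} + emeasure lborel (U - A) < ennreal (e/2) + ennreal (e/2)"
      by (intro add_strict_mono d(2) u U(3))
    also have "\<dots> = e" using assms(3) by (simp flip: ennreal_plus)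
    finally show "emeasure lborel {z \<in> A. z + u \<notin> A} < e" .
  qed
qed

section \<open>The circle as a probability space and its rotations\<close>

lemma space_torus [simp]: "space torus = {0..<1}"
  by (simp add: torus_def space_restrict_space)

lemma sets_torus_iff: "A \<in> sets torus \<longleftrightarrow> A \<in> sets borel \<and> A \<subseteq> {0..<1}"
  unfolding torus_def by (subst sets_restrict_space_iff) auto

lemma sets_torus_space [simp, measurable]: "{0..<1} \<in> sets torus"
  by (simp add: sets_torus_iff)

lemma emeasure_torus: "A \<in> sets torus \<Longrightarrow> emeasure torus A = emeasure lborel A"
  unfolding torus_def by (subst emeasure_restrict_space)
    (auto simp: sets_torus_iff[unfolded torus_def])

interpretation torus: finite_measure torus
  by (rule finite_measureI) (subst emeasure_torus, auto simp: sets_torus_iff)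

lemma measure_torus_space [simp]: "measure torus {0..<1} = 1"
  unfolding measure_def by (subst emeasure_torus) (auto simp: sets_torus_iff)

lemma rot_in [simp]: "0 \<le> rot t x" "rot t x < 1" "rot t x \<in> {0..<1}"
  by (auto simp: rot_def frac_lt_1)

lemma borel_measurable_frac [measurable]: "(frac :: real \<Rightarrow> real) \<in> borel_measurable borel"
  unfolding frac_def[abs_def] by measurable

lemma measurable_rot [measurable]: "rot t \<in> measurable torus torus"
proof -
  have "rot t \<in> borel_measurable lborel" unfolding rot_def[abs_def] by measurable
  then show ?thesis unfolding torus_def
    by (intro measurable_restrict_space3) (auto simp: rot_def frac_lt_1)
qed

lemma distr_rot: "distr torus torus (rot t) = torus"
proof (rule measure_eqI)
  fix A assume "A \<in> sets (distr torus torus (rot t))"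
  then have A: "A \<in> sets torus" by simp
  then have [measurable]: "A \<in> sets borel" and sub: "A \<subseteq> {0..<1}" by (auto simp: sets_torus_iff)
  define s where "s = frac t"
  have s: "0 \<le> s" "s < 1" by (auto simp: s_def frac_lt_1)
  have rs: "rot t x = (if x + s < 1 then x + s else x + s - 1)" if "x \<in> {0..<1}" for x
    using that frac_eq[of x] unfolding rot_def s_def by (subst frac_add) auto
  \<comment> \<open>The preimage splits according to whether the addition wraps around; on each part
    the rotation is a translation of the line.\<close>
  have eq: "rot t -` A \<inter> space torus = {x. x + s \<in> A \<inter> {s..<1}} \<union> {x. x + (s - 1) \<in> A \<inter> {0..<s}}"
    using sub s rs by (auto split: if_splits simp: algebra_simps)
  have "emeasure (distr torus torus (rot t)) A = emeasure torus (rot t -` A \<inter> space torus)"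
    using A by (intro emeasure_distr) auto
  also have "\<dots> = emeasure lborel (rot t -` A \<inter> space torus)"
    by (intro emeasure_torus measurable_sets[OF measurable_rot A])
  also have "\<dots> = emeasure lborel {x. x + s \<in> A \<inter> {s..<1}} + emeasure lborel {x. x + (s - 1) \<in> A \<inter> {0..<s}}"
    unfolding eq using s by (intro plus_emeasure[symmetric]) auto
  also have "\<dots> = emeasure lborel (A \<inter> {s..<1}) + emeasure lborel (A \<inter> {0..<s})"
    by (subst (1 2) emeasure_lborel_translate) auto
  also have "\<dots> = emeasure lborel (A \<inter> {s..<1} \<union> A \<inter> {0..<s})"
    by (intro plus_emeasure) auto
  also have "A \<inter> {s..<1} \<union> A \<inter> {0..<s} = A" using sub s by auto
  finally show "emeasure (distr torus torus (rot t)) A = emeasure torus A"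
    using emeasure_torus[OF A] by simp
qed simp

definition rot_vimage :: "real \<Rightarrow> real set \<Rightarrow> real set" where
  "rot_vimage t A = {x \<in> {0..<1}. rot t x \<in> A}"

lemma sets_rot_vimage [measurable]: "A \<in> sets torus \<Longrightarrow> rot_vimage t A \<in> sets torus"
proof -
  assume "A \<in> sets torus"
  moreover have "rot_vimage t A = rot t -` A \<inter> space torus" by (auto simp: rot_vimage_def)
  ultimately show ?thesis using measurable_sets[OF measurable_rot] by simp
qed

lemma emeasure_rot_vimage:
  assumes "A \<in> sets torus"
  shows "emeasure torus (rot_vimage t A) = emeasure torus A"
proof -
  have "emeasure torus A = emeasure (distr torus torus (rot t)) A" by (simp add: distr_rot)
  also have "\<dots> = emeasure torus (rot t -` A \<inter> space torus)" using assms by (intro emeasure_distr) auto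
  also have "rot t -` A \<inter> space torus = rot_vimage t A" by (auto simp: rot_vimage_def)
  finally show ?thesis by simp
qed

lemma measure_rot_vimage: "A \<in> sets torus \<Longrightarrow> measure torus (rot_vimage t A) = measure torus A"
  by (simp add: measure_def emeasure_rot_vimage)

lemma rot_vimage_rot_vimage: "rot_vimage s (rot_vimage t A) = rot_vimage (s + t) A"
  by (auto simp: rot_vimage_def rot_rot)

lemma rot_vimage_mono: "A \<subseteq> B \<Longrightarrow> rot_vimage t A \<subseteq> rot_vimage t B"
  by (auto simp: rot_vimage_def)

lemma rot_zero [simp]: "x \<in> {0..<1} \<Longrightarrow> rot 0 x = x"
  by (simp add: rot_def frac_eq)

lemma rot_add_int [simp]: "rot (t + of_int m) x = rot t x"
  by (simp add: rot_def frac_def add.assoc[symmetric])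

lemma rot_diff_int [simp]: "rot (t - of_int m) x = rot t x"
  using rot_add_int[of t "- m" x] by simp

text \<open>If \<open>x + t\<close> lies in \<open>A\<close> then nothing wraps around and
  \<open>rot t x = x + t\<close>. Hence the loss on the circle is at most the loss on the
  line.\<close>

lemma rot_small:
  assumes A: "A \<in> sets torus" and "0 < (e::real)"
  shows "\<exists>\<delta>>0. \<forall>t. \<bar>t\<bar> < \<delta> \<longrightarrow> measure torus (A - rot_vimage t A) < e"
proof -
  have B: "A \<in> sets borel" "A \<subseteq> {0..<1}" using A by (auto simp: sets_torus_iff)
  have "emeasure lborel A < \<infinity>" using torus.emeasure_finite[of A] emeasure_torus[OF A]
    by (simp add: less_top[symmetric])
  then obtain \<delta> where d: "\<delta> > 0" "\<And>u. norm u < \<delta> \<Longrightarrow> emeasure lborel {z \<in> A. z + u \<notin> A} < e"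
    using small_translation[OF B(1) _ assms(2)] by auto
  show ?thesis
  proof (intro exI[of _ \<delta>] conjI allI impI d(1))
    fix t :: real assume t: "\<bar>t\<bar> < \<delta>"
    have [measurable]: "A \<in> sets borel" by (rule B)
    have sub: "A - rot_vimage t A \<subseteq> {z \<in> A. z + t \<notin> A}"
    proof
      fix x assume x: "x \<in> A - rot_vimage t A"
      then have "x \<in> A" "rot t x \<notin> A" using B by (auto simp: rot_vimage_def)
      moreover have "rot t x = x + t" if "x + t \<in> A"
        using that B unfolding rot_def by (auto simp: frac_eq)
      ultimately show "x \<in> {z \<in> A. z + t \<notin> A}" by auto
    qed
    have "emeasure torus (A - rot_vimage t A) = emeasure lborel (A - rot_vimage t A)"
      using A by (intro emeasure_torus) auto
    also have "\<dots> \<le> emeasure lborel {z \<in> A. z + t \<notin> A}"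
      by (intro emeasure_mono sub) measurable
    also have "\<dots> < ennreal e" using d(2)[of t] t by simp
    finally show "measure torus (A - rot_vimage t A) < e"
      using assms(2) by (simp add: torus.emeasure_eq_measure ennreal_less_iff)
  qed
qed

section \<open>Irrational rotations: density of orbits and ergodicity\<close>

lemma dense_multiples:
  assumes "\<alpha> \<notin> \<rat>" "0 < e"
  shows "\<exists>k h :: int. \<bar>of_int k * \<alpha> - of_int h - (t::real)\<bar> < e"
  using sequence_of_fractional_parts_is_dense[OF assms] by metis

text \<open>Invariance under multiples of \<open>\<alpha>\<close> allows \<open>t\<close> to be
  replaced by \<open>s\<close> arbitrarily close to 0 without changing the preimage; there
  \<open>rot_small\<close> makes the loss smaller than the positive value assumed.\<close>

lemma rot_invariant_all:
  assumes irr: "\<alpha> \<notin> \<rat>" and A: "A \<in> sets torus" and inv: "\<And>k::int. rot_vimage (of_int k * \<alpha>) A = A"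
  shows "measure torus (A - rot_vimage t A) = 0"
proof (rule ccontr)
  assume "measure torus (A - rot_vimage t A) \<noteq> 0"
  then have "0 < measure torus (A - rot_vimage t A)" by (simp add: zero_less_measure_iff)
  then obtain \<delta> where d: "\<delta> > 0"
    "\<And>s. \<bar>s\<bar> < \<delta> \<Longrightarrow> measure torus (A - rot_vimage s A) < measure torus (A - rot_vimage t A)"
    using rot_small[OF A] by meson
  obtain k h :: int where kh: "\<bar>of_int k * \<alpha> - of_int h - t\<bar> < \<delta>"
    using dense_multiples[OF irr d(1)] by blast
  define s where "s = t - of_int k * \<alpha> + of_int h"
  have "rot_vimage s A = rot_vimage s (rot_vimage (of_int k * \<alpha>) A)" by (simp add: inv)
  also have "\<dots> = rot_vimage (t + of_int h) A" by (simp add: rot_vimage_rot_vimage s_def)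
  also have "\<dots> = rot_vimage t A" by (simp add: rot_vimage_def)
  finally have "rot_vimage s A = rot_vimage t A" .
  with d(2)[of s] kh show False by (simp add: s_def abs_minus_commute algebra_simps)
qed

text \<open>Lets angle and point exchange roles in the Fubini argument of
  \<open>rot_ergodic\<close>.\<close>

lemma rot_commute: "rot t x = rot x t"
  by (simp add: rot_def add.commute)

text \<open>By density \<open>A\<close> is almost invariant under every rotation \<open>t\<close>.
  Fubini yields, for almost every \<open>x\<close> in \<open>A\<close>, that
  \<open>rot t x \<in> A\<close> for almost all \<open>t\<close>; as
  \<open>rot t x = rot x t\<close>, the set \<open>rot_vimage x A\<close> is then full, and it has
  the measure of \<open>A\<close>.\<close>

lemma rot_ergodic:
  assumes irr: "\<alpha> \<notin> \<rat>" and A: "A \<in> sets torus" and inv: "rot_vimage \<alpha> A = A"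
  shows "measure torus A = 0 \<or> measure torus A = 1"
proof -
  have sub: "A \<subseteq> {0..<1}" using A by (simp add: sets_torus_iff)
  have pw: "rot_vimage (of_int k * \<alpha>) A = A" for k :: int
  proof (induction k rule: int_induct[where k = 0])
    case base
    then show ?case using sub by (auto simp: rot_vimage_def)
  next
    case (step1 i)
    then show ?case using rot_vimage_rot_vimage[of "of_int i * \<alpha>" \<alpha> A]
      by (simp add: inv algebra_simps)
  next
    case (step2 i)
    have "rot_vimage (of_int (i - 1) * \<alpha>) A = rot_vimage (of_int (i - 1) * \<alpha>) (rot_vimage \<alpha> A)"
      by (simp add: inv)
    also have "\<dots> = A" using step2 by (simp add: rot_vimage_rot_vimage algebra_simps)
    finally show ?case .
  qed
  have null: "measure torus (A - rot_vimage t A) = 0" for t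
    by (rule rot_invariant_all[OF irr A pw])
  interpret P: pair_sigma_finite torus torus ..
  have [measurable]: "A \<in> sets torus" by (rule A)
  have mr: "(\<lambda>p. rot (fst p) (snd p)) \<in> measurable (torus \<Otimes>\<^sub>M torus) torus"
  proof -
    have "(\<lambda>p. rot (fst p) (snd p)) \<in> borel_measurable (torus \<Otimes>\<^sub>M torus)"
      unfolding rot_def
      by (intro measurable_compose[OF _ borel_measurable_frac] borel_measurable_add
          measurable_compose[OF measurable_fst] measurable_compose[OF measurable_snd])
        (auto simp: torus_def intro!: measurable_restrict_space1)
    then show ?thesis
      by (auto simp: measurable_def sets_torus_iff)
  qed
  have AE1: "AE t in torus. AE x in torus. \<not> (x \<in> A \<and> rot t x \<notin> A)"
  proof (rule AE_I2)
    fix t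
    show "AE x in torus. \<not> (x \<in> A \<and> rot t x \<notin> A)"
    proof (rule AE_I[of _ _ "A - rot_vimage t A"])
      show "{x \<in> space torus. \<not> \<not> (x \<in> A \<and> rot t x \<notin> A)} \<subseteq> A - rot_vimage t A"
        by (auto simp: rot_vimage_def)
      show "emeasure torus (A - rot_vimage t A) = 0" using null by (simp add: torus.emeasure_eq_measure)
      show "A - rot_vimage t A \<in> sets torus" by simp
    qed
  qed
  have "AE x in torus. AE t in torus. \<not> (x \<in> A \<and> rot t x \<notin> A)"
  proof (rule P.AE_commute[THEN iffD1, OF _ AE1])
    have m: "{p \<in> space (torus \<Otimes>\<^sub>M torus). snd p \<in> A \<and> rot (fst p) (snd p) \<notin> A} \<in> sets (torus \<Otimes>\<^sub>M torus)"
      using mr A by measurable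
    have eq: "{p \<in> space (torus \<Otimes>\<^sub>M torus). \<not> (snd p \<in> A \<and> rot (fst p) (snd p) \<notin> A)}
      = space (torus \<Otimes>\<^sub>M torus) - {p \<in> space (torus \<Otimes>\<^sub>M torus). snd p \<in> A \<and> rot (fst p) (snd p) \<notin> A}" by auto
    show "{p \<in> space (torus \<Otimes>\<^sub>M torus). \<not> (snd p \<in> A \<and> rot (fst p) (snd p) \<notin> A)} \<in> sets (torus \<Otimes>\<^sub>M torus)"
      unfolding eq by (rule sets.compl_sets[OF m])
  qed
  then have AE2: "AE x in torus. x \<in> A \<longrightarrow> measure torus A = 1"
  proof (rule AE_mp, intro AE_I2 impI)
    fix x assume x: "x \<in> A" and ae: "AE t in torus. \<not> (x \<in> A \<and> rot t x \<notin> A)"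
    have "measure torus A = measure torus (rot_vimage x A)" using A by (simp add: measure_rot_vimage)
    also have "\<dots> = measure torus (space torus)"
    proof (rule torus.finite_measure_eq_AE)
      show "AE t in torus. t \<in> rot_vimage x A \<longleftrightarrow> t \<in> space torus"
        using ae by eventually_elim (use x in \<open>auto simp: rot_vimage_def rot_commute\<close>)
    qed (use A in auto)
    finally show "measure torus A = 1" by simp
  qed
  show ?thesis
  proof (cases "measure torus A = 1")
    case False
    with AE2 have "AE x in torus. x \<notin> A" by auto
    then have "emeasure torus A = 0" using A sub by (subst (asm) AE_iff_measurable[OF A]) auto
    then show ?thesis by (simp add: measure_def)
  qed simp
qed

text \<open>By ergodicity the preimages of \<open>A\<close> cover the circle up to a null set, and
  finitely many of them cover all but \<open>r/2\<close>. On each one \<open>B n\<close> becomes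
  small, since passing to the next preimage costs only the defect of invariance
  \<open>ai\<close>.\<close>

lemma vanishes_if_vanishes_on_positive_set:
  assumes irr: "\<alpha> \<notin> \<rat>" and A: "A \<in> sets torus" "measure torus A > 0"
    and B: "\<And>n. B n \<in> sets torus"
    and ai: "(\<lambda>n. measure torus (B n - rot_vimage \<alpha> (B n))) \<longlonglongrightarrow> 0"
    and AB: "(\<lambda>n. measure torus (A \<inter> B n)) \<longlonglongrightarrow> 0"
  shows "(\<lambda>n. measure torus (B n)) \<longlonglongrightarrow> 0"
proof -
  note [measurable] = A(1) B
  define S where "S = (\<Union>k::nat. rot_vimage (real k * \<alpha>) A)"

  define R where "R m = (\<Union>k<m. rot_vimage (real k * \<alpha>) A)" for m :: nat
  have [measurable]: "S \<in> sets torus" "R m \<in> sets torus" for m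
    by (auto simp: S_def R_def)
  have SS: "rot_vimage \<alpha> S \<subseteq> S"
  proof
    fix x assume "x \<in> rot_vimage \<alpha> S"
    then obtain k :: nat where "x \<in> rot_vimage \<alpha> (rot_vimage (real k * \<alpha>) A)"
      by (auto simp: S_def rot_vimage_def)
    then have "x \<in> rot_vimage (real (Suc k) * \<alpha>) A" by (simp add: rot_vimage_rot_vimage algebra_simps)
    then show "x \<in> S" unfolding S_def by blast
  qed
  \<comment> \<open>Only \<open>rot_vimage \<alpha> S \<subseteq> S\<close> is known. The decreasing
    intersection of the preimages is truly invariant and has the same measure as
    \<open>S\<close>.\<close>
  define I where "I = (\<Inter>k::nat. rot_vimage (real k * \<alpha>) S)"
  have [measurable]: "I \<in> sets torus" by (auto simp: I_def)
  have ddec: "decseq (\<lambda>k. rot_vimage (real k * \<alpha>) S)"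
  proof (rule decseq_SucI)
    fix k
    have "rot_vimage (real (Suc k) * \<alpha>) S = rot_vimage (real k * \<alpha>) (rot_vimage \<alpha> S)"
      by (simp add: rot_vimage_rot_vimage algebra_simps)
    then show "rot_vimage (real (Suc k) * \<alpha>) S \<subseteq> rot_vimage (real k * \<alpha>) S"
      by (simp only: rot_vimage_mono[OF SS])
  qed
  have "(\<lambda>k. measure torus (rot_vimage (real k * \<alpha>) S)) \<longlonglongrightarrow> measure torus I"
    unfolding I_def by (rule torus.finite_Lim_measure_decseq[OF _ ddec]) auto
  then have mI: "measure torus I = measure torus S"
    by (simp add: measure_rot_vimage LIMSEQ_const_iff)
  have "rot_vimage \<alpha> I = I"
  proof -
    have "rot_vimage \<alpha> I = (\<Inter>k::nat. rot_vimage (real (Suc k) * \<alpha>) S)"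
    proof -
      have "rot_vimage \<alpha> I = (\<Inter>k::nat. rot_vimage \<alpha> (rot_vimage (real k * \<alpha>) S))"
        by (auto simp: I_def rot_vimage_def)
      then show ?thesis by (simp add: rot_vimage_rot_vimage algebra_simps)
    qed
    also have "\<dots> = I"
    proof
      show "I \<subseteq> (\<Inter>k::nat. rot_vimage (real (Suc k) * \<alpha>) S)" unfolding I_def by blast
      show "(\<Inter>k::nat. rot_vimage (real (Suc k) * \<alpha>) S) \<subseteq> I"
        unfolding I_def by (rule INT_greatest) (use decseq_SucD[OF ddec] in blast)
    qed
    finally show ?thesis .
  qed
  then have "measure torus I = 0 \<or> measure torus I = 1" by (intro rot_ergodic[OF irr]) auto
  moreover have "measure torus A \<le> measure torus S"
  proof (rule torus.finite_measure_mono)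
    have "A \<subseteq> rot_vimage (real 0 * \<alpha>) A" using sets.sets_into_space[OF A(1)] by (auto simp: rot_vimage_def)
    then show "A \<subseteq> S" unfolding S_def by blast
  qed simp
  ultimately have S1: "measure torus S = 1" using A(2) mI by auto
  have "(\<lambda>m. measure torus (R m)) \<longlonglongrightarrow> measure torus (\<Union>m. R m)"
    by (rule torus.finite_Lim_measure_incseq) (fastforce simp: R_def incseq_def)+
  also have "(\<Union>m. R m) = S" by (auto simp: R_def S_def)
  finally have Rlim: "(\<lambda>m. measure torus (R m)) \<longlonglongrightarrow> 1" by (simp add: S1)
  have step: "(\<lambda>n. measure torus (rot_vimage (real k * \<alpha>) A \<inter> B n)) \<longlonglongrightarrow> 0" for k :: nat
  proof (induction k)
    case 0
    have "rot_vimage (real 0 * \<alpha>) A = A" using sets.sets_into_space[OF A(1)] by (auto simp: rot_vimage_def)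
    then show ?case using AB by simp
  next
    case (Suc k)
    \<comment> \<open>A point of \<open>B n\<close> either moves into \<open>B n\<close>, and then
      lies in the preimage of the previous set, or belongs to the defect.\<close>
    have le: "measure torus (rot_vimage (real (Suc k) * \<alpha>) A \<inter> B n)
       \<le> measure torus (rot_vimage (real k * \<alpha>) A \<inter> B n) + measure torus (B n - rot_vimage \<alpha> (B n))" for n
    proof -
      have "measure torus (rot_vimage (real (Suc k) * \<alpha>) A \<inter> B n)
         \<le> measure torus (rot_vimage \<alpha> (rot_vimage (real k * \<alpha>) A \<inter> B n) \<union> (B n - rot_vimage \<alpha> (B n)))"
      proof (rule torus.finite_measure_mono)
        have "rot_vimage (real (Suc k) * \<alpha>) A = rot_vimage \<alpha> (rot_vimage (real k * \<alpha>) A)"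
          by (simp add: rot_vimage_rot_vimage algebra_simps)
        then show "rot_vimage (real (Suc k) * \<alpha>) A \<inter> B n
            \<subseteq> rot_vimage \<alpha> (rot_vimage (real k * \<alpha>) A \<inter> B n) \<union> (B n - rot_vimage \<alpha> (B n))"
          by (auto simp: rot_vimage_def)
      qed auto
      also have "\<dots> \<le> measure torus (rot_vimage \<alpha> (rot_vimage (real k * \<alpha>) A \<inter> B n))
          + measure torus (B n - rot_vimage \<alpha> (B n))" by (rule measure_Un_le) auto
      finally show ?thesis by (simp add: measure_rot_vimage)
    qed
    show ?case
      by (rule Lim_null_comparison[OF _ tendsto_add_zero[OF Suc ai]]) (use le in \<open>auto simp del: of_nat_Suc\<close>)
  qed
  show ?thesis
  proof (rule LIMSEQ_I)
    fix r :: real assume r: "0 < r"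
    obtain m where m: "1 - r/2 < measure torus (R m)"
      using order_tendstoD(1)[OF Rlim, of "1 - r/2"] r by (auto simp: eventually_sequentially)
    have "(\<lambda>n. \<Sum>k<m. measure torus (rot_vimage (real k * \<alpha>) A \<inter> B n)) \<longlonglongrightarrow> 0"
      by (rule tendsto_null_sum) (rule step)
    then have "\<forall>\<^sub>F n in sequentially. (\<Sum>k<m. measure torus (rot_vimage (real k * \<alpha>) A \<inter> B n)) < r/2"
      using r by (intro order_tendstoD(2)) auto
    then obtain N where N: "\<And>n. n \<ge> N \<Longrightarrow> (\<Sum>k<m. measure torus (rot_vimage (real k * \<alpha>) A \<inter> B n)) < r/2"
      by (auto simp: eventually_sequentially)
    show "\<exists>no. \<forall>n\<ge>no. norm (measure torus (B n) - 0) < r"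
    proof (intro exI[of _ N] allI impI)
      fix n assume n: "n \<ge> N"
      have "measure torus (B n) \<le> measure torus ((\<Union>k<m. rot_vimage (real k * \<alpha>) A \<inter> B n) \<union> (space torus - R m))"
        using sets.sets_into_space[OF B[of n]] by (intro torus.finite_measure_mono) (auto simp: R_def, measurable)
      also have "\<dots> \<le> measure torus (\<Union>k<m. rot_vimage (real k * \<alpha>) A \<inter> B n) + measure torus (space torus - R m)"
        by (rule measure_Un_le) auto
      also have "measure torus (space torus - R m) = 1 - measure torus (R m)"
        by (subst torus.finite_measure_compl) auto
      also have "measure torus (\<Union>k<m. rot_vimage (real k * \<alpha>) A \<inter> B n)
          \<le> (\<Sum>k<m. measure torus (rot_vimage (real k * \<alpha>) A \<inter> B n))"
        by (rule torus.finite_measure_subadditive_finite) auto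
      finally show "norm (measure torus (B n) - 0) < r" using N[OF n] m by simp
    qed
  qed
qed

section \<open>Convergents\<close>

text \<open>The numerators of the convergents, against which \<open>q \<alpha>\<close> is compared
  in \<open>conv_error_Suc\<close>.\<close>

fun conv_num :: "real \<Rightarrow> nat \<Rightarrow> int" where
  "conv_num \<alpha> 0 = cf_partial \<alpha> 0"
| "conv_num \<alpha> (Suc 0) = cf_partial \<alpha> 1 * cf_partial \<alpha> 0 + 1"
| "conv_num \<alpha> (Suc (Suc n)) =
     cf_partial \<alpha> (Suc (Suc n)) * conv_num \<alpha> (Suc n) + conv_num \<alpha> n"

lemma cf_complete_irrational: "\<alpha> \<notin> \<rat> \<Longrightarrow> cf_complete \<alpha> n \<notin> \<rat>"
proof (induction n)
  case (Suc n)
  then show ?case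
    by (metis Rats_1 Rats_divide Rats_add Rats_of_int add.commute cf_complete.simps(2) diff_add_cancel
        div_by_1 divide_divide_eq_right frac_def mult_1)
qed simp

lemma frac_cf_complete_pos: "\<alpha> \<notin> \<rat> \<Longrightarrow> 0 < frac (cf_complete \<alpha> n)"
  using cf_complete_irrational[of \<alpha> n]
  by (metis Ints_subset_Rats frac_gt_0_iff subsetD)

lemma cf_complete_gt_1: "\<alpha> \<notin> \<rat> \<Longrightarrow> 1 < cf_complete \<alpha> (Suc n)"
  using frac_cf_complete_pos[of \<alpha> n] frac_lt_1[of "cf_complete \<alpha> n"] by simp

lemma cf_partial_ge_1: "\<alpha> \<notin> \<rat> \<Longrightarrow> 1 \<le> cf_partial \<alpha> (Suc n)"
  using cf_complete_gt_1[of \<alpha> n] unfolding cf_partial_def by linarith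

lemma conv_denom_ge_1: "\<alpha> \<notin> \<rat> \<Longrightarrow> 1 \<le> conv_denom \<alpha> n"
proof (induction n rule: conv_denom.induct)
  case (2 \<alpha>)
  then show ?case using cf_partial_ge_1[of \<alpha> 0] by simp
next
  case (3 \<alpha> n)
  then show ?case by simp
qed simp

lemma int_conv_denom_Suc_Suc:
  "\<alpha> \<notin> \<rat> \<Longrightarrow> int (conv_denom \<alpha> (Suc (Suc n))) =
     cf_partial \<alpha> (Suc (Suc n)) * int (conv_denom \<alpha> (Suc n)) + int (conv_denom \<alpha> n)"
  using cf_partial_ge_1[of \<alpha> "Suc n"] by simp

text \<open>Inserting both recursions cancels the partial quotient and flips the sign. The value
  \<open>\<plusminus>1\<close> gives coprimality as well as the size of the approximation
  error.\<close>

lemma conv_determinant: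
  "\<alpha> \<notin> \<rat> \<Longrightarrow> conv_num \<alpha> (Suc n) * int (conv_denom \<alpha> n) - conv_num \<alpha> n * int (conv_denom \<alpha> (Suc n)) = (-1) ^ n"
proof (induction n)
  case 0
  then show ?case using cf_partial_ge_1[of \<alpha> 0] by simp
next
  case (Suc n)
  have "conv_num \<alpha> (Suc (Suc n)) * int (conv_denom \<alpha> (Suc n)) - conv_num \<alpha> (Suc n) * int (conv_denom \<alpha> (Suc (Suc n)))
     = - (conv_num \<alpha> (Suc n) * int (conv_denom \<alpha> n) - conv_num \<alpha> n * int (conv_denom \<alpha> (Suc n)))"
    unfolding int_conv_denom_Suc_Suc[OF Suc.prems] conv_num.simps(3) by (simp only: algebra_simps)
  then show ?case using Suc by simp
qed

text \<open>The classical \<open>\<alpha> = (z p + p') / (z q + q')\<close> with complete quotient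
  \<open>z\<close>, multiplied out. Beginning at \<open>Suc (Suc n)\<close> avoids convergents of
  index -1; the induction replaces \<open>z\<close> by its integer part plus the inverse of the next
  complete quotient.\<close>

lemma conv_identity:
  assumes "\<alpha> \<notin> \<rat>"
  shows "\<alpha> * (cf_complete \<alpha> (Suc (Suc n)) * real (conv_denom \<alpha> (Suc n)) + real (conv_denom \<alpha> n))
    = cf_complete \<alpha> (Suc (Suc n)) * of_int (conv_num \<alpha> (Suc n)) + of_int (conv_num \<alpha> n)"
proof (induction n)
  case 0
  define a b where "a = \<alpha> - of_int (cf_partial \<alpha> 0)" and "b = 1 / a - of_int (cf_partial \<alpha> 1)"
  have fa: "frac \<alpha> = a" by (simp add: a_def cf_partial_def frac_def)
  have fb: "frac (cf_complete \<alpha> 1) = b" by (simp add: b_def cf_partial_def frac_def fa[symmetric])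
  have pos: "a > 0" "b > 0"
    using frac_cf_complete_pos[OF assms, of 0] frac_cf_complete_pos[OF assms, of 1]
    unfolding fb cf_complete.simps(1) fa by simp_all
  have d: "real (conv_denom \<alpha> (Suc 0)) = of_int (cf_partial \<alpha> 1)"
    using cf_partial_ge_1[OF assms, of 0] by simp
  have c: "cf_complete \<alpha> (Suc (Suc 0)) = 1 / b" using fb by simp
  have ab: "a * b = 1 - a * of_int (cf_partial \<alpha> 1)" using pos by (simp add: b_def algebra_simps)
  have "\<alpha> * (of_int (cf_partial \<alpha> 1) + b)
      = (of_int (cf_partial \<alpha> 0) + a) * (of_int (cf_partial \<alpha> 1) + b)"
    by (simp add: a_def)
  also have "\<dots> = of_int (cf_partial \<alpha> 0) * of_int (cf_partial \<alpha> 1)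
      + of_int (cf_partial \<alpha> 0) * b + (a * b + a * of_int (cf_partial \<alpha> 1))"
    by (simp only: algebra_simps)
  finally have "\<alpha> * (of_int (cf_partial \<alpha> 1) + b)
      = of_int (cf_partial \<alpha> 1) * of_int (cf_partial \<alpha> 0) + 1 + of_int (cf_partial \<alpha> 0) * b"
    unfolding ab by (simp add: algebra_simps)
  then show ?case unfolding c d conv_num.simps conv_denom.simps(1)
    using pos by (simp add: field_simps)
next
  case (Suc n)
  define z a where "z = cf_complete \<alpha> (Suc (Suc n))" and "a = cf_partial \<alpha> (Suc (Suc n))"
  have f: "frac z = z - of_int a" by (simp add: z_def a_def cf_partial_def frac_def)
  have pos: "z - of_int a > 0"
    using frac_cf_complete_pos[OF assms, of "Suc (Suc n)"] unfolding z_def[symmetric] f .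
  have z: "cf_complete \<alpha> (Suc (Suc (Suc n))) = 1 / (z - of_int a)"
    unfolding cf_complete.simps(2)[of \<alpha> "Suc (Suc n)"] z_def[symmetric] f by (rule refl)
  have d: "real (conv_denom \<alpha> (Suc (Suc n))) = of_int a * real (conv_denom \<alpha> (Suc n)) + real (conv_denom \<alpha> n)"
    using int_conv_denom_Suc_Suc[OF assms, of n] unfolding a_def
    by (metis of_int_add of_int_mult of_int_of_nat_eq)
  show ?case unfolding z d conv_num.simps(3) a_def[symmetric]
    using pos Suc.IH unfolding z_def[symmetric] by (simp add: field_simps)
qed

lemma coprime_conv: "\<alpha> \<notin> \<rat> \<Longrightarrow> coprime (conv_num \<alpha> n) (int (conv_denom \<alpha> n))"
proof (rule coprimeI)
  fix d assume irr: "\<alpha> \<notin> \<rat>" and d: "d dvd conv_num \<alpha> n" "d dvd int (conv_denom \<alpha> n)"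
  then have "d dvd (-1) ^ n" unfolding conv_determinant[OF irr, of n, symmetric] by simp
  then show "is_unit d" by (cases "even n") auto
qed

text \<open>The identity and the determinant give
  \<open>\<bar>q \<alpha> - p\<bar> (z q + q') = 1\<close>, and the factor exceeds \<open>q\<close>
  because \<open>z > 1\<close>.\<close>

lemma conv_error_Suc:
  assumes "\<alpha> \<notin> \<rat>"
  shows "\<bar>real (conv_denom \<alpha> (Suc n)) * \<alpha> - of_int (conv_num \<alpha> (Suc n))\<bar> < 1 / real (conv_denom \<alpha> (Suc n))"
proof -
  define z q p q' p' where "z = cf_complete \<alpha> (Suc (Suc n))" "q = real (conv_denom \<alpha> (Suc n))"
    "p = real_of_int (conv_num \<alpha> (Suc n))" "q' = real (conv_denom \<alpha> n)" "p' = real_of_int (conv_num \<alpha> n)"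
  note defs = this
  have q: "q \<ge> 1" "q' \<ge> 1" using conv_denom_ge_1[OF assms] unfolding defs by (simp_all del: conv_denom.simps)
  have z: "z > 1" unfolding defs by (rule cf_complete_gt_1[OF assms])
  have id: "\<alpha> * (z * q + q') = z * p + p'"
    using conv_identity[OF assms, of n] unfolding defs .
  have "p * q' - p' * q = of_int (conv_num \<alpha> (Suc n) * int (conv_denom \<alpha> n) - conv_num \<alpha> n * int (conv_denom \<alpha> (Suc n)))"
    unfolding defs by simp
  also have "\<dots> = (-1) ^ n" unfolding conv_determinant[OF assms] by simp
  finally have det: "p * q' - p' * q = (-1) ^ n" .
  have pos: "z * q + q' > q" using q z by (smt (verit) mult_le_cancel_right1)
  have "(q * \<alpha> - p) * (z * q + q') = q * (\<alpha> * (z * q + q')) - p * (z * q + q')" by (simp add: algebra_simps)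
  also have "\<dots> = - (p * q' - p' * q)" unfolding id by (simp add: algebra_simps)
  finally have "\<bar>q * \<alpha> - p\<bar> * (z * q + q') = 1"
    using pos q unfolding det by (metis abs_minus_cancel abs_mult abs_of_pos less_le_trans less_trans power_abs abs_1 power_one zero_less_one)
  then have "\<bar>q * \<alpha> - p\<bar> = 1 / (z * q + q')" using pos q by (simp add: field_simps)
  also have "\<dots> < 1 / q" using pos q by (simp add: frac_less2)
  finally show ?thesis unfolding defs .
qed

text \<open>The form in which continued fractions enter the rest of the proof. For index 0 the
  denominator is 1 and the error is \<open>frac \<alpha> < 1\<close>.\<close>

lemma conv_denom_approx:
  assumes "\<alpha> \<notin> \<rat>" "q \<in> range (conv_denom \<alpha>)"
  obtains p :: int where "coprime p (int q)" "\<bar>real q * \<alpha> - of_int p\<bar> < 1 / real q" "1 \<le> q"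
proof -
  obtain n where n: "q = conv_denom \<alpha> n" using assms(2) by auto
  have "\<bar>real q * \<alpha> - of_int (conv_num \<alpha> n)\<bar> < 1 / real q"
  proof (cases n)
    case 0
    then show ?thesis using n by (simp add: cf_partial_def frac_def[symmetric] frac_lt_1)
  next
    case (Suc m)
    then show ?thesis using n conv_error_Suc[OF assms(1), of m] by simp
  qed
  then show thesis using that coprime_conv[OF assms(1), of n] conv_denom_ge_1[OF assms(1), of n] n by blast
qed

section \<open>Step functions\<close>

lemma frac_add_of_int [simp]: "frac (t + of_int m) = frac (t::real)"
  by (simp add: frac_def)

lemma step_function_finite_range:
  assumes "step_function \<Phi>"
  shows "finite (\<Phi> ` {0..<1})"
proof -
  obtain P where P: "finite P" "partition_on {0..<1::real} P" "\<And>I. I \<in> P \<Longrightarrow> \<Phi> constant_on I"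
    using assms by (auto simp: step_function_def)
  have "\<Phi> ` {0..<1} = (\<Union>I\<in>P. \<Phi> ` I)" using P(2) by (auto simp: partition_on_def)
  moreover have "finite (\<Phi> ` I)" if I: "I \<in> P" for I
  proof -
    obtain y where "\<And>x. x \<in> I \<Longrightarrow> \<Phi> x = y" using P(3)[OF I] by (auto simp: constant_on_def)
    then have "\<Phi> ` I \<subseteq> {y}" by auto
    then show ?thesis by (rule finite_subset) simp
  qed
  ultimately show ?thesis using P(1) by simp
qed

lemma step_function_measurable:
  fixes \<Phi> :: "real \<Rightarrow> 'a::topological_space"
  assumes "step_function \<Phi>"
  shows "\<Phi> \<in> borel_measurable torus"
proof (rule measurableI)
  fix S :: "'a set"
  obtain P where P: "finite P" "partition_on {0..<1::real} P" "\<And>I. I \<in> P \<Longrightarrow> is_interval I"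
     "\<And>I. I \<in> P \<Longrightarrow> \<Phi> constant_on I"
    using assms by (auto simp: step_function_def)
  have sub: "I \<subseteq> {0..<1}" if "I \<in> P" for I using P(2) that by (auto simp: partition_on_def)
  have "\<Phi> -` S \<inter> space torus = (\<Union>I\<in>{I\<in>P. \<Phi> ` I \<inter> S \<noteq> {}}. I)"
  proof (intro equalityI subsetI)
    fix x assume x: "x \<in> \<Phi> -` S \<inter> space torus"
    then have "x \<in> \<Union>P" using P(2) by (simp add: partition_on_def)
    then obtain I where "I \<in> P" "x \<in> I" by blast
    then show "x \<in> (\<Union>I\<in>{I\<in>P. \<Phi> ` I \<inter> S \<noteq> {}}. I)" using x by auto
  next
    fix x assume "x \<in> (\<Union>I\<in>{I\<in>P. \<Phi> ` I \<inter> S \<noteq> {}}. I)"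
    then obtain I y where I: "I \<in> P" "x \<in> I" "y \<in> I" "\<Phi> y \<in> S" by auto
    then have "\<Phi> x = \<Phi> y" using P(4)[OF I(1)] by (metis constant_on_def)
    then show "x \<in> \<Phi> -` S \<inter> space torus" using I sub[OF I(1)] by auto
  qed
  moreover have "I \<in> sets torus" if "I \<in> P" for I
    using real_interval_borel_measurable[OF P(3)[OF that]] sub[OF that] by (simp add: sets_torus_iff)
  ultimately show "\<Phi> -` S \<inter> space torus \<in> sets torus" using P(1) by auto
qed simp

lemma frac_notin_discontinuities:
  assumes "frac t \<notin> discontinuities \<Phi>"
  shows "isCont (\<lambda>t. \<Phi> (frac t)) t"
proof -
  have *: "isCont (\<lambda>t. \<Phi> (frac t)) (frac t)"
    using assms by (simp add: discontinuities_def frac_lt_1)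
  have "isCont (\<lambda>s. \<Phi> (frac (s - of_int \<lfloor>t\<rfloor>))) t"
    using * by (intro isCont_o2[where f = "\<lambda>s. s - of_int \<lfloor>t\<rfloor>" and g = "\<lambda>t. \<Phi> (frac t)"])
      (auto simp: frac_def)
  moreover have "frac (s - of_int \<lfloor>t\<rfloor>) = frac s" for s :: real
    using frac_add_of_int[of s "- \<lfloor>t\<rfloor>"] by simp
  ultimately show ?thesis by simp
qed

text \<open>A continuous image of \<open>S\<close> is connected and here also finite, hence a point.
  Working with the periodic extension lets \<open>S\<close> pass through integers.\<close>

lemma step_function_constant:
  fixes \<Phi> :: "real \<Rightarrow> 'a::metric_space"
  assumes "step_function \<Phi>" "connected S" "\<And>t. t \<in> S \<Longrightarrow> frac t \<notin> discontinuities \<Phi>" "s \<in> S" "t \<in> S"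
  shows "\<Phi> (frac s) = \<Phi> (frac t)"
proof -
  have "continuous_on S (\<lambda>t. \<Phi> (frac t))"
    using assms(3) frac_notin_discontinuities by (blast intro: continuous_at_imp_continuous_on)
  then have "connected ((\<lambda>t. \<Phi> (frac t)) ` S)" using assms(2) by (rule connected_continuous_image)
  moreover have "finite ((\<lambda>t. \<Phi> (frac t)) ` S)"
    by (rule finite_subset[OF _ step_function_finite_range[OF assms(1)]]) (auto simp: frac_lt_1)
  ultimately have "\<exists>y. (\<lambda>t. \<Phi> (frac t)) ` S = {y}"
    using connected_finite_iff_sing assms(4) by blast
  then show ?thesis using assms(4,5) by (metis (no_types, lifting) image_eqI singletonD)
qed

section \<open>The Denjoy-Koksma inequality\<close>

lemma sum_periodic_coprime:
  fixes f :: "int \<Rightarrow> 'a::comm_monoid_add"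
  assumes per: "\<And>m z. f (m + int q * z) = f m" and cop: "coprime p (int q)" and q: "1 \<le> q"
  shows "(\<Sum>k<q. f (int k * p + j)) = (\<Sum>k<q. f (int k))"
proof -
  define h where "h k = nat ((int k * p + j) mod int q)" for k
  \<comment> \<open>Multiplication by \<open>p\<close> is invertible modulo \<open>q\<close>, so
    \<open>k \<mapsto> k p + j\<close> permutes the residues.\<close>
  have inj: "inj_on h {..<q}"
  proof (rule inj_onI)
    fix k l assume kl: "k \<in> {..<q}" "l \<in> {..<q}" "h k = h l"
    then have "(int k * p + j) mod int q = (int l * p + j) mod int q"
      using q by (simp add: h_def nat_eq_iff)
    then have "int q dvd (int k - int l) * p"
      by (simp add: mod_eq_dvd_iff algebra_simps)
    then have "int q dvd (int k - int l)"
      using cop by (metis coprime_commute coprime_dvd_mult_left_iff)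
    then have "int k mod int q = int l mod int q" by (simp add: mod_eq_dvd_iff)
    then show "k = l" using kl by simp
  qed
  have "h ` {..<q} \<subseteq> {..<q}" using q by (auto simp: h_def nat_less_iff)
  then have im: "h ` {..<q} = {..<q}" using inj by (intro endo_inj_surj) auto
  have "f (int k * p + j) = f (int (h k))" for k
  proof -
    have "int (h k) = (int k * p + j) mod int q" using q by (simp add: h_def)
    then have "int k * p + j = int (h k) + int q * ((int k * p + j) div int q)" by simp
    then show ?thesis using per by metis
  qed
  then have "(\<Sum>k<q. f (int k * p + j)) = (\<Sum>k<q. f (int (h k)))" by simp
  also have "\<dots> = (\<Sum>k\<in>h ` {..<q}. f (int k))" using inj by (simp add: sum.reindex)
  finally show ?thesis by (simp add: im)
qed

lemma card_multiples_near:
  assumes cop: "coprime p (int q)" and q: "1 \<le> q"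
  shows "finite {k. k < q \<and> (\<exists>n. int k * p = e + int q * n)}"
    and "card {k. k < q \<and> (\<exists>n. int k * p = e + int q * n)} \<le> 1"
proof -
  show fin: "finite {k. k < q \<and> (\<exists>n. int k * p = e + int q * n)}" by simp
  have "k = l" if kl: "k < q" "l < q" "int k * p = e + int q * m" "int l * p = e + int q * n" for k l m n
  proof -
    have "(int k - int l) * p = int q * (m - n)" using kl(3,4) by (simp add: algebra_simps)
    then have "int q dvd (int k - int l) * p" by simp
    then have "int q dvd (int k - int l)"
      using cop by (metis coprime_commute coprime_dvd_mult_left_iff)
    then have "int k mod int q = int l mod int q" by (simp add: mod_eq_dvd_iff)
    then show "k = l" using kl by simp
  qed
  then show "card {k. k < q \<and> (\<exists>n. int k * p = e + int q * n)} \<le> 1"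
    unfolding card_le_Suc0_iff_eq[OF fin, folded One_nat_def] by blast
qed

lemma cocycle_sum_of_nat:
  "cocycle_sum \<alpha> \<Phi> (int n) x = (\<Sum>k<n. \<Phi> (rot (real k * \<alpha>) x))"
proof -
  have "(\<Sum>k\<in>{0..<int n}. \<Phi> (rot (of_int k * \<alpha>) x)) = (\<Sum>k<n. \<Phi> (rot (of_int (int k) * \<alpha>) x))"
    by (rule sum.reindex_bij_witness[of _ int nat]) auto
  then show ?thesis by (simp add: cocycle_sum_def)
qed

lemma integral_rot:
  fixes f :: "real \<Rightarrow> 'a::{banach, second_countable_topology}"
  assumes "f \<in> borel_measurable torus"
  shows "(\<integral>v. f (rot t v) \<partial>torus) = (\<integral>v. f v \<partial>torus)"
  using integral_distr[OF measurable_rot assms, of t] by (simp add: distr_rot)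

text \<open>The three possible offsets are the three exceptional terms per discontinuity in the
  Denjoy-Koksma bound.\<close>

lemma int_near_floor:
  assumes "\<bar>of_int m - z\<bar> \<le> (1::real)"
  shows "m - \<lfloor>z\<rfloor> \<in> {-1,0,1}"
proof -
  have "of_int \<lfloor>z\<rfloor> \<le> z" "z < of_int \<lfloor>z\<rfloor> + 1" "of_int m - z \<le> 1" "z - of_int m \<le> 1"
    using assms by (auto simp: abs_le_iff)
  then have "real_of_int m < of_int (\<lfloor>z\<rfloor> + 2)" "real_of_int (\<lfloor>z\<rfloor> - 1) \<le> of_int m"
    unfolding of_int_add of_int_diff of_int_numeral of_int_1 by linarith+
  then have "m < \<lfloor>z\<rfloor> + 2" "\<lfloor>z\<rfloor> - 1 \<le> m" by linarith+
  then show ?thesis by auto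
qed

text \<open>The orbit \<open>x + k\<alpha>\<close> stays within \<open>1/q\<close> of the \<open>q\<close>-periodic orbit \<open>x + kp/q\<close>, so the Birkhoff sum
  differs from the average of \<open>\<Phi>\<close> over that orbit in at most three terms per discontinuity.\<close>

lemma denjoy_koksma_step:
  fixes \<Phi> :: "real \<Rightarrow> 'a::euclidean_space"
  assumes step: "step_function \<Phi>" and int0: "(\<integral>v. \<Phi> v \<partial>torus) = 0"
    and fin: "finite (discontinuities \<Phi>)" and M: "\<And>t. norm (\<Phi> (frac t)) \<le> M"
    and cop: "coprime p (int q)" and q: "1 \<le> q" and app: "\<bar>real q * \<alpha> - of_int p\<bar> < 1 / real q"
  shows "norm (cocycle_sum \<alpha> \<Phi> (int q) x) \<le> 6 * real (card (discontinuities \<Phi>)) * M"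
proof -
  define F where "F t = \<Phi> (frac t)" for t
  define dd where "dd = discontinuities \<Phi>"
  have Fper: "F (t + of_int m) = F t" for t m by (simp add: F_def)
  have M0: "0 \<le> M" using M[of 0] norm_ge_zero order_trans by blast
  have fin_dd: "finite dd" using fin by (simp add: dd_def)
  define S where "S = (\<Sum>k<q. F (x + real k * \<alpha>))"
  \<comment> \<open>The sum over the whole grid of mesh \<open>1/q\<close> through \<open>v\<close>.
    It has mean zero in \<open>v\<close>, and coprimality allows the grid to be traversed in steps
    of \<open>p/q\<close>.\<close>
  define G where "G v = (\<Sum>k<q. F (v + real k / real q))" for v
  \<comment> \<open>The bad indices: a discontinuity, modulo 1, lies within \<open>1/q\<close> of
    \<open>x + k p/q\<close>. After multiplication by \<open>q\<close> this confines
    \<open>k p\<close> modulo \<open>q\<close> to three residues per discontinuity, the sets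
    \<open>N i e\<close>.\<close>
  define K where "K = {k. k < q \<and> (\<exists>i\<in>dd. \<exists>n::int. \<bar>x + real k * of_int p / real q - i - of_int n\<bar> \<le> 1 / real q)}"
  define N where "N i e = {k. k < q \<and> (\<exists>n. int k * p = (\<lfloor>real q * (i - x)\<rfloor> + e) + int q * n)}" for i e
  have "K \<subseteq> (\<Union>i\<in>dd. N i (-1) \<union> N i 0 \<union> N i 1)"
  proof
    fix k assume "k \<in> K"
    then obtain i n where k: "k < q" "i \<in> dd" "\<bar>x + real k * of_int p / real q - i - of_int n\<bar> \<le> 1 / real q"
      by (auto simp: K_def)
    have "real k * of_int p - real q * (i - x) - real q * of_int n
        = real q * (x + real k * of_int p / real q - i - of_int n)"
      using q by (simp add: algebra_simps)
    then have "\<bar>real k * of_int p - real q * (i - x) - real q * of_int n\<bar>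
        = real q * \<bar>x + real k * of_int p / real q - i - of_int n\<bar>"
      by (simp add: abs_mult)
    also have "\<dots> \<le> 1" using k(3) q by (simp add: field_simps)
    finally have "\<bar>of_int (int k * p - int q * n) - real q * (i - x)\<bar> \<le> 1" by (simp add: algebra_simps)
    then have "int k * p - int q * n - \<lfloor>real q * (i - x)\<rfloor> \<in> {-1,0,1}"
      by (rule int_near_floor)
    then have "k \<in> N i (-1) \<union> N i 0 \<union> N i 1"
      unfolding N_def using k(1) by (auto simp: algebra_simps intro!: exI[of _ n])
    then show "k \<in> (\<Union>i\<in>dd. N i (-1) \<union> N i 0 \<union> N i 1)" using k(2) by blast
  qed
  moreover have N: "finite (N i e)" "card (N i e) \<le> 1" for i e
    unfolding N_def by (rule card_multiples_near[OF cop q])+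
  ultimately have "card K \<le> card (\<Union>i\<in>dd. N i (-1) \<union> N i 0 \<union> N i 1)"
    using fin_dd by (intro card_mono) auto
  also have "\<dots> \<le> (\<Sum>i\<in>dd. card (N i (-1) \<union> N i 0 \<union> N i 1))" by (rule card_UN_le[OF fin_dd])
  also have "\<dots> \<le> (\<Sum>i\<in>dd. 3)"
  proof (rule sum_mono)
    fix i
    have "card (N i (-1) \<union> N i 0 \<union> N i 1) \<le> card (N i (-1)) + card (N i 0) + card (N i 1)"
      by (meson add_mono card_Un_le le_refl order_trans)
    then show "card (N i (-1) \<union> N i 0 \<union> N i 1) \<le> 3" using N(2)[of i "-1"] N(2)[of i 0] N(2)[of i 1] by linarith
  qed
  finally have cK: "card K \<le> 3 * card dd" by simp
  have near: "norm (S - G v) \<le> 6 * real (card dd) * M" for v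
  proof -
    \<comment> \<open>Writing \<open>v = x + u + j/q\<close> with \<open>0 \<le> u < 1/q\<close>
      places a grid point within \<open>1/q\<close> of each \<open>x + k p/q\<close>; the shift
      \<open>j\<close> is absorbed by the permutation of residues.\<close>
    define j where "j = \<lfloor>(v - x) * real q\<rfloor>"
    define u where "u = v - x - of_int j / real q"
    have u: "0 \<le> u" "u < 1 / real q"
    proof -
      have "of_int j \<le> (v - x) * real q" "(v - x) * real q < of_int j + 1" by (auto simp: j_def)
      then have "of_int j / real q \<le> v - x" "v - x < (of_int j + 1) / real q"
        using q by (auto simp: pos_divide_le_eq pos_less_divide_eq)
      then show "0 \<le> u" "u < 1 / real q" by (auto simp: u_def add_divide_distrib)
    qed
    define f where "f m = F (x + u + of_int m / real q)" for m :: int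
    have fper: "f (m + int q * z) = f m" for m z
    proof -
      have "x + u + of_int (m + int q * z) / real q = (x + u + of_int m / real q) + of_int z"
        using q by (simp add: field_simps)
      then show ?thesis unfolding f_def using Fper by metis
    qed
    have "G v = (\<Sum>k<q. f (int k * 1 + j))"
      unfolding G_def f_def u_def by (intro sum.cong refl arg_cong[of _ _ F]) (simp add: add_divide_distrib)
    also have "\<dots> = (\<Sum>k<q. f (int k))" by (rule sum_periodic_coprime[OF fper _ q]) simp
    also have "\<dots> = (\<Sum>k<q. f (int k * p + 0))" by (rule sum_periodic_coprime[OF fper cop q, symmetric])
    finally have Gv: "G v = (\<Sum>k<q. f (int k * p))" by simp
    \<comment> \<open>Both arguments lie in the interval of radius \<open>1/q\<close> around
      \<open>y\<close>, the orbit point because \<open>k/q < 1\<close> keeps its accumulated error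
      below \<open>1/q\<close>. For a good index that interval is free of discontinuities.\<close>
    have zero: "F (x + real k * \<alpha>) = f (int k * p)" if k: "k < q" "k \<notin> K" for k
    proof -
      define y where "y = x + real k * of_int p / real q"
      have nd: "frac t \<notin> discontinuities \<Phi>" if t: "t \<in> {y - 1 / real q..y + 1 / real q}" for t
      proof
        assume d: "frac t \<in> discontinuities \<Phi>"
        have "\<bar>y - frac t - of_int \<lfloor>t\<rfloor>\<bar> \<le> 1 / real q" using t by (simp add: frac_def abs_le_iff)
        then have "k \<in> K" using d k(1) unfolding K_def dd_def y_def by blast
        then show False using k(2) by simp
      qed
      have "real k * \<alpha> - real k * of_int p / real q = real k / real q * (real q * \<alpha> - of_int p)"
        using q by (simp add: algebra_simps)
      then have "\<bar>real k * \<alpha> - real k * of_int p / real q\<bar> = real k / real q * \<bar>real q * \<alpha> - of_int p\<bar>"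
        by (simp add: abs_mult)
      also have "\<dots> \<le> 1 * (1 / real q)"
        using k(1) app q by (intro mult_mono) auto
      finally have "\<bar>real k * \<alpha> - real k * of_int p / real q\<bar> \<le> 1 / real q" by simp
      then have i1: "x + real k * \<alpha> \<in> {y - 1 / real q..y + 1 / real q}" by (auto simp: y_def abs_le_iff)
      have i2: "x + u + of_int (int k * p) / real q \<in> {y - 1 / real q..y + 1 / real q}"
        using u by (auto simp: y_def)
      show ?thesis unfolding f_def F_def
        by (rule step_function_constant[OF step connected_Icc _ i1 i2]) (rule nd)
    qed
    have "norm (S - G v) = norm (\<Sum>k<q. F (x + real k * \<alpha>) - f (int k * p))"
      by (simp add: S_def Gv sum_subtractf)
    also have "(\<Sum>k<q. F (x + real k * \<alpha>) - f (int k * p)) = (\<Sum>k\<in>K. F (x + real k * \<alpha>) - f (int k * p))"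
      using zero by (intro sum.mono_neutral_right) (auto simp: K_def)
    also have "norm \<dots> \<le> (\<Sum>k\<in>K. 2 * M)"
    proof (rule sum_norm_le)
      fix k
      show "norm (F (x + real k * \<alpha>) - f (int k * p)) \<le> 2 * M"
        using norm_triangle_ineq4[of "F (x + real k * \<alpha>)" "f (int k * p)"]
          M[of "x + real k * \<alpha>"] M[of "x + u + of_int (int k * p) / real q"]
        unfolding f_def F_def by linarith
    qed
    also have "\<dots> = 2 * M * real (card K)" by simp
    also have "\<dots> \<le> 2 * M * real (3 * card dd)" using M0 cK by (intro mult_left_mono) auto
    finally show ?thesis by (simp add: mult_ac)
  qed
  have meas: "\<Phi> \<in> borel_measurable torus" by (rule step_function_measurable[OF step])
  have mr: "(\<lambda>v. \<Phi> (rot t v)) \<in> borel_measurable torus" for t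
    using measurable_compose[OF measurable_rot meas] .
  have intg: "integrable torus (\<lambda>v. \<Phi> (rot t v))" for t
    by (rule torus.integrable_const_bound[of _ M]) (auto simp: rot_def M mr[unfolded rot_def])
  have G_rot: "G = (\<lambda>v. \<Sum>k<q. \<Phi> (rot (real k / real q) v))"
    by (auto simp: G_def F_def rot_def)
  have Gint: "integrable torus G" unfolding G_rot by (intro Bochner_Integration.integrable_sum intg)
  have "(\<integral>v. G v \<partial>torus) = (\<Sum>k<q. \<integral>v. \<Phi> (rot (real k / real q) v) \<partial>torus)"
    unfolding G_rot by (intro Bochner_Integration.integral_sum intg)
  also have "\<dots> = 0" by (simp add: integral_rot[OF meas] int0)
  finally have G0: "(\<integral>v. G v \<partial>torus) = 0" .
  \<comment> \<open>The comparison with \<open>G v\<close> is uniform in \<open>v\<close>, so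
    averaging over \<open>v\<close> removes \<open>G\<close> and keeps the bound.\<close>
  have "S = (\<integral>v. S - G v \<partial>torus)"
    by (subst Bochner_Integration.integral_diff) (auto simp: Gint G0)
  then have "norm S \<le> (\<integral>v. norm (S - G v) \<partial>torus)"
    by (metis integral_norm_bound)
  also have "\<dots> \<le> (\<integral>v. 6 * real (card dd) * M \<partial>torus)"
    using near Gint by (intro integral_mono) auto
  finally have "norm S \<le> 6 * real (card dd) * M" by simp
  then show ?thesis unfolding S_def dd_def F_def cocycle_sum_of_nat rot_def .
qed

section \<open>Essential values\<close>

lemma borel_measurable_cocycle_sum [measurable]:
  fixes \<Phi> :: "real \<Rightarrow> 'a::euclidean_space"
  assumes "\<Phi> \<in> borel_measurable torus"
  shows "cocycle_sum \<alpha> \<Phi> N \<in> borel_measurable torus"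
proof -
  have "(\<lambda>x. \<Phi> (rot t x)) \<in> borel_measurable torus" for t
    using measurable_compose[OF measurable_rot assms] .
  then show ?thesis unfolding cocycle_sum_def by measurable
qed

lemma cocycle_sum_zero [simp]: "cocycle_sum \<alpha> \<Phi> 0 x = 0"
  by (simp add: cocycle_sum_def)

lemma cocycle_sum_one: "cocycle_sum \<alpha> \<Phi> 1 x = \<Phi> (rot 0 x)"
  using cocycle_sum_Suc[of \<alpha> \<Phi> 0 x] by simp

lemma tendsto_zero_bound:
  fixes f g :: "nat \<Rightarrow> real"
  assumes "\<And>n. 0 \<le> f n" "\<And>n. f n \<le> g n" "g \<longlonglongrightarrow> 0"
  shows "f \<longlonglongrightarrow> 0"
  by (rule tendsto_sandwich[OF _ _ tendsto_const assms(3)]) (auto simp: assms)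

text \<open>Named so that it can be iterated: a return set again serves as the set \<open>A\<close>
  of another one.\<close>

definition return_set ::
  "real \<Rightarrow> (real \<Rightarrow> 'a::euclidean_space) \<Rightarrow> real set \<Rightarrow> int \<Rightarrow> 'a set \<Rightarrow> real set" where
  "return_set \<alpha> \<Phi> A N U = {x \<in> A. rot (of_int N * \<alpha>) x \<in> A \<and> cocycle_sum \<alpha> \<Phi> N x \<in> U}"

lemma sets_return_set [measurable]:
  fixes \<Phi> :: "real \<Rightarrow> 'a::euclidean_space"
  assumes \<Phi>: "\<Phi> \<in> borel_measurable torus" and A: "A \<in> sets torus" and U: "U \<in> sets borel"
  shows "return_set \<alpha> \<Phi> A N U \<in> sets torus"
proof -
  have "return_set \<alpha> \<Phi> A N U
      = A \<inter> rot_vimage (of_int N * \<alpha>) A \<inter> (cocycle_sum \<alpha> \<Phi> N -` U \<inter> space torus)"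
    using sets.sets_into_space[OF A] by (auto simp: return_set_def rot_vimage_def)
  then show ?thesis
    using A measurable_sets[OF borel_measurable_cocycle_sum[OF \<Phi>] U] by auto
qed

lemma return_set_mono: "A \<subseteq> B \<Longrightarrow> U \<subseteq> V \<Longrightarrow> return_set \<alpha> \<Phi> A N U \<subseteq> return_set \<alpha> \<Phi> B N V"
  by (auto simp: return_set_def)

lemma essential_valuesD:
  assumes "g \<in> essential_values \<alpha> \<Phi>" "open U" "g \<in> U" "A \<in> sets torus" "0 < measure torus A"
  obtains N where "0 < measure torus (return_set \<alpha> \<Phi> A N U)"
  using assms unfolding essential_values_def return_set_def[symmetric]
  by (simp add: torus.emeasure_eq_measure) metis

lemma essential_valuesI:
  assumes "\<And>U A. open U \<Longrightarrow> g \<in> U \<Longrightarrow> A \<in> sets torus \<Longrightarrow> 0 < measure torus A \<Longrightarrow>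
     \<exists>N. 0 < measure torus (return_set \<alpha> \<Phi> A N U)"
  shows "g \<in> essential_values \<alpha> \<Phi>"
  using assms unfolding essential_values_def return_set_def[symmetric]
  by (simp add: torus.emeasure_eq_measure)

lemma measure_pos_mono:
  "0 < measure torus A \<Longrightarrow> A \<subseteq> B \<Longrightarrow> B \<in> sets torus \<Longrightarrow> 0 < measure torus B"
  using torus.finite_measure_mono[of A B] by linarith

lemma essential_values_zero: "0 \<in> essential_values \<alpha> \<Phi>"
proof (rule essential_valuesI)
  fix U :: "'a set" and A assume "0 \<in> U" and A: "A \<in> sets torus" "0 < measure torus A"
  then have "return_set \<alpha> \<Phi> A 0 U = A"
    using sets.sets_into_space[OF A(1)] by (auto simp: return_set_def cocycle_sum_def)
  then show "\<exists>N. 0 < measure torus (return_set \<alpha> \<Phi> A N U)" using A by metis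
qed

lemma closed_essential_values: "closed (essential_values \<alpha> \<Phi>)"
  unfolding closed_sequential_limits
proof (intro allI impI, elim conjE)
  fix g l assume g: "\<forall>n. g n \<in> essential_values \<alpha> \<Phi>" and lim: "g \<longlonglongrightarrow> l"
  show "l \<in> essential_values \<alpha> \<Phi>"
  proof (rule essential_valuesI)
    fix U A assume UA: "open U" "l \<in> U" "A \<in> sets torus" "0 < measure torus A"
    obtain n where "g n \<in> U"
      using topological_tendstoD[OF lim UA(1,2)] by (auto simp: eventually_sequentially)
    then show "\<exists>N. 0 < measure torus (return_set \<alpha> \<Phi> A N U)"
      using g UA by (metis essential_valuesD)
  qed
qed

lemma cocycle_sum_minus:
  "cocycle_sum \<alpha> \<Phi> (- N) (rot (of_int N * \<alpha>) x) = - cocycle_sum \<alpha> \<Phi> N x"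
  using cocycle_sum_add[of \<alpha> \<Phi> N "- N" x] by (simp add: eq_neg_iff_add_eq_0 add.commute)

text \<open>\<open>T\<^sup>N\<close> carries a return with value in \<open>- U\<close> to a return
  under \<open>- N\<close> with value in \<open>U\<close>.\<close>

lemma essential_values_uminus:
  assumes \<Phi>: "\<Phi> \<in> borel_measurable torus" and g: "g \<in> essential_values \<alpha> \<Phi>"
  shows "- g \<in> essential_values \<alpha> \<Phi>"
proof (rule essential_valuesI)
  fix U A assume UA: "open U" "- g \<in> U" "A \<in> sets torus" "0 < measure torus A"
  have op: "open (uminus ` U)" using UA(1) by (rule open_negations)
  have "g \<in> uminus ` U" using UA(2) by (metis image_eqI minus_minus)
  then obtain N where N: "0 < measure torus (return_set \<alpha> \<Phi> A N (uminus ` U))"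
    using essential_valuesD[OF g op _ UA(3,4)] by blast
  have sub: "A \<subseteq> {0..<1}" using UA(3) by (simp add: sets_torus_iff)
  have m: "return_set \<alpha> \<Phi> A N (uminus ` U) \<in> sets torus" "return_set \<alpha> \<Phi> A (- N) U \<in> sets torus"
    using \<Phi> UA op by (auto intro!: sets_return_set)
  have "return_set \<alpha> \<Phi> A N (uminus ` U) \<subseteq> rot_vimage (of_int N * \<alpha>) (return_set \<alpha> \<Phi> A (- N) U)"
    using sub by (auto simp: return_set_def rot_vimage_def rot_rot cocycle_sum_minus)
  then have "0 < measure torus (rot_vimage (of_int N * \<alpha>) (return_set \<alpha> \<Phi> A (- N) U))"
    using N m by (intro measure_pos_mono[OF N]) auto
  then show "\<exists>N. 0 < measure torus (return_set \<alpha> \<Phi> A N U)"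
    using m by (auto simp: measure_rot_vimage)
qed

lemma return_set_compose:
  assumes "W + V \<subseteq> U" "A \<subseteq> {0..<1}"
  shows "return_set \<alpha> \<Phi> (return_set \<alpha> \<Phi> A N V) M W \<subseteq> return_set \<alpha> \<Phi> A (M + N) U"
proof
  fix x assume x: "x \<in> return_set \<alpha> \<Phi> (return_set \<alpha> \<Phi> A N V) M W"
  have "rot (of_int (M + N) * \<alpha>) x = rot (of_int N * \<alpha>) (rot (of_int M * \<alpha>) x)"
    by (simp add: rot_rot algebra_simps)
  moreover have "cocycle_sum \<alpha> \<Phi> (M + N) x \<in> W + V"
    using x unfolding cocycle_sum_add return_set_def by (intro set_plus_intro) auto
  ultimately show "x \<in> return_set \<alpha> \<Phi> A (M + N) U"
    using x assms(1) by (auto simp: return_set_def)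
qed

text \<open>It is enough to see \<open>g\<close> modulo essential values. A countable dense subset
  singles out one \<open>e\<close> with returns near \<open>g + e\<close> on a set of positive
  measure; a second return inside that set, with value near \<open>- e\<close>, removes it.\<close>

lemma essential_value_if_returns_mod:
  fixes \<Phi> :: "real \<Rightarrow> 'a::euclidean_space"
  assumes \<Phi>: "\<Phi> \<in> borel_measurable torus"
    and g: "\<And>r A. 0 < r \<Longrightarrow> A \<in> sets torus \<Longrightarrow> 0 < measure torus A \<Longrightarrow>
      \<exists>N. 0 < measure torus (return_set \<alpha> \<Phi> A N (\<Union>e\<in>essential_values \<alpha> \<Phi>. ball (g + e) r))"
  shows "g \<in> essential_values \<alpha> \<Phi>"
proof (rule essential_valuesI)
  fix U A assume UA: "open U" "g \<in> U" "A \<in> sets torus" "0 < measure torus A"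
  define E where "E = essential_values \<alpha> \<Phi>"
  obtain r where r: "r > 0" "ball g r \<subseteq> U" using UA(1,2) openE by blast
  obtain D where D: "countable D" "D \<subseteq> E" "E \<subseteq> closure D" using separable by blast
  \<comment> \<open>Thirds of \<open>r\<close> go to the given return, to the approximation by
    \<open>D\<close>, and to the correcting return.\<close>
  obtain N where N: "0 < measure torus (return_set \<alpha> \<Phi> A N (\<Union>e\<in>E. ball (g + e) (r/3)))"
    using g[of "r/3" A] r UA unfolding E_def by auto
  have sub: "return_set \<alpha> \<Phi> A N (\<Union>e\<in>E. ball (g + e) (r/3))
      \<subseteq> (\<Union>e\<in>D. return_set \<alpha> \<Phi> A N (ball (g + e) (2*r/3)))"
  proof
    fix x assume x: "x \<in> return_set \<alpha> \<Phi> A N (\<Union>e\<in>E. ball (g + e) (r/3))"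
    then obtain e where e: "e \<in> E" "dist (g + e) (cocycle_sum \<alpha> \<Phi> N x) < r/3"
      by (auto simp: return_set_def)
    obtain d where d: "d \<in> D" "dist d e < r/3"
      using e(1) D(3) r closure_approachable[of e D] by (meson divide_pos_pos subsetD zero_less_numeral)
    have "dist (g + d) (cocycle_sum \<alpha> \<Phi> N x) \<le> dist (g + d) (g + e) + dist (g + e) (cocycle_sum \<alpha> \<Phi> N x)"
      by (rule dist_triangle)
    also have "dist (g + d) (g + e) = dist d e" by (simp add: dist_norm)
    finally have "cocycle_sum \<alpha> \<Phi> N x \<in> ball (g + d) (2*r/3)" using e(2) d(2) by simp
    then show "x \<in> (\<Union>e\<in>D. return_set \<alpha> \<Phi> A N (ball (g + e) (2*r/3)))"
      using d(1) x by (auto simp: return_set_def)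
  qed
  have m: "return_set \<alpha> \<Phi> A N (ball (g + e) (2*r/3)) \<in> sets torus" for e
    using \<Phi> UA by (auto intro: sets_return_set)
  have "\<exists>e\<in>D. 0 < measure torus (return_set \<alpha> \<Phi> A N (ball (g + e) (2*r/3)))"
  proof (rule ccontr)
    assume "\<not> ?thesis"
    then have "\<And>e. e \<in> D \<Longrightarrow> return_set \<alpha> \<Phi> A N (ball (g + e) (2*r/3)) \<in> null_sets torus"
      using m by (intro null_setsI) (auto simp: torus.emeasure_eq_measure not_less measure_le_0_iff)
    then have null: "(\<Union>e\<in>D. return_set \<alpha> \<Phi> A N (ball (g + e) (2*r/3))) \<in> null_sets torus"
      using D(1) by (intro null_sets_UN') auto
    have "0 < measure torus (\<Union>e\<in>D. return_set \<alpha> \<Phi> A N (ball (g + e) (2*r/3)))"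
      by (rule measure_pos_mono[OF N sub]) (use null in auto)
    then show False using null by (simp add: measure_def null_setsD1)
  qed
  then obtain e where e: "e \<in> E" "0 < measure torus (return_set \<alpha> \<Phi> A N (ball (g + e) (2*r/3)))"
    using D(2) by auto
  have "- e \<in> essential_values \<alpha> \<Phi>" using e(1) essential_values_uminus[OF \<Phi>] by (simp add: E_def)
  then obtain M where M: "0 < measure torus
      (return_set \<alpha> \<Phi> (return_set \<alpha> \<Phi> A N (ball (g + e) (2*r/3))) M (ball (- e) (r/3)))"
    by (rule essential_valuesD[OF _ open_ball[of "- e" "r/3"] _ m e(2)]) (use r in auto)
  have "ball (- e) (r/3) + ball (g + e) (2*r/3) \<subseteq> U"
  proof
    fix z assume "z \<in> ball (- e) (r/3) + ball (g + e) (2*r/3)"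
    then obtain a b where ab: "z = a + b" "dist (- e) a < r/3" "dist (g + e) b < 2*r/3"
      by (auto elim: set_plus_elim)
    have "dist (- e + (g + e)) (a + b) \<le> dist (- e) a + dist (g + e) b" by (rule dist_triangle_add)
    then have "dist g z < r" using ab by simp
    then show "z \<in> U" using r(2) by auto
  qed
  then have "return_set \<alpha> \<Phi> (return_set \<alpha> \<Phi> A N (ball (g + e) (2*r/3))) M (ball (- e) (r/3))
      \<subseteq> return_set \<alpha> \<Phi> A (M + N) U"
    using UA(3) by (intro return_set_compose) (auto simp: sets_torus_iff)
  moreover have "return_set \<alpha> \<Phi> A (M + N) U \<in> sets torus" using \<Phi> UA by (auto intro: sets_return_set)
  ultimately show "\<exists>N. 0 < measure torus (return_set \<alpha> \<Phi> A N U)"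
    using measure_pos_mono[OF M] by blast
qed

text \<open>A return with value near \<open>g = (g + h) + (- h)\<close> is a return near
  \<open>g + h\<close> modulo essential values.\<close>

lemma essential_values_add:
  fixes \<Phi> :: "real \<Rightarrow> 'a::euclidean_space"
  assumes \<Phi>: "\<Phi> \<in> borel_measurable torus"
    and g: "g \<in> essential_values \<alpha> \<Phi>" and h: "h \<in> essential_values \<alpha> \<Phi>"
  shows "g + h \<in> essential_values \<alpha> \<Phi>"
proof (rule essential_value_if_returns_mod[OF \<Phi>])
  fix r :: real and A assume r: "0 < r" and A: "A \<in> sets torus" "0 < measure torus A"
  obtain N where N: "0 < measure torus (return_set \<alpha> \<Phi> A N (ball g r))"
    using essential_valuesD[OF g open_ball _ A] r by (metis centre_in_ball)
  have "- h \<in> essential_values \<alpha> \<Phi>" by (rule essential_values_uminus[OF \<Phi> h])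
  then have "ball g r \<subseteq> (\<Union>e\<in>essential_values \<alpha> \<Phi>. ball (g + h + e) r)"
    by (intro subsetI UN_I[of "- h"]) auto
  then have "return_set \<alpha> \<Phi> A N (ball g r)
      \<subseteq> return_set \<alpha> \<Phi> A N (\<Union>e\<in>essential_values \<alpha> \<Phi>. ball (g + h + e) r)"
    by (intro return_set_mono) auto
  moreover have "return_set \<alpha> \<Phi> A N (\<Union>e\<in>essential_values \<alpha> \<Phi>. ball (g + h + e) r) \<in> sets torus"
    using \<Phi> A by (intro sets_return_set borel_open) auto
  ultimately show "\<exists>N. 0 < measure torus (return_set \<alpha> \<Phi> A N (\<Union>e\<in>essential_values \<alpha> \<Phi>. ball (g + h + e) r))"
    using measure_pos_mono[OF N] by blast
qed

lemma closed_subgroup_essential_values: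
  "\<Phi> \<in> borel_measurable torus \<Longrightarrow> closed_subgroup (essential_values \<alpha> \<Phi>)"
  unfolding closed_subgroup_def
  using closed_essential_values essential_values_zero essential_values_add essential_values_uminus by blast

section \<open>Rigidity along denominators\<close>

lemma rigid_returns:
  fixes q :: "nat \<Rightarrow> nat"
  assumes lim: "(\<lambda>n. real (q n) * \<alpha> - of_int (p n)) \<longlonglongrightarrow> 0" and A: "A \<in> sets torus"
  shows "(\<lambda>n. measure torus (A - rot_vimage (real (q n) * \<alpha>) A)) \<longlonglongrightarrow> 0"
proof (rule LIMSEQ_I)
  fix r :: real assume "0 < r"
  then obtain \<delta> where d: "\<delta> > 0" "\<And>t. \<bar>t\<bar> < \<delta> \<Longrightarrow> measure torus (A - rot_vimage t A) < r"
    using rot_small[OF A] by blast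
  obtain n0 where n0: "\<And>n. n \<ge> n0 \<Longrightarrow> norm (real (q n) * \<alpha> - of_int (p n) - 0) < \<delta>"
    using LIMSEQ_D[OF lim d(1)] by blast
  have "rot_vimage (real (q n) * \<alpha>) A = rot_vimage (real (q n) * \<alpha> - of_int (p n)) A" for n
    by (simp add: rot_vimage_def)
  then show "\<exists>no. \<forall>n\<ge>no. norm (measure torus (A - rot_vimage (real (q n) * \<alpha>) A) - 0) < r"
    using n0 d(2) by (intro exI[of _ n0]) auto
qed

text \<open>The two sums share all but their end terms. Since \<open>x\<close> is any real here,
  \<open>rot 0 x\<close> stands for its reduction modulo 1.\<close>

lemma cocycle_sum_shift:
  "cocycle_sum \<alpha> \<Phi> N (rot \<alpha> x) = cocycle_sum \<alpha> \<Phi> N x + \<Phi> (rot (of_int N * \<alpha>) x) - \<Phi> (rot 0 x)"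
  using cocycle_sum_add[of \<alpha> \<Phi> 1 N x] cocycle_sum_Suc[of \<alpha> \<Phi> N x]
  by (simp add: cocycle_sum_one add.commute algebra_simps)

text \<open>\<open>\<Phi>\<close> has finitely many level sets, and its value changes only at points
  that leave one of them; rigidity applies to each separately.\<close>

lemma step_almost_invariant:
  fixes q :: "nat \<Rightarrow> nat"
  assumes step: "step_function \<Phi>" and lim: "(\<lambda>n. real (q n) * \<alpha> - of_int (p n)) \<longlonglongrightarrow> 0"
  shows "(\<lambda>n. measure torus {x\<in>{0..<1}. \<Phi> (rot (real (q n) * \<alpha>) x) \<noteq> \<Phi> x}) \<longlonglongrightarrow> 0"
    and "{x\<in>{0..<1}. \<Phi> (rot (real (q n) * \<alpha>) x) \<noteq> \<Phi> x} \<in> sets torus"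
proof -
  define A where "A y = {x\<in>{0..<1}. \<Phi> x = y}" for y
  have fin: "finite (\<Phi> ` {0..<1})" by (rule step_function_finite_range[OF step])
  obtain P where P: "finite P" "partition_on {0..<1::real} P" "\<And>I. I \<in> P \<Longrightarrow> is_interval I"
     "\<And>I. I \<in> P \<Longrightarrow> \<Phi> constant_on I"
    using step by (auto simp: step_function_def)
  have A: "A y \<in> sets torus" for y
  proof -
    have "A y = \<Union>{I\<in>P. A y \<inter> I \<noteq> {}}"
    proof (intro equalityI subsetI)
      fix x assume x: "x \<in> A y"
      then have "x \<in> \<Union>P" using P(2) by (simp add: partition_on_def A_def)
      then show "x \<in> \<Union>{I\<in>P. A y \<inter> I \<noteq> {}}" using x by blast
    next
      fix x assume "x \<in> \<Union>{I\<in>P. A y \<inter> I \<noteq> {}}"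
      then obtain I z where I: "I \<in> P" "x \<in> I" "z \<in> I" "z \<in> A y" by auto
      then have "\<Phi> x = \<Phi> z" using P(4)[OF I(1)] by (metis constant_on_def)
      moreover have "x \<in> {0..<1}" using P(2) I by (auto simp add: partition_on_def)
      ultimately show "x \<in> A y" using I by (simp add: A_def)
    qed
    moreover have "I \<in> sets torus" if "I \<in> P" for I
      using real_interval_borel_measurable[OF P(3)[OF that]] that P(2) by (auto simp: sets_torus_iff partition_on_def)
    ultimately show ?thesis
      using P(1) by (metis (no_types, lifting) finite_subset mem_Collect_eq sets.finite_Union subsetI)
  qed
  have eq: "{x\<in>{0..<1}. \<Phi> (rot (real (q n) * \<alpha>) x) \<noteq> \<Phi> x}
      = (\<Union>y\<in>\<Phi> ` {0..<1}. A y - rot_vimage (real (q n) * \<alpha>) (A y))" for n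
    by (auto simp: A_def rot_vimage_def)
  show "{x\<in>{0..<1}. \<Phi> (rot (real (q n) * \<alpha>) x) \<noteq> \<Phi> x} \<in> sets torus"
    unfolding eq using fin A by (intro sets.finite_UN) auto
  have "(\<lambda>n. \<Sum>y\<in>\<Phi> ` {0..<1}. measure torus (A y - rot_vimage (real (q n) * \<alpha>) (A y))) \<longlonglongrightarrow> 0"
    by (intro tendsto_null_sum rigid_returns[OF lim] A)
  moreover have "measure torus {x\<in>{0..<1}. \<Phi> (rot (real (q n) * \<alpha>) x) \<noteq> \<Phi> x}
     \<le> (\<Sum>y\<in>\<Phi> ` {0..<1}. measure torus (A y - rot_vimage (real (q n) * \<alpha>) (A y)))" for n
    unfolding eq using A fin by (intro torus.finite_measure_subadditive_finite) auto
  ultimately show "(\<lambda>n. measure torus {x\<in>{0..<1}. \<Phi> (rot (real (q n) * \<alpha>) x) \<noteq> \<Phi> x}) \<longlonglongrightarrow> 0"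
    by (rule tendsto_zero_bound[OF measure_nonneg, rotated])
qed

text \<open>Along rigidity times the set \<open>{\<Phi>\<^sub>q \<in> U}\<close> is almost invariant under the rotation, so if it becomes
  negligible on one set of positive measure then it becomes negligible everywhere.\<close>

lemma not_essential_value_vanishing:
  fixes \<Phi> :: "real \<Rightarrow> 'a::euclidean_space" and q :: "nat \<Rightarrow> nat"
  assumes irr: "\<alpha> \<notin> \<rat>" and step: "step_function \<Phi>"
    and lim: "(\<lambda>n. real (q n) * \<alpha> - of_int (p n)) \<longlonglongrightarrow> 0" and g: "g \<notin> essential_values \<alpha> \<Phi>"
  obtains U where "open U" "g \<in> U"
    "(\<lambda>n. measure torus {x\<in>{0..<1}. cocycle_sum \<alpha> \<Phi> (int (q n)) x \<in> U}) \<longlonglongrightarrow> 0"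
proof -
  have \<Phi>: "\<Phi> \<in> borel_measurable torus" by (rule step_function_measurable[OF step])
  obtain U A where UA: "open U" "g \<in> U" "A \<in> sets torus" "0 < measure torus A"
    "\<And>N. \<not> 0 < measure torus (return_set \<alpha> \<Phi> A N U)"
    using g essential_valuesI by metis
  define B where "B n = {x\<in>{0..<1}. cocycle_sum \<alpha> \<Phi> (int (q n)) x \<in> U}" for n
  have B: "B n \<in> sets torus" for n
  proof -
    have "B n = cocycle_sum \<alpha> \<Phi> (int (q n)) -` U \<inter> space torus" by (auto simp: B_def)
    then show ?thesis using measurable_sets[OF borel_measurable_cocycle_sum[OF \<Phi>] borel_open[OF UA(1)]] by simp
  qed
  define R where "R n = {x\<in>{0..<1}. \<Phi> (rot (real (q n) * \<alpha>) x) \<noteq> \<Phi> x}" for n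
  have R: "R n \<in> sets torus" for n unfolding R_def by (rule step_almost_invariant(2)[OF step lim])
  have Rlim: "(\<lambda>n. measure torus (R n)) \<longlonglongrightarrow> 0" unfolding R_def by (rule step_almost_invariant(1)[OF step lim])
  have "(\<lambda>n. measure torus (B n)) \<longlonglongrightarrow> 0"
  proof (rule vanishes_if_vanishes_on_positive_set[OF irr UA(3,4) B])
    \<comment> \<open>If \<open>\<Phi>\<^sub>q\<close> differs at \<open>x\<close> and
      \<open>T x\<close>, then by \<open>cocycle_sum_shift\<close> \<open>\<Phi>\<close> differs at
      \<open>x\<close> and \<open>T\<^sup>q x\<close>, so \<open>x \<in> R n\<close>.\<close>
    have "measure torus (B n - rot_vimage \<alpha> (B n)) \<le> measure torus (R n)" for n
      using R cocycle_sum_shift[of \<alpha> \<Phi> "int (q n)"]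
      by (intro torus.finite_measure_mono) (auto simp: B_def R_def rot_vimage_def)
    then show "(\<lambda>n. measure torus (B n - rot_vimage \<alpha> (B n))) \<longlonglongrightarrow> 0"
      by (rule tendsto_zero_bound[OF measure_nonneg _ Rlim])
    \<comment> \<open>A point of \<open>A \<inter> B n\<close> that returns to \<open>A\<close>
      belongs to a return set, null by the choice of \<open>U\<close> and \<open>A\<close>; the
      others are lost to rigidity.\<close>
    have le: "measure torus (A \<inter> B n) \<le> measure torus (A - rot_vimage (real (q n) * \<alpha>) A)" for n
    proof -
      have "measure torus (A \<inter> B n)
          \<le> measure torus (return_set \<alpha> \<Phi> A (int (q n)) U \<union> (A - rot_vimage (real (q n) * \<alpha>) A))"
      proof (rule torus.finite_measure_mono)
        show "A \<inter> B n \<subseteq> return_set \<alpha> \<Phi> A (int (q n)) U \<union> (A - rot_vimage (real (q n) * \<alpha>) A)"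
          by (auto simp: B_def return_set_def rot_vimage_def)
        show "return_set \<alpha> \<Phi> A (int (q n)) U \<union> (A - rot_vimage (real (q n) * \<alpha>) A) \<in> sets torus"
          using UA(1,3) \<Phi> by (auto intro!: sets.Un sets_return_set)
      qed
      also have "\<dots> \<le> measure torus (return_set \<alpha> \<Phi> A (int (q n)) U) + measure torus (A - rot_vimage (real (q n) * \<alpha>) A)"
        using UA(1,3) \<Phi> by (intro measure_Un_le) (auto intro!: sets_return_set)
      finally show ?thesis using UA(5)[of "int (q n)"] measure_nonneg[of torus "return_set \<alpha> \<Phi> A (int (q n)) U"] by linarith
    qed
    show "(\<lambda>n. measure torus (A \<inter> B n)) \<longlonglongrightarrow> 0"
      by (rule tendsto_zero_bound[OF measure_nonneg le rigid_returns[OF lim UA(3)]])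
  qed
  then show thesis using that UA(1,2) unfolding B_def by blast
qed

section \<open>Jumps are essential values\<close>

text \<open>As a map over a product list, distinctness becomes injectivity in \<open>(i, k)\<close>
  and the length is visibly \<open>D * n\<close>.\<close>

lemma disc_orbit_product:
  "disc_orbit \<alpha> x D n = map (\<lambda>(i, k). frac (x i - real k * \<alpha>)) (List.product [1..<Suc D] [0..<n])"
proof -
  have "concat (map (\<lambda>i. map (\<lambda>k. frac (x i - real k * \<alpha>)) ks) is)
      = map (\<lambda>(i, k). frac (x i - real k * \<alpha>)) (List.product is ks)" for "is" ks
    by (induction "is") auto
  then show ?thesis unfolding disc_orbit_def by simp
qed

text \<open>The geometry at a single denominator \<open>q\<close>, with \<open>\<delta>\<close> in
  the role of \<open>c / q\<close>.\<close>

locale separated_orbit =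
  fixes \<alpha> :: real and x :: "nat \<Rightarrow> real" and D q :: nat and \<delta> :: real
  assumes dist: "distinct (disc_orbit \<alpha> x D q)" and pos: "0 < \<delta>" "1 \<le> q" "1 \<le> D"
    and gap: "\<And>l. l \<in> {1..D * q} \<Longrightarrow> \<delta> \<le> disc_gap \<alpha> x D q l"
begin

definition "points = sort (disc_orbit \<alpha> x D q)"

lemma length_points: "length points = D * q"
  by (simp add: points_def disc_orbit_product)

lemma sorted_points: "sorted points" by (simp add: points_def)

lemma Dq: "1 \<le> D * q" using pos by simp

lemma wrap: "points ! (D * q - 1) - points ! 0 \<le> 1 - \<delta>"
  using gap[of "D * q"] Dq by (simp add: disc_gap_def disc_gamma_def points_def)

lemma delta_le_1: "\<delta> \<le> 1"
  using wrap sorted_nth_mono[OF sorted_points, of 0 "D * q - 1"] Dq by (simp add: length_points)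

text \<open>Both arcs joining two orbit points have length at least \<open>\<delta>\<close>; the
  second bound comes from the gap through 0.\<close>

lemma points_apart:
  assumes "a < b" "b < D * q"
  shows "\<delta> \<le> points ! b - points ! a" "points ! b - points ! a \<le> 1 - \<delta>"
proof -
  have "points ! (a + 1) \<le> points ! b"
    using assms by (intro sorted_nth_mono[OF sorted_points]) (auto simp: length_points)
  moreover have "\<delta> \<le> points ! (a + 1) - points ! a"
    using gap[of "a + 1"] assms by (simp add: disc_gap_def disc_gamma_def points_def)
  ultimately show "\<delta> \<le> points ! b - points ! a" by linarith
  have "points ! b \<le> points ! (D * q - 1)" "points ! 0 \<le> points ! a"
    using assms by (auto intro!: sorted_nth_mono[OF sorted_points] simp: length_points)
  then show "points ! b - points ! a \<le> 1 - \<delta>" using wrap by linarith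
qed

text \<open>The gaps lifted to the line, with \<open>n\<close> counting turns: two lifts closer than
  \<open>\<delta>\<close> are the same lift of the same point.\<close>

lemma separation:
  assumes "i \<in> {1..D}" "i' \<in> {1..D}" "j < q" "k < q"
    and near: "\<bar>(x i - real j * \<alpha>) - (x i' - real k * \<alpha>) - of_int n\<bar> < \<delta>"
  shows "i = i' \<and> j = k \<and> n = 0"
proof (cases "(i, j) = (i', k)")
  case True
  then have "\<bar>real_of_int n\<bar> < 1" using near delta_le_1 by simp
  then have "n = 0" by linarith
  then show ?thesis using True by simp
next
  case False
  define s t where "s = x i - real j * \<alpha>" and "t = x i' - real k * \<alpha>"
  have inj: "inj_on (\<lambda>(i, k). frac (x i - real k * \<alpha>)) ({1..D} \<times> {..<q})"
    using dist by (simp add: disc_orbit_product distinct_map atLeastLessThanSuc_atLeastAtMost lessThan_atLeast0 del: upt_Suc)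
  have "frac s \<noteq> frac t"
    using inj_onD[OF inj, of "(i, j)" "(i', k)"] False assms by (auto simp: s_def t_def)
  moreover have "set points = (\<lambda>(i, k). frac (x i - real k * \<alpha>)) ` ({1..D} \<times> {..<q})"
    by (simp add: points_def disc_orbit_product atLeastLessThanSuc_atLeastAtMost lessThan_atLeast0 del: upt_Suc)
  then have "frac s \<in> set points" "frac t \<in> set points"
    using assms by (force simp: s_def t_def)+
  then obtain a b where ab: "a < D * q" "b < D * q" "frac s = points ! a" "frac t = points ! b"
    by (auto simp: in_set_conv_nth length_points)
  ultimately have "a < b \<or> b < a" by (metis linorder_neqE_nat)
  then have ap: "\<delta> \<le> \<bar>frac s - frac t\<bar>" "\<bar>frac s - frac t\<bar> \<le> 1 - \<delta>"
    using points_apart ab pos by (metis abs_ge_self abs_minus_commute order_trans)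
      (use \<open>a < b \<or> b < a\<close> points_apart[of a b] points_apart[of b a] ab pos in auto)
  define m where "m = n + \<lfloor>t\<rfloor> - \<lfloor>s\<rfloor>"
  have "frac s - frac t - of_int m = s - t - of_int n" by (simp add: m_def frac_def)
  then have "\<bar>frac s - frac t - of_int m\<bar> < \<delta>"
    using near unfolding s_def[symmetric] t_def[symmetric] by simp
  \<comment> \<open>Here \<open>m = 0\<close> contradicts the lower bound in \<open>ap\<close>, and
    \<open>\<bar>m\<bar> \<ge> 1\<close> the upper one.\<close>
  moreover have "m = 0 \<or> 1 \<le> \<bar>real_of_int m\<bar>" by linarith
  ultimately show ?thesis using ap by auto
qed

end

lemma jump_eq:
  assumes "0 < \<delta>" "\<And>t. t \<in> {z<..<z + \<delta>} \<Longrightarrow> \<Phi> (frac t) = a" "\<And>t. t \<in> {z - \<delta><..<z} \<Longrightarrow> \<Phi> (frac t) = b"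
  shows "jump \<Phi> z = a - b"
proof -
  have "\<forall>\<^sub>F t in at_right z. t \<in> {z<..<z + \<delta>}"
    using assms(1) by (intro eventually_at_rightI[of z "z + \<delta>"]) auto
  then have "\<forall>\<^sub>F t in at_right z. \<Phi> (frac t) = a" by eventually_elim (rule assms(2))
  then have 1: "((\<lambda>t. \<Phi> (frac t)) \<longlongrightarrow> a) (at_right z)" by (rule tendsto_eventually)
  have "\<forall>\<^sub>F t in at_left z. t \<in> {z - \<delta><..<z}"
    using assms(1) by (intro eventually_at_leftI[of "z - \<delta>" z]) auto
  then have "\<forall>\<^sub>F t in at_left z. \<Phi> (frac t) = b" by eventually_elim (rule assms(3))
  then have 2: "((\<lambda>t. \<Phi> (frac t)) \<longlongrightarrow> b) (at_left z)" by (rule tendsto_eventually)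
  show ?thesis unfolding jump_def
    using tendsto_Lim[OF _ 1] tendsto_Lim[OF _ 2] by (simp add: trivial_limit_at_right_real trivial_limit_at_left_real)
qed

text \<open>Moving by \<open>\<delta>\<close> from \<open>x\<^sub>i - k \<alpha> + y\<close> crosses
  the point \<open>x\<^sub>i - k \<alpha>\<close>, and by \<open>separation\<close> no other
  discontinuity of the sum. Only the term \<open>j = k\<close> changes, by the jump.\<close>

lemma (in separated_orbit) sum_across_jump:
  fixes \<Phi> :: "real \<Rightarrow> 'a::euclidean_space"
  assumes step: "step_function \<Phi>" and bij: "bij_betw x {1..D} (discontinuities \<Phi>)"
    and i: "i \<in> {1..D}" and k: "k < q" and y: "- \<delta> < y" "y < 0"
  shows "(\<Sum>j<q. \<Phi> (frac (x i - real k * \<alpha> + y + \<delta> + real j * \<alpha>)))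
     = (\<Sum>j<q. \<Phi> (frac (x i - real k * \<alpha> + y + real j * \<alpha>))) + jump \<Phi> (x i)"
proof -
  define p where "p = x i - real k * \<alpha>"
  \<comment> \<open>In the window of radius \<open>\<delta>\<close> around
    \<open>p + j \<alpha>\<close> a discontinuity can occur only for \<open>j = k\<close>, and then
    only at the centre, the lift \<open>x\<^sub>i\<close> itself.\<close>
  have hit: "j = k \<and> t = p + real j * \<alpha>"
    if j: "j < q" and d: "frac t \<in> discontinuities \<Phi>" and near: "\<bar>t - (p + real j * \<alpha>)\<bar> < \<delta>" for j t
  proof -
    obtain i' where i': "i' \<in> {1..D}" "frac t = x i'" using d bij by (metis bij_betw_imp_surj_on imageE)
    have t: "t = x i' + of_int \<lfloor>t\<rfloor>" using i'(2) by (simp add: frac_def)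
    have "(x i' - real j * \<alpha>) - (x i - real k * \<alpha>) - of_int (- \<lfloor>t\<rfloor>) = t - (p + real j * \<alpha>)"
      using t by (simp add: p_def)
    then have *: "i' = i \<and> j = k \<and> - \<lfloor>t\<rfloor> = 0"
      using near by (intro separation[OF i'(1) i j k]) simp
    then show ?thesis using t by (simp add: p_def)
  qed
  have off: "\<Phi> (frac (p + y + \<delta> + real j * \<alpha>)) = \<Phi> (frac (p + y + real j * \<alpha>))" if j: "j < q" "j \<noteq> k" for j
  proof -
    have nd: "frac t \<notin> discontinuities \<Phi>" if "t \<in> {p + y + real j * \<alpha>..p + y + \<delta> + real j * \<alpha>}" for t
      using hit[OF j(1), of t] j(2) that y by (auto simp: abs_less_iff)
    show ?thesis
      by (rule step_function_constant[OF step connected_Icc nd, of "p + y + real j * \<alpha>" "p + y + \<delta> + real j * \<alpha>"])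
        (use pos in auto)
  qed
  have pk: "p + real k * \<alpha> = x i" by (simp add: p_def)
  have "jump \<Phi> (x i) = \<Phi> (frac (x i + y + \<delta>)) - \<Phi> (frac (x i + y))"
  proof (rule jump_eq[OF pos(1)])
    fix t assume t: "t \<in> {x i<..<x i + \<delta>}"
    have nd: "frac s \<notin> discontinuities \<Phi>" if "s \<in> {x i<..<x i + \<delta>}" for s
      using hit[OF k, of s] that by (auto simp: pk)
    show "\<Phi> (frac t) = \<Phi> (frac (x i + y + \<delta>))"
      by (rule step_function_constant[OF step connected_Ioo nd t]) (use y in auto)
  next
    fix t assume t: "t \<in> {x i - \<delta><..<x i}"
    have nd: "frac s \<notin> discontinuities \<Phi>" if "s \<in> {x i - \<delta><..<x i}" for s
      using hit[OF k, of s] that by (auto simp: pk)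
    show "\<Phi> (frac t) = \<Phi> (frac (x i + y))"
      by (rule step_function_constant[OF step connected_Ioo nd t]) (use y in auto)
  qed
  then have kk: "\<Phi> (frac (p + y + \<delta> + real k * \<alpha>)) = \<Phi> (frac (p + y + real k * \<alpha>)) + jump \<Phi> (x i)"
    by (simp add: p_def algebra_simps)
  have "(\<Sum>j<q. \<Phi> (frac (p + y + \<delta> + real j * \<alpha>)))
     = \<Phi> (frac (p + y + \<delta> + real k * \<alpha>)) + (\<Sum>j\<in>{..<q} - {k}. \<Phi> (frac (p + y + \<delta> + real j * \<alpha>)))"
    using k by (intro sum.remove) auto
  also have "(\<Sum>j\<in>{..<q} - {k}. \<Phi> (frac (p + y + \<delta> + real j * \<alpha>)))
     = (\<Sum>j\<in>{..<q} - {k}. \<Phi> (frac (p + y + real j * \<alpha>)))"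
    using off by (intro sum.cong) auto
  also have "\<Phi> (frac (p + y + \<delta> + real k * \<alpha>)) + \<dots>
     = jump \<Phi> (x i) + (\<Phi> (frac (p + y + real k * \<alpha>)) + (\<Sum>j\<in>{..<q} - {k}. \<Phi> (frac (p + y + real j * \<alpha>))))"
    unfolding kk by simp
  also have "\<Phi> (frac (p + y + real k * \<alpha>)) + (\<Sum>j\<in>{..<q} - {k}. \<Phi> (frac (p + y + real j * \<alpha>)))
     = (\<Sum>j<q. \<Phi> (frac (p + y + real j * \<alpha>)))"
    using k by (intro sum.remove[symmetric]) auto
  finally show ?thesis unfolding p_def by (simp add: add.commute)
qed

context separated_orbit
begin

text \<open>The arcs of length \<open>\<delta>\<close> ending at the points
  \<open>x\<^sub>i - k \<alpha>\<close>, encoded as rotated copies of the arc ending at 0 so that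
  each measure is immediate.\<close>

definition "left_arcs i = (\<Union>k<q. rot_vimage (real k * \<alpha> - x i) {1 - \<delta><..<1})"

lemma left_arcs_cases:
  assumes "u \<in> rot_vimage (real k * \<alpha> - x i) {1 - \<delta><..<1}"
  obtains y m where "u = x i - real k * \<alpha> + y + of_int m" "- \<delta> < y" "y < 0"
proof
  define m where "m = \<lfloor>u + (real k * \<alpha> - x i)\<rfloor> + 1"
  define y where "y = frac (u + (real k * \<alpha> - x i)) - 1"
  show "u = x i - real k * \<alpha> + y + of_int m" by (simp add: y_def m_def frac_def)
  show "- \<delta> < y" "y < 0" using assms by (auto simp: rot_vimage_def rot_def y_def)
qed

lemma arc_measure: "{1 - \<delta><..<1} \<in> sets torus" "measure torus {1 - \<delta><..<1} = \<delta>"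
proof -
  show m: "{1 - \<delta><..<1} \<in> sets torus" using delta_le_1 by (auto simp: sets_torus_iff)
  show "measure torus {1 - \<delta><..<1} = \<delta>"
    using emeasure_torus[OF m] pos by (simp add: measure_def)
qed

text \<open>Two arcs with a common point would have right endpoints less than
  \<open>\<delta>\<close> apart, against \<open>separation\<close>. With
  \<open>\<delta> = c / q\<close> the total is \<open>c\<close>, independent of
  \<open>q\<close>.\<close>

lemma measure_left_arcs:
  assumes "i \<in> {1..D}"
  shows "left_arcs i \<in> sets torus" "measure torus (left_arcs i) = real q * \<delta>"
proof -
  show "left_arcs i \<in> sets torus" unfolding left_arcs_def using arc_measure by auto
  have "disjoint_family_on (\<lambda>k. rot_vimage (real k * \<alpha> - x i) {1 - \<delta><..<1}) {..<q}"
    unfolding disjoint_family_on_def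
  proof (intro ballI impI)
    fix k l assume kl: "k \<in> {..<q}" "l \<in> {..<q}" "k \<noteq> l"
    show "rot_vimage (real k * \<alpha> - x i) {1 - \<delta><..<1} \<inter> rot_vimage (real l * \<alpha> - x i) {1 - \<delta><..<1} = {}"
    proof (rule ccontr)
      assume "\<not> ?thesis"
      then obtain u where u: "u \<in> rot_vimage (real k * \<alpha> - x i) {1 - \<delta><..<1}"
         "u \<in> rot_vimage (real l * \<alpha> - x i) {1 - \<delta><..<1}" by blast
      obtain y m where 1: "u = x i - real k * \<alpha> + y + of_int m" "- \<delta> < y" "y < 0"
        using left_arcs_cases[OF u(1)] .
      obtain y' m' where 2: "u = x i - real l * \<alpha> + y' + of_int m'" "- \<delta> < y'" "y' < 0"
        using left_arcs_cases[OF u(2)] .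
      have "(x i - real k * \<alpha>) - (x i - real l * \<alpha>) - of_int (m' - m) = y' - y" using 1(1) 2(1) by simp
      then have "k = l" using separation[OF assms assms, of k l "m' - m"] kl 1 2 by (auto simp: abs_less_iff)
      then show False using kl by simp
    qed
  qed
  then have "measure torus (left_arcs i) = (\<Sum>k<q. measure torus (rot_vimage (real k * \<alpha> - x i) {1 - \<delta><..<1}))"
    unfolding left_arcs_def using arc_measure by (intro torus.finite_measure_finite_Union) auto
  then show "measure torus (left_arcs i) = real q * \<delta>"
    using arc_measure by (simp add: measure_rot_vimage)
qed

lemma cocycle_sum_across_jump:
  fixes \<Phi> :: "real \<Rightarrow> 'a::euclidean_space"
  assumes step: "step_function \<Phi>" and bij: "bij_betw x {1..D} (discontinuities \<Phi>)"
    and i: "i \<in> {1..D}" and u: "u \<in> left_arcs i"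
  shows "cocycle_sum \<alpha> \<Phi> (int q) (rot \<delta> u) = cocycle_sum \<alpha> \<Phi> (int q) u + jump \<Phi> (x i)"
proof -
  obtain k where k: "k < q" "u \<in> rot_vimage (real k * \<alpha> - x i) {1 - \<delta><..<1}"
    using u by (auto simp: left_arcs_def)
  obtain y m where y: "u = x i - real k * \<alpha> + y + of_int m" "- \<delta> < y" "y < 0"
    using left_arcs_cases[OF k(2)] .
  have 1: "rot (real j * \<alpha>) (rot \<delta> u) = frac (x i - real k * \<alpha> + y + \<delta> + real j * \<alpha>)" for j
  proof -
    have "rot (real j * \<alpha>) (rot \<delta> u) = frac ((x i - real k * \<alpha> + y + \<delta> + real j * \<alpha>) + of_int m)"
      unfolding rot_rot unfolding rot_def y(1) by (rule arg_cong[of _ _ frac]) simp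
    then show ?thesis by simp
  qed
  have 2: "rot (real j * \<alpha>) u = frac (x i - real k * \<alpha> + y + real j * \<alpha>)" for j
  proof -
    have "rot (real j * \<alpha>) u = frac ((x i - real k * \<alpha> + y + real j * \<alpha>) + of_int m)"
      unfolding rot_def y(1) by (rule arg_cong[of _ _ frac]) simp
    then show ?thesis by simp
  qed
  show ?thesis unfolding cocycle_sum_of_nat 1 2 by (rule sum_across_jump[OF step bij i k(1) y(2,3)])
qed

end

section \<open>From almost invariance and compactness to essential jumps\<close>

lemma conv_denom_sequence:
  assumes irr: "\<alpha> \<notin> \<rat>" and Q: "infinite Q" "Q \<subseteq> range (conv_denom \<alpha>)"
  obtains q :: "nat \<Rightarrow> nat" and p :: "nat \<Rightarrow> int" where "\<And>n. q n \<in> Q" "\<And>n. 1 \<le> q n" "\<And>n. coprime (p n) (int (q n))"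
    "\<And>n. \<bar>real (q n) * \<alpha> - of_int (p n)\<bar> < 1 / real (q n)" "(\<lambda>n. real (q n) * \<alpha> - of_int (p n)) \<longlonglongrightarrow> 0"
proof -
  define q where "q = enumerate Q"
  have qQ: "q n \<in> Q" for n using Q(1) by (simp add: q_def enumerate_in_set)
  have "\<exists>p. coprime p (int (q n)) \<and> \<bar>real (q n) * \<alpha> - of_int p\<bar> < 1 / real (q n) \<and> 1 \<le> q n" for n
    using conv_denom_approx[OF irr] qQ Q(2) by (metis subsetD)
  then obtain p where p: "\<And>n. coprime (p n) (int (q n)) \<and> \<bar>real (q n) * \<alpha> - of_int (p n)\<bar> < 1 / real (q n) \<and> 1 \<le> q n"
    by metis
  have "(\<lambda>n. \<bar>real (q n) * \<alpha> - of_int (p n)\<bar>) \<longlonglongrightarrow> 0"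
  proof (rule tendsto_zero_bound)
    fix n
    have "n \<le> q n" unfolding q_def by (rule le_enumerate[OF Q(1)])
    \<comment> \<open>Since \<open>q n\<close> is at least \<open>n\<close> and at least 1,
      \<open>n + 1 \<le> 2 q n\<close>.\<close>
    then have "1 / real (q n) \<le> 2 * inverse (real (Suc n))" using p[of n] by (simp add: field_simps)
    then show "\<bar>real (q n) * \<alpha> - of_int (p n)\<bar> \<le> 2 * inverse (real (Suc n))" using p[of n] by linarith
    show "(\<lambda>n. 2 * inverse (real (Suc n))) \<longlonglongrightarrow> 0"
      using tendsto_mult_right_zero[OF LIMSEQ_inverse_real_of_nat] .
  qed simp
  then have "(\<lambda>n. real (q n) * \<alpha> - of_int (p n)) \<longlonglongrightarrow> 0" by (rule tendsto_rabs_zero_cancel)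
  then show thesis using that qQ p by blast
qed

text \<open>The sums \<open>\<Phi>\<^sub>q\<close> live in a fixed ball, and on the arcs left and right of \<open>x\<^sub>i - k\<alpha>\<close> they take values
  \<open>g\<close> and \<open>g + \<sigma>\<close>.  If no pair \<open>g\<close>, \<open>g + \<sigma>\<close> consisted of essential values, compactness of
  the ball would make the left arcs negligible, while their total length is \<open>c\<close>.\<close>

lemma jump_essential_value:
  fixes \<Phi> :: "real \<Rightarrow> 'a::euclidean_space"
  assumes irr: "\<alpha> \<notin> \<rat>" and step: "step_function \<Phi>" and int0: "(\<integral>v. \<Phi> v \<partial>torus) = 0"
    and bij: "bij_betw x {1..D} (discontinuities \<Phi>)"
    and dist: "\<And>n. n \<ge> 1 \<Longrightarrow> distinct (disc_orbit \<alpha> x D n)"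
    and sep: "well_separated \<alpha> x D" and i: "i \<in> {1..D}"
  shows "jump \<Phi> (x i) \<in> essential_values \<alpha> \<Phi>"
proof (rule ccontr)
  assume notE: "jump \<Phi> (x i) \<notin> essential_values \<alpha> \<Phi>"
  define \<sigma> where "\<sigma> = jump \<Phi> (x i)"
  have \<Phi>: "\<Phi> \<in> borel_measurable torus" by (rule step_function_measurable[OF step])
  obtain c Q where c: "c > 0" and Q: "infinite Q" "Q \<subseteq> range (conv_denom \<alpha>)"
    and gap: "\<And>q l. q \<in> Q \<Longrightarrow> l \<in> {1..D * q} \<Longrightarrow> disc_gap \<alpha> x D q l \<ge> c / real q"
    using sep unfolding well_separated_def by blast
  obtain q :: "nat \<Rightarrow> nat" and p :: "nat \<Rightarrow> int" where qQ: "\<And>n. q n \<in> Q" and q1: "\<And>n. 1 \<le> q n"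
    and cop: "\<And>n. coprime (p n) (int (q n))" and app: "\<And>n. \<bar>real (q n) * \<alpha> - of_int (p n)\<bar> < 1 / real (q n)"
    and lim: "(\<lambda>n. real (q n) * \<alpha> - of_int (p n)) \<longlonglongrightarrow> 0"
    using conv_denom_sequence[OF irr Q] by blast
  have so: "separated_orbit \<alpha> x D (q n) (c / real (q n))" for n
  proof
    show "0 < c / real (q n)" using c q1[of n] by simp
    show "1 \<le> D" using i by simp
  qed (use dist q1 gap qQ in auto)
  define L where "L n = separated_orbit.left_arcs \<alpha> x (q n) (c / real (q n)) i" for n
  have L: "L n \<in> sets torus" "measure torus (L n) = c" for n
    using separated_orbit.measure_left_arcs[OF so i, of n] q1[of n] by (auto simp: L_def)
  have cross: "cocycle_sum \<alpha> \<Phi> (int (q n)) (rot (c / real (q n)) u) = cocycle_sum \<alpha> \<Phi> (int (q n)) u + \<sigma>"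
    if "u \<in> L n" for n u
    using separated_orbit.cocycle_sum_across_jump[OF so step bij i that[unfolded L_def]] by (simp add: \<sigma>_def)
  have finR: "finite (\<Phi> ` {0..<1})" by (rule step_function_finite_range[OF step])
  have find: "finite (discontinuities \<Phi>)" using bij by (auto simp: bij_betw_finite[symmetric])
  obtain M where M: "\<And>y. y \<in> \<Phi> ` {0..<1} \<Longrightarrow> norm y \<le> M"
    using finite_imp_bounded[OF finR] by (auto simp: bounded_iff)
  define C where "C = 6 * real (card (discontinuities \<Phi>)) * M"
  have DK: "norm (cocycle_sum \<alpha> \<Phi> (int (q n)) u) \<le> C" for n u
    unfolding C_def by (rule denjoy_koksma_step[OF step int0 find _ cop q1 app]) (auto intro!: M simp: frac_lt_1)
  \<comment> \<open>At least one of \<open>g\<close> and \<open>g + \<sigma>\<close> is not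
    essential, otherwise their difference \<open>\<sigma>\<close> would be. If it is
    \<open>g + \<sigma>\<close>, rotation by \<open>c / q\<close> carries the left arcs across the
    jump and transfers the vanishing from \<open>g + \<sigma>\<close> back to
    \<open>g\<close>.\<close>
  have "\<exists>W. open W \<and> g \<in> W \<and> (\<lambda>n. measure torus {u \<in> L n. cocycle_sum \<alpha> \<Phi> (int (q n)) u \<in> W}) \<longlonglongrightarrow> 0" for g
  proof (cases "g \<in> essential_values \<alpha> \<Phi>")
    case False
    obtain U where U: "open U" "g \<in> U"
      "(\<lambda>n. measure torus {x\<in>{0..<1}. cocycle_sum \<alpha> \<Phi> (int (q n)) x \<in> U}) \<longlonglongrightarrow> 0"
      using not_essential_value_vanishing[OF irr step lim False] .
    have B: "{x\<in>{0..<1}. cocycle_sum \<alpha> \<Phi> (int (q n)) x \<in> U} \<in> sets torus" for n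
      using measurable_sets[OF borel_measurable_cocycle_sum[OF \<Phi>] borel_open[OF U(1)], of \<alpha> "int (q n)"]
      by (simp add: vimage_def Int_def conj_commute)
    have "(\<lambda>n. measure torus {u \<in> L n. cocycle_sum \<alpha> \<Phi> (int (q n)) u \<in> U}) \<longlonglongrightarrow> 0"
    proof (rule tendsto_zero_bound[OF measure_nonneg torus.finite_measure_mono[OF _ B] U(3)])
      show "{u \<in> L n. cocycle_sum \<alpha> \<Phi> (int (q n)) u \<in> U}
          \<subseteq> {x\<in>{0..<1}. cocycle_sum \<alpha> \<Phi> (int (q n)) x \<in> U}" for n
        using sets.sets_into_space[OF L(1)[of n]] by auto
    qed
    then show ?thesis using U by blast
  next
    case True
    have gs: "g + \<sigma> \<notin> essential_values \<alpha> \<Phi>"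
    proof
      assume "g + \<sigma> \<in> essential_values \<alpha> \<Phi>"
      then have "(g + \<sigma>) + (- g) \<in> essential_values \<alpha> \<Phi>"
        by (rule essential_values_add[OF \<Phi> _ essential_values_uminus[OF \<Phi> True]])
      then show False using notE by (simp add: \<sigma>_def)
    qed
    obtain U where U: "open U" "g + \<sigma> \<in> U"
      "(\<lambda>n. measure torus {x\<in>{0..<1}. cocycle_sum \<alpha> \<Phi> (int (q n)) x \<in> U}) \<longlonglongrightarrow> 0"
      using not_essential_value_vanishing[OF irr step lim gs] .
    define W where "W = (\<lambda>w. w + \<sigma>) -` U"
    have "open W" unfolding W_def by (intro open_vimage U(1) continuous_intros)
    moreover have "g \<in> W" using U(2) by (simp add: W_def)
    ultimately have W: "open W" "g \<in> W" .
    have B: "{x\<in>{0..<1}. cocycle_sum \<alpha> \<Phi> (int (q n)) x \<in> U} \<in> sets torus" for n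
      using measurable_sets[OF borel_measurable_cocycle_sum[OF \<Phi>] borel_open[OF U(1)], of \<alpha> "int (q n)"]
      by (simp add: vimage_def Int_def conj_commute)
    have "measure torus {u \<in> L n. cocycle_sum \<alpha> \<Phi> (int (q n)) u \<in> W}
        \<le> measure torus {x\<in>{0..<1}. cocycle_sum \<alpha> \<Phi> (int (q n)) x \<in> U}" for n
    proof -
      have "measure torus {u \<in> L n. cocycle_sum \<alpha> \<Phi> (int (q n)) u \<in> W}
        \<le> measure torus (rot_vimage (c / real (q n)) {x\<in>{0..<1}. cocycle_sum \<alpha> \<Phi> (int (q n)) x \<in> U})"
      proof (rule torus.finite_measure_mono[OF _ sets_rot_vimage[OF B]])
        show "{u \<in> L n. cocycle_sum \<alpha> \<Phi> (int (q n)) u \<in> W}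
          \<subseteq> rot_vimage (c / real (q n)) {x\<in>{0..<1}. cocycle_sum \<alpha> \<Phi> (int (q n)) x \<in> U}"
          using sets.sets_into_space[OF L(1)[of n]] cross[of _ n] by (auto simp: rot_vimage_def W_def)
      qed
      then show ?thesis by (simp only: measure_rot_vimage[OF B])
    qed
    then have "(\<lambda>n. measure torus {u \<in> L n. cocycle_sum \<alpha> \<Phi> (int (q n)) u \<in> W}) \<longlonglongrightarrow> 0"
      by (rule tendsto_zero_bound[OF measure_nonneg _ U(3)])
    then show ?thesis using W by blast
  qed
  then have "\<forall>g. \<exists>W. open W \<and> g \<in> W \<and> (\<lambda>n. measure torus {u \<in> L n. cocycle_sum \<alpha> \<Phi> (int (q n)) u \<in> W}) \<longlonglongrightarrow> 0"
    by blast
  from choice[OF this] obtain W where W: "\<And>g. open (W g)" "\<And>g. g \<in> W g"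
    "\<And>g. (\<lambda>n. measure torus {u \<in> L n. cocycle_sum \<alpha> \<Phi> (int (q n)) u \<in> W g}) \<longlonglongrightarrow> 0" by blast
  obtain G where G: "finite G" "cball 0 C \<subseteq> (\<Union>g\<in>G. W g)"
  proof (rule compactE_image[OF compact_cball[of 0 C], of "UNIV" W])
    show "cball 0 C \<subseteq> \<Union> (range W)" using W(2) by blast
  qed (use W(1) in auto)
  have mW: "{u \<in> L n. cocycle_sum \<alpha> \<Phi> (int (q n)) u \<in> W g} \<in> sets torus" for n g
  proof -
    have "{u \<in> L n. cocycle_sum \<alpha> \<Phi> (int (q n)) u \<in> W g} = L n \<inter> (cocycle_sum \<alpha> \<Phi> (int (q n)) -` W g \<inter> space torus)"
      using sets.sets_into_space[OF L(1)[of n]] by auto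
    then show ?thesis
      using measurable_sets[OF borel_measurable_cocycle_sum[OF \<Phi>] borel_open[OF W(1)]] L(1) by auto
  qed
  have "measure torus (L n) \<le> (\<Sum>g\<in>G. measure torus {u \<in> L n. cocycle_sum \<alpha> \<Phi> (int (q n)) u \<in> W g})" for n
  proof -
    have "L n \<subseteq> (\<Union>g\<in>G. {u \<in> L n. cocycle_sum \<alpha> \<Phi> (int (q n)) u \<in> W g})"
    proof
      fix u assume u: "u \<in> L n"
      have "cocycle_sum \<alpha> \<Phi> (int (q n)) u \<in> cball 0 C" using DK by simp
      then show "u \<in> (\<Union>g\<in>G. {u \<in> L n. cocycle_sum \<alpha> \<Phi> (int (q n)) u \<in> W g})" using G(2) u by blast
    qed
    then have "measure torus (L n) \<le> measure torus (\<Union>g\<in>G. {u \<in> L n. cocycle_sum \<alpha> \<Phi> (int (q n)) u \<in> W g})"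
      using mW G(1) by (intro torus.finite_measure_mono sets.finite_UN) auto
    also have "\<dots> \<le> (\<Sum>g\<in>G. measure torus {u \<in> L n. cocycle_sum \<alpha> \<Phi> (int (q n)) u \<in> W g})"
      using mW G(1) by (intro torus.finite_measure_subadditive_finite) auto
    finally show ?thesis .
  qed
  then have "(\<lambda>n. measure torus (L n)) \<longlonglongrightarrow> 0"
    by (rule tendsto_zero_bound[OF measure_nonneg _ tendsto_null_sum[OF W(3)]])
  then have "c = 0" by (simp add: L(2) LIMSEQ_const_iff)
  then show False using c by simp
qed

section \<open>Closed subgroups of Euclidean spaces\<close>

lemma closed_subgroup_diff: "closed_subgroup H \<Longrightarrow> g \<in> H \<Longrightarrow> h \<in> H \<Longrightarrow> g - h \<in> H"
  unfolding closed_subgroup_def by (metis add_uminus_conv_diff)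

lemma closed_subgroup_add: "closed_subgroup H \<Longrightarrow> g \<in> H \<Longrightarrow> h \<in> H \<Longrightarrow> g + h \<in> H"
  unfolding closed_subgroup_def by blast

lemma closed_subgroup_uminus: "closed_subgroup H \<Longrightarrow> h \<in> H \<Longrightarrow> - h \<in> H"
  unfolding closed_subgroup_def by blast

lemma closed_subgroup_zero: "closed_subgroup H \<Longrightarrow> 0 \<in> H"
  unfolding closed_subgroup_def by blast

lemma closed_subgroup_scaleR_int:
  fixes n :: int
  assumes "closed_subgroup H" "g \<in> H"
  shows "of_int n *\<^sub>R g \<in> H"
proof (induction n rule: int_induct[where k = 0])
  case base
  then show ?case using assms closed_subgroup_zero by simp
next
  case (step1 i)
  then show ?case using closed_subgroup_add[OF assms(1) _ assms(2)] by (simp add: scaleR_left_distrib)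
next
  case (step2 i)
  then show ?case using closed_subgroup_diff[OF assms(1) _ assms(2)] by (simp add: scaleR_left_diff_distrib)
qed

lemma closed_subgroup_closure:
  assumes "0 \<in> G" "\<And>g h. g \<in> G \<Longrightarrow> h \<in> G \<Longrightarrow> g + h \<in> G" "\<And>h. h \<in> G \<Longrightarrow> - h \<in> G"
  shows "closed_subgroup (closure G)"
  unfolding closed_subgroup_def
proof (intro conjI ballI)
  fix g h assume "g \<in> closure G" "h \<in> closure G"
  then obtain a b where "\<And>n. a n \<in> G" "a \<longlonglongrightarrow> g" "\<And>n. b n \<in> G" "b \<longlonglongrightarrow> h"
    unfolding closure_sequential by blast
  then show "g + h \<in> closure G"
    unfolding closure_sequential using assms(2) by (intro exI[of _ "\<lambda>n. a n + b n"]) (auto intro: tendsto_add)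
next
  fix h assume "h \<in> closure G"
  then obtain b where "\<And>n. b n \<in> G" "b \<longlonglongrightarrow> h"
    unfolding closure_sequential by blast
  then show "- h \<in> closure G"
    unfolding closure_sequential using assms(3) by (intro exI[of _ "\<lambda>n. - b n"]) (auto intro: tendsto_minus)
qed (use assms(1) closure_subset in auto)

text \<open>Along a subsequence the directions of the small elements converge to \<open>d\<close>,
  and the integer multiples of \<open>u\<close> nearest below length \<open>r\<close> converge to
  \<open>r *\<^sub>R d\<close>. The subsequence is exported so that properties of the
  \<open>u n\<close> can be passed on to \<open>d\<close>.\<close>

lemma closed_subgroup_line:
  fixes G :: "'b::euclidean_space set"
  assumes G: "closed_subgroup G" and u: "\<And>n. u n \<in> G" "\<And>n. u n \<noteq> 0" "u \<longlonglongrightarrow> 0"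
  obtains d s where "norm d = 1" "strict_mono (s :: nat \<Rightarrow> nat)"
    "(\<lambda>n. u (s n) /\<^sub>R norm (u (s n))) \<longlonglongrightarrow> d" "\<And>r::real. r *\<^sub>R d \<in> G"
proof -
  have "\<exists>d\<in>sphere 0 1. \<exists>s. strict_mono s \<and> ((\<lambda>n. u n /\<^sub>R norm (u n)) \<circ> s) \<longlonglongrightarrow> d"
    by (rule compact_sphere[of "0 :: 'b" 1, unfolded compact_def, rule_format]) (simp add: u(2))
  then obtain d s where d: "d \<in> sphere 0 1" "strict_mono s" "((\<lambda>n. u n /\<^sub>R norm (u n)) \<circ> s) \<longlonglongrightarrow> d"
    by blast
  have us: "(\<lambda>n. norm (u (s n))) \<longlonglongrightarrow> 0"
    using LIMSEQ_subseq_LIMSEQ[OF u(3) d(2)] by (simp add: o_def tendsto_norm_zero)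
  have "r *\<^sub>R d \<in> G" for r
  proof -
    define k where "k n = \<lfloor>r / norm (u (s n))\<rfloor>" for n
    have "(\<lambda>n. of_int (k n) * norm (u (s n)) - r) \<longlonglongrightarrow> 0"
    proof (rule Lim_null_comparison[OF _ us], intro always_eventually allI)
      fix n
      have p: "norm (u (s n)) > 0" using u(2) by simp
      have "of_int (k n) \<le> r / norm (u (s n))" "r / norm (u (s n)) < of_int (k n) + 1" by (auto simp: k_def)
      then have "of_int (k n) * norm (u (s n)) \<le> r" "r < (of_int (k n) + 1) * norm (u (s n))"
        using p by (auto simp: pos_le_divide_eq pos_divide_less_eq)
      then show "norm (of_int (k n) * norm (u (s n)) - r) \<le> norm (u (s n))"
        by (auto simp: algebra_simps abs_le_iff)
    qed
    then have "(\<lambda>n. of_int (k n) * norm (u (s n))) \<longlonglongrightarrow> r" by (simp add: LIM_zero_iff)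
    then have "(\<lambda>n. (of_int (k n) * norm (u (s n))) *\<^sub>R (u (s n) /\<^sub>R norm (u (s n)))) \<longlonglongrightarrow> r *\<^sub>R d"
      using d(3) by (intro tendsto_scaleR) (auto simp: o_def)
    moreover have "(of_int (k n) * norm (u (s n))) *\<^sub>R (u (s n) /\<^sub>R norm (u (s n))) = of_int (k n) *\<^sub>R u (s n)" for n
      using u(2)[of "s n"] by simp
    ultimately have lim: "(\<lambda>n. of_int (k n) *\<^sub>R u (s n)) \<longlonglongrightarrow> r *\<^sub>R d" by (simp only:)
    have mem: "of_int (k n) *\<^sub>R u (s n) \<in> G" for n by (rule closed_subgroup_scaleR_int[OF G u(1)])
    have "closed G" using G by (simp add: closed_subgroup_def)
    then show "r *\<^sub>R d \<in> G" by (rule closed_sequentially[OF _ mem lim])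
  qed
  then show thesis using that d by (auto simp: o_def)
qed

text \<open>For a closed subgroup \<open>H\<close>, the largest linear subspace contained in
  it.\<close>

definition line_space :: "'a::euclidean_space set \<Rightarrow> 'a set" where
  "line_space H = {z. \<forall>r. r *\<^sub>R z \<in> H}"

lemma line_space_subset: "line_space H \<subseteq> H"
  unfolding line_space_def using scaleR_one by (metis (mono_tags, lifting) mem_Collect_eq subsetI)

lemma subspace_line_space: "closed_subgroup H \<Longrightarrow> subspace (line_space H)"
  unfolding subspace_def line_space_def
  by (auto simp: closed_subgroup_zero scaleR_right_distrib closed_subgroup_add)

lemma line_space_decomp:
  assumes "closed_subgroup H"
  obtains v z where "x = v + z" "v \<in> line_space H" "\<And>w. w \<in> line_space H \<Longrightarrow> z \<bullet> w = 0" "norm z \<le> norm x"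
proof -
  have sp: "span (line_space H) = line_space H"
    using subspace_line_space[OF assms] span_eq_iff by blast
  obtain v z where vz: "v \<in> span (line_space H)" "\<And>w. w \<in> span (line_space H) \<Longrightarrow> orthogonal z w" "x = v + z"
    using orthogonal_subspace_decomp_exists[of "line_space H" x] by blast
  have "orthogonal v z" using vz(1,2) by (simp add: orthogonal_commute)
  then have "(norm x)\<^sup>2 = (norm v)\<^sup>2 + (norm z)\<^sup>2" unfolding vz(3) by (rule norm_add_Pythagorean)
  then have "(norm z)\<^sup>2 \<le> (norm x)\<^sup>2" by simp
  then have "norm z \<le> norm x" by (rule power2_le_imp_le) simp
  then show thesis using that vz sp by (simp add: orthogonal_def)
qed

text \<open>In the closed group \<open>G\<close> generated by \<open>(1, 0)\<close>, \<open>0 \<times> H\<close> and \<open>(\<alpha>, v)\<close> there are small nonzero elements;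
  once their components along lines of \<open>H\<close> are removed, a limiting direction gives a nonvertical line in \<open>G\<close>.\<close>

lemma rotation_number_in_subgroup:
  fixes H :: "'a::euclidean_space set"
  assumes H: "closed_subgroup H"
    and lim: "\<And>(n :: nat \<Rightarrow> int) (m :: nat \<Rightarrow> int) h g. (\<lambda>k. of_int (n k) * \<alpha> + of_int (m k)) \<longlonglongrightarrow> 0 \<Longrightarrow>
        (\<And>k. h k \<in> H) \<Longrightarrow> (\<lambda>k. of_int (n k) *\<^sub>R v + h k) \<longlonglongrightarrow> g \<Longrightarrow> g \<in> H"
    and q: "(\<lambda>k. real (q k) * \<alpha> - of_int (p k)) \<longlonglongrightarrow> 0" "\<And>k. real (q k) * \<alpha> - of_int (p k) \<noteq> 0"
    and y: "\<And>k. y k - real (q k) *\<^sub>R v \<in> H" "\<And>k. norm (y k) \<le> C"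
  obtains w where "w \<in> H" "\<alpha> *\<^sub>R w - v \<in> H"
proof -
  define G0 where "G0 = {(of_int n * \<alpha> + of_int m, of_int n *\<^sub>R v + h) | n m h. h \<in> H}"
  define G where "G = closure G0"
  have G0I: "(of_int n * \<alpha> + of_int m, of_int n *\<^sub>R v + h) \<in> G0" if "h \<in> H" for n m h
    using that unfolding G0_def by blast
  have G: "closed_subgroup G"
    unfolding G_def
  proof (rule closed_subgroup_closure)
    show "0 \<in> G0" using G0I[OF closed_subgroup_zero[OF H], of 0 0] by (simp add: zero_prod_def)
  next
    fix a b assume "a \<in> G0" "b \<in> G0"
    then obtain n m h n' m' h' where a: "a = (of_int n * \<alpha> + of_int m, of_int n *\<^sub>R v + h)" "h \<in> H"
      and b: "b = (of_int n' * \<alpha> + of_int m', of_int n' *\<^sub>R v + h')" "h' \<in> H" by (auto simp: G0_def)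
    then show "a + b \<in> G0" using G0I[OF closed_subgroup_add[OF H a(2) b(2)], of "n + n'" "m + m'"]
      by (simp add: algebra_simps)
  next
    fix a assume "a \<in> G0"
    then obtain n m h where a: "a = (of_int n * \<alpha> + of_int m, of_int n *\<^sub>R v + h)" "h \<in> H" by (auto simp: G0_def)
    then show "- a \<in> G0" using G0I[OF closed_subgroup_uminus[OF H a(2)], of "- n" "- m"]
      by (simp add: algebra_simps)
  qed
  have G0G: "a \<in> G0 \<Longrightarrow> a \<in> G" for a unfolding G_def using closure_subset by blast
  \<comment> \<open>The assumption \<open>lim\<close> says precisely that the vertical axis meets
    \<open>G\<close> in nothing beyond \<open>H\<close>.\<close>
  have vert: "g \<in> H" if g: "(0, g) \<in> G" for g
  proof -
    obtain a where a: "\<And>k. a k \<in> G0" "a \<longlonglongrightarrow> (0, g)" using g unfolding G_def closure_sequential by blast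
    have "\<forall>k. \<exists>n m h. a k = (of_int n * \<alpha> + of_int m, of_int n *\<^sub>R v + h) \<and> h \<in> H"
      using a(1) unfolding G0_def by blast
    then obtain n m h where nmh: "\<And>k. a k = (of_int (n k) * \<alpha> + of_int (m k), of_int (n k) *\<^sub>R v + h k)" "\<And>k. h k \<in> H"
      by metis
    show ?thesis
    proof (rule lim[of n m h])
      show "(\<lambda>k. of_int (n k) * \<alpha> + of_int (m k)) \<longlonglongrightarrow> 0" using tendsto_fst[OF a(2)] by (simp add: nmh)
      show "(\<lambda>k. of_int (n k) *\<^sub>R v + h k) \<longlonglongrightarrow> g" using tendsto_snd[OF a(2)] by (simp add: nmh)
    qed (rule nmh(2))
  qed
  have HG: "(0, h) \<in> G" if "h \<in> H" for h using G0G[OF G0I[OF that, of 0 0]] by simp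
  define e where "e k = real (q k) * \<alpha> - of_int (p k)" for k
  have yG: "(e k, y k) \<in> G" for k
    using G0G[OF G0I[OF y(1)[of k], of "int (q k)" "- p k"]] by (simp add: e_def)
  \<comment> \<open>The \<open>y k\<close> are bounded but need not be small. A limit
    \<open>g\<close> of a subsequence is vertical in \<open>G\<close>, and subtracting it makes them
    small.\<close>
  obtain g s where g: "strict_mono s" "(y \<circ> s) \<longlonglongrightarrow> g"
    using compact_cball[of "0 :: 'a" C, unfolded compact_def] y(2) by (metis mem_cball_0)
  have es: "(\<lambda>k. e (s k)) \<longlonglongrightarrow> 0" using LIMSEQ_subseq_LIMSEQ[OF q(1) g(1)] by (simp add: o_def e_def)
  have "(\<lambda>k. (e (s k), y (s k))) \<longlonglongrightarrow> (0, g)" using es g(2) by (intro tendsto_Pair) (auto simp: o_def)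
  moreover have "closed G" using G by (simp add: closed_subgroup_def)
  ultimately have gG: "(0, g) \<in> G" using yG by (metis (no_types, lifting) closed_sequentially)
  \<comment> \<open>Subtracting the component \<open>a\<close> along \<open>line_space H\<close>
    stays in \<open>G\<close> and does not enlarge the norm; what remains is orthogonal to every
    line of \<open>H\<close>.\<close>
  have "\<exists>z. (e (s k), z) \<in> G \<and> norm z \<le> norm (y (s k) - g) \<and> (\<forall>w\<in>line_space H. z \<bullet> w = 0)" for k
  proof -
    obtain a z where az: "y (s k) - g = a + z" "a \<in> line_space H" "\<And>w. w \<in> line_space H \<Longrightarrow> z \<bullet> w = 0"
      "norm z \<le> norm (y (s k) - g)"
      using line_space_decomp[OF H] by metis
    have "(0, a) \<in> G" using az(2) line_space_subset by (intro HG) blast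
    then have "(e (s k), y (s k)) - (0, g) - (0, a) \<in> G"
      by (intro closed_subgroup_diff[OF G] yG gG)
    then have "(e (s k), z) \<in> G" using az(1) by (simp add: diff_diff_eq algebra_simps)
    then show ?thesis using az by blast
  qed
  then obtain z where z: "\<And>k. (e (s k), z k) \<in> G" "\<And>k. norm (z k) \<le> norm (y (s k) - g)"
    "\<And>k w. w \<in> line_space H \<Longrightarrow> z k \<bullet> w = 0" by metis
  have z0: "z \<longlonglongrightarrow> 0"
  proof (rule Lim_null_comparison)
    show "(\<lambda>k. norm (y (s k) - g)) \<longlonglongrightarrow> 0" using g(2) by (simp add: o_def LIM_zero_iff tendsto_norm_zero_iff)
  qed (simp add: z(2))
  define u where "u k = (e (s k), z k)" for k
  have u0: "u \<longlonglongrightarrow> 0" unfolding u_def zero_prod_def by (intro tendsto_Pair es z0)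
  have une: "u k \<noteq> 0" for k using q(2) by (simp add: u_def e_def zero_prod_def)
  obtain d t where d: "norm d = 1" "strict_mono (t :: nat \<Rightarrow> nat)"
    "(\<lambda>n. u (t n) /\<^sub>R norm (u (t n))) \<longlonglongrightarrow> d" "\<And>r::real. r *\<^sub>R d \<in> G"
    using closed_subgroup_line[OF G _ une u0] z(1) unfolding u_def by blast
  have orth: "snd d \<bullet> w = 0" if w: "w \<in> line_space H" for w
  proof -
    have "(\<lambda>n. snd (u (t n) /\<^sub>R norm (u (t n))) \<bullet> w) \<longlonglongrightarrow> snd d \<bullet> w"
      by (intro tendsto_inner tendsto_snd d(3) tendsto_const)
    moreover have "snd (u (t n) /\<^sub>R norm (u (t n))) \<bullet> w = 0" for n using z(3)[OF w] by (simp add: u_def)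
    ultimately have "(\<lambda>n. 0) \<longlonglongrightarrow> snd d \<bullet> w" by (simp only:)
    then show ?thesis by (simp add: LIMSEQ_const_iff)
  qed
  \<comment> \<open>A vertical limit line would lie in \<open>line_space H\<close>, but
    \<open>snd d\<close> is orthogonal to that space.\<close>
  have "fst d \<noteq> 0"
  proof
    assume d0: "fst d = 0"
    have "r *\<^sub>R snd d \<in> H" for r
    proof (rule vert)
      have "r *\<^sub>R d = (0, r *\<^sub>R snd d)" using d0 by (simp add: prod_eq_iff)
      then show "(0, r *\<^sub>R snd d) \<in> G" using d(4)[of r] by simp
    qed
    then have "snd d \<in> line_space H" by (simp add: line_space_def)
    then have "snd d = 0" using orth by (metis inner_eq_zero_iff)
    then have "d = 0" using d0 by (simp add: prod_eq_iff)
    then show False using d(1) by simp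
  qed
  define w where "w = snd d /\<^sub>R fst d"
  have wG: "(r, r *\<^sub>R w) \<in> G" for r
  proof -
    have "(r / fst d) *\<^sub>R d = (r, r *\<^sub>R w)" using \<open>fst d \<noteq> 0\<close> by (simp add: prod_eq_iff w_def divide_inverse)
    then show ?thesis using d(4)[of "r / fst d"] by simp
  qed
  \<comment> \<open>The line of slope \<open>w\<close> is compared with the generators
    \<open>(1, 0)\<close> and \<open>(\<alpha>, v)\<close> over the same abscissae; both differences
    are vertical.\<close>
  have "(1, 1 *\<^sub>R w) - (1, 0) \<in> G"
    using G0G[OF G0I[OF closed_subgroup_zero[OF H], of 0 1]] by (intro closed_subgroup_diff[OF G] wG) simp
  then have "w \<in> H" by (intro vert) simp
  moreover have "(\<alpha>, \<alpha> *\<^sub>R w) - (\<alpha>, v) \<in> G"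
    using G0G[OF G0I[OF closed_subgroup_zero[OF H], of 1 0]] by (intro closed_subgroup_diff[OF G] wG) simp
  then have "\<alpha> *\<^sub>R w - v \<in> H" by (intro vert) simp
  ultimately show thesis by (rule that)
qed

section \<open>Reduction to a cocycle with values in the group of essential values\<close>

lemma punctured_nbhd_no_disc:
  fixes \<Phi> :: "real \<Rightarrow> 'a::topological_space"
  assumes "finite (discontinuities \<Phi>)"
  obtains \<epsilon> where "0 < \<epsilon>" "\<And>t. \<bar>t - z\<bar> < \<epsilon> \<Longrightarrow> t \<noteq> z \<Longrightarrow> frac t \<notin> discontinuities \<Phi>"
proof -
  \<comment> \<open>The lifts of discontinuities whose turn number is close to that of
    \<open>z\<close>; they include all lifts within distance 1 of \<open>z\<close>.\<close>
  define S where "S = (\<lambda>(d, n). d + real_of_int n) ` (discontinuities \<Phi> \<times> {\<lfloor>z\<rfloor> - 2..\<lfloor>z\<rfloor> + 2})"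
  have "finite S" using assms by (simp add: S_def)
  then obtain \<delta> where \<delta>: "\<delta> > 0" "\<And>t. t \<in> S \<Longrightarrow> t \<noteq> z \<Longrightarrow> \<delta> \<le> dist z t"
    using finite_set_avoid[of S z] by blast
  have "frac t \<notin> discontinuities \<Phi>" if t: "\<bar>t - z\<bar> < min \<delta> 1" "t \<noteq> z" for t
  proof
    assume d: "frac t \<in> discontinuities \<Phi>"
    have "\<lfloor>t\<rfloor> \<in> {\<lfloor>z\<rfloor> - 2..\<lfloor>z\<rfloor> + 2}" using t(1) by (auto simp: abs_less_iff) linarith+
    then have "frac t + of_int \<lfloor>t\<rfloor> \<in> S" using d unfolding S_def by (intro image_eqI[of _ _ "(frac t, \<lfloor>t\<rfloor>)"]) auto
    then have "t \<in> S" by (simp add: frac_def)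
    then show False using \<delta>(2)[of t] t by (auto simp: dist_real_def)
  qed
  then show thesis using that[of "min \<delta> 1"] \<delta>(1) by simp
qed

text \<open>Near any point only the two one-sided values occur, and they differ by 0 or by a jump.
  Congruence modulo \<open>H\<close> is thus locally constant, and connectedness of the line spreads
  it. Values at the discontinuities themselves are unconstrained, hence the restriction on
  \<open>s\<close> and \<open>t\<close>.\<close>

lemma step_mod_subgroup:
  fixes \<Phi> :: "real \<Rightarrow> 'a::euclidean_space"
  assumes step: "step_function \<Phi>" and fin: "finite (discontinuities \<Phi>)" and H: "closed_subgroup H"
    and jump: "\<And>d. d \<in> discontinuities \<Phi> \<Longrightarrow> jump \<Phi> d \<in> H"
    and st: "frac s \<notin> discontinuities \<Phi>" "frac t \<notin> discontinuities \<Phi>"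
  shows "\<Phi> (frac s) - \<Phi> (frac t) \<in> H"
proof (rule connected_equivalence_relation_gen[where S = UNIV and P = "\<lambda>t. frac t \<notin> discontinuities \<Phi>"
      and R = "\<lambda>s t. \<Phi> (frac s) - \<Phi> (frac t) \<in> H"])
  show "\<Phi> (frac a) - \<Phi> (frac c) \<in> H" if "\<Phi> (frac a) - \<Phi> (frac b) \<in> H" "\<Phi> (frac b) - \<Phi> (frac c) \<in> H" for a b c
    using closed_subgroup_add[OF H that] by simp
next
  fix T :: "real set" and a assume T: "openin (top_of_set UNIV) T" "a \<in> T"
  then have "open T" by simp
  then obtain r where r: "r > 0" "ball a r \<subseteq> T" using T(2) openE by blast
  obtain \<epsilon> where e: "0 < \<epsilon>" "\<And>t. \<bar>t - a\<bar> < \<epsilon> \<Longrightarrow> t \<noteq> a \<Longrightarrow> frac t \<notin> discontinuities \<Phi>"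
    using punctured_nbhd_no_disc[OF fin] by blast
  have "a + min r \<epsilon> / 2 \<in> ball a r" using r(1) e(1) by (auto simp: dist_real_def)
  moreover have "frac (a + min r \<epsilon> / 2) \<notin> discontinuities \<Phi>" using r(1) e(1) by (intro e(2)) auto
  ultimately show "\<exists>z. z \<in> T \<and> frac z \<notin> discontinuities \<Phi>" using r(2) by blast
next
  fix a :: real
  obtain \<epsilon> where e: "0 < \<epsilon>" "\<And>t. \<bar>t - a\<bar> < \<epsilon> \<Longrightarrow> t \<noteq> a \<Longrightarrow> frac t \<notin> discontinuities \<Phi>"
    using punctured_nbhd_no_disc[OF fin] by blast
  define R where "R = \<Phi> (frac (a + \<epsilon>/2))"
  define L where "L = \<Phi> (frac (a - \<epsilon>/2))"
  have right: "\<Phi> (frac t) = R" if t: "t \<in> {a<..<a + \<epsilon>}" for t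
  proof -
    have nd: "frac s \<notin> discontinuities \<Phi>" if "s \<in> {a<..<a + \<epsilon>}" for s
      using that by (intro e(2)) auto
    show ?thesis unfolding R_def
      by (rule step_function_constant[OF step connected_Ioo nd t]) (use e(1) in auto)
  qed
  have left: "\<Phi> (frac t) = L" if t: "t \<in> {a - \<epsilon><..<a}" for t
  proof -
    have nd: "frac s \<notin> discontinuities \<Phi>" if "s \<in> {a - \<epsilon><..<a}" for s
      using that by (intro e(2)) auto
    show ?thesis unfolding L_def
      by (rule step_function_constant[OF step connected_Ioo nd t]) (use e(1) in auto)
  qed
  have 0: "0 \<in> H" by (rule closed_subgroup_zero[OF H])
  have "\<Phi> (frac s) - \<Phi> (frac t) \<in> H"
    if s: "\<bar>s - a\<bar> < \<epsilon>" "frac s \<notin> discontinuities \<Phi>" and t: "\<bar>t - a\<bar> < \<epsilon>" "frac t \<notin> discontinuities \<Phi>" for s t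
  proof (cases "frac a \<in> discontinuities \<Phi>")
    case True
    \<comment> \<open>The hypothesis on jumps concerns the representative \<open>frac a\<close>;
      periodicity moves the one-sided values at \<open>a\<close> there.\<close>
    have sh: "frac t = frac (t + of_int \<lfloor>a\<rfloor>)" for t :: real by simp
    have "jump \<Phi> (frac a) = R - L"
    proof (rule jump_eq[OF e(1)])
      fix t assume "t \<in> {frac a<..<frac a + \<epsilon>}"
      then show "\<Phi> (frac t) = R" by (subst sh, intro right) (auto simp: frac_def)
    next
      fix t assume "t \<in> {frac a - \<epsilon><..<frac a}"
      then show "\<Phi> (frac t) = L" by (subst sh, intro left) (auto simp: frac_def)
    qed
    then have RL: "R - L \<in> H" using jump[OF True] by simp
    have LR: "L - R \<in> H" using closed_subgroup_uminus[OF H RL] by simp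
    have "\<Phi> (frac s) \<in> {R, L}" "\<Phi> (frac t) \<in> {R, L}"
    proof -
      have "s \<noteq> a" "t \<noteq> a" using s t True by auto
      then have "s \<in> {a<..<a + \<epsilon>} \<or> s \<in> {a - \<epsilon><..<a}" "t \<in> {a<..<a + \<epsilon>} \<or> t \<in> {a - \<epsilon><..<a}"
        using s(1) t(1) by (auto simp: abs_less_iff)
      then show "\<Phi> (frac s) \<in> {R, L}" "\<Phi> (frac t) \<in> {R, L}" using right left by blast+
    qed
    then show ?thesis using RL LR 0 by auto
  next
    case False
    have nd: "frac r \<notin> discontinuities \<Phi>" if "r \<in> {a - \<epsilon><..<a + \<epsilon>}" for r
      using e(2)[of r] that False by (cases "r = a") (auto simp: abs_less_iff)
    have "\<Phi> (frac s) = \<Phi> (frac t)"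
    proof (rule step_function_constant[OF step connected_Ioo nd])
      show "s \<in> {a - \<epsilon><..<a + \<epsilon>}" "t \<in> {a - \<epsilon><..<a + \<epsilon>}"
        using s(1) t(1) by (auto simp: abs_less_iff)
    qed
    then show ?thesis using 0 by simp
  qed
  then show "\<exists>T. openin (top_of_set UNIV) T \<and> a \<in> T \<and> (\<forall>x\<in>T. \<forall>y\<in>T.
      frac x \<notin> discontinuities \<Phi> \<and> frac y \<notin> discontinuities \<Phi> \<longrightarrow> \<Phi> (frac x) - \<Phi> (frac y) \<in> H)"
    using e(1) by (intro exI[of _ "ball a \<epsilon>"]) (auto simp: dist_real_def abs_minus_commute)
qed (use st in auto)

section \<open>Cocycles modulo a subgroup and modulo a coboundary\<close>

lemma AE_rot:
  assumes "AE x in torus. P x"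
  shows "AE x in torus. \<forall>k::int. P (rot (of_int k * \<alpha>) x)"
  unfolding AE_all_countable
proof
  fix k :: int
  have "AE x in distr torus torus (rot (of_int k * \<alpha>)). P x" unfolding distr_rot by (rule assms)
  then show "AE x in torus. P (rot (of_int k * \<alpha>) x)" by (rule AE_distrD[OF measurable_rot])
qed

lemma AE_torus_finite:
  assumes "finite S"
  shows "AE x in torus. x \<notin> S"
proof -
  have m: "S \<inter> {0..<1} \<in> sets torus" using assms
    by (auto simp: sets_torus_iff intro!: sets.Int borel_closed finite_imp_closed)
  have "emeasure torus (S \<inter> {0..<1}) = 0"
    using emeasure_torus[OF m] assms by (simp add: emeasure_lborel_countable countable_finite)
  then show ?thesis using m by (intro AE_I[of _ _ "S \<inter> {0..<1}"]) auto
qed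

lemma cocycle_sum_mod_subgroup:
  fixes \<Phi> :: "real \<Rightarrow> 'a::euclidean_space"
  assumes H: "closed_subgroup H" and "\<And>k::int. \<Phi> (rot (of_int k * \<alpha>) x) - v \<in> H"
  shows "cocycle_sum \<alpha> \<Phi> N x - of_int N *\<^sub>R v \<in> H"
proof (induction N rule: int_induct[where k = 0])
  case base
  then show ?case using closed_subgroup_zero[OF H] by simp
next
  case (step1 i)
  then show ?case using closed_subgroup_add[OF H step1(2) assms(2)[of i]]
    unfolding cocycle_sum_Suc of_int_add of_int_1 scaleR_left_distrib by (simp add: algebra_simps)
next
  case (step2 i)
  then show ?case using closed_subgroup_diff[OF H step2(2) assms(2)[of "i - 1"]] cocycle_sum_Suc[of \<alpha> \<Phi> "i - 1" x]
    by (simp add: algebra_simps)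
qed

lemma cocycle_sum_minus_coboundary:
  fixes \<Phi> :: "real \<Rightarrow> 'a::euclidean_space"
  shows "cocycle_sum \<alpha> (\<lambda>x. \<Phi> x - (rot \<alpha> x - x) *\<^sub>R w) N x = cocycle_sum \<alpha> \<Phi> N x - (rot (of_int N * \<alpha>) x - rot 0 x) *\<^sub>R w"
proof (induction N rule: int_induct[where k = 0])
  case base
  then show ?case by simp
next
  case (step1 i)
  then show ?case unfolding cocycle_sum_Suc by (simp add: rot_rot algebra_simps)
next
  case (step2 i)
  then show ?case
    using cocycle_sum_Suc[of \<alpha> \<Phi> "i - 1" x] cocycle_sum_Suc[of \<alpha> "\<lambda>x. \<Phi> x - (rot \<alpha> x - x) *\<^sub>R w" "i - 1" x]
    by (simp add: rot_rot algebra_simps)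
qed

text \<open>The sums of the two cocycles differ by the displacement of the point times
  \<open>w\<close>. Cutting \<open>A\<close> into short pieces and returning to the same piece makes
  this displacement small.\<close>

lemma essential_values_coboundary:
  fixes \<Phi> \<Psi> :: "real \<Rightarrow> 'a::euclidean_space"
  assumes \<Phi>: "\<Phi> \<in> borel_measurable torus" and \<Psi>: "\<Psi> \<in> borel_measurable torus"
    and eq: "AE x in torus. \<Psi> x = \<Phi> x - (rot \<alpha> x - x) *\<^sub>R w"
  shows "essential_values \<alpha> \<Phi> \<subseteq> essential_values \<alpha> \<Psi>"
proof
  fix g assume g: "g \<in> essential_values \<alpha> \<Phi>"
  show "g \<in> essential_values \<alpha> \<Psi>"
  proof (rule essential_valuesI)
    fix U A assume UA: "open U" "g \<in> U" "A \<in> sets torus" "0 < measure torus A"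
    obtain r where r: "r > 0" "ball g r \<subseteq> U" using UA(1,2) openE by blast
    \<comment> \<open>Pieces of length \<open>1 / n\<close> keep the correction below
      \<open>r / 2\<close>; the other half of \<open>r\<close> is the accuracy of the return for
      \<open>\<Phi>\<close>.\<close>
    obtain n :: nat where n: "2 * norm w / r < real n" "0 < n"
      using reals_Archimedean2[of "max 1 (2 * norm w / r)"] by (metis gr0I less_numeral_extra(3) max_less_iff_conj not_one_less_zero of_nat_0)
    define A' where "A' j = A \<inter> {real j / real n..<real (Suc j) / real n}" for j
    have mA': "A' j \<in> sets torus" for j using UA(3) by (auto simp: A'_def sets_torus_iff)
    have "A \<subseteq> (\<Union>j<n. A' j)"
    proof
      fix u assume u: "u \<in> A"
      then have u01: "0 \<le> u" "u < 1" using UA(3) by (auto simp: sets_torus_iff)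
      define j where "j = nat \<lfloor>u * real n\<rfloor>"
      have "real j \<le> u * real n" "u * real n < real j + 1" using u01 by (auto simp: j_def)
      moreover have "u * real n < real n" using u01 n(2) by simp
      ultimately have "real j < real n" "u \<in> A' j" using u n(2) by (linarith, auto simp: A'_def field_simps)
      then have "j < n" "u \<in> A' j" by auto
      then show "u \<in> (\<Union>j<n. A' j)" by blast
    qed
    then have "measure torus A \<le> measure torus (\<Union>j<n. A' j)" using mA' by (intro torus.finite_measure_mono) auto
    also have "\<dots> \<le> (\<Sum>j<n. measure torus (A' j))" using mA' by (intro torus.finite_measure_subadditive_finite) auto
    finally have "0 < (\<Sum>j<n. measure torus (A' j))" using UA(4) by simp
    then obtain j where j: "0 < measure torus (A' j)" by (meson not_less sum_nonpos)
    obtain N where N: "0 < measure torus (return_set \<alpha> \<Phi> (A' j) N (ball g (r/2)))"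
      using essential_valuesD[OF g open_ball _ mA' j, of g "r/2"] r(1) by auto
    have "AE x in torus. x \<in> return_set \<alpha> \<Phi> (A' j) N (ball g (r/2)) \<longrightarrow> x \<in> return_set \<alpha> \<Psi> A N U"
      using AE_rot[OF eq, of \<alpha>]
    proof (eventually_elim, intro impI)
      fix u assume ae: "\<forall>k::int. \<Psi> (rot (of_int k * \<alpha>) u) = \<Phi> (rot (of_int k * \<alpha>) u) -
           (rot \<alpha> (rot (of_int k * \<alpha>) u) - rot (of_int k * \<alpha>) u) *\<^sub>R w"
        and u: "u \<in> return_set \<alpha> \<Phi> (A' j) N (ball g (r/2))"
      have "cocycle_sum \<alpha> \<Psi> N u = cocycle_sum \<alpha> (\<lambda>x. \<Phi> x - (rot \<alpha> x - x) *\<^sub>R w) N u"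
        using ae unfolding cocycle_sum_def by simp
      then have cs: "cocycle_sum \<alpha> \<Psi> N u = cocycle_sum \<alpha> \<Phi> N u - (rot (of_int N * \<alpha>) u - rot 0 u) *\<^sub>R w"
        by (simp only: cocycle_sum_minus_coboundary)
      have uA: "u \<in> A' j" "rot (of_int N * \<alpha>) u \<in> A' j" using u by (auto simp: return_set_def)
      have r0: "rot 0 u = u" using uA UA(3) by (auto simp: A'_def sets_torus_iff)
      have "\<bar>rot (of_int N * \<alpha>) u - u\<bar> \<le> 1 / real n"
        using uA by (auto simp: A'_def add_divide_distrib abs_le_iff)
      then have "norm ((rot (of_int N * \<alpha>) u - u) *\<^sub>R w) \<le> 1 / real n * norm w"
        unfolding norm_scaleR by (intro mult_right_mono) auto
      also have "\<dots> < r / 2" using n r(1) by (simp add: field_simps)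
      finally have small: "norm ((rot (of_int N * \<alpha>) u - u) *\<^sub>R w) < r / 2" .
      have "dist g (cocycle_sum \<alpha> \<Phi> N u) < r / 2" using u by (simp add: return_set_def)
      then have "dist g (cocycle_sum \<alpha> \<Psi> N u) < r"
        using small dist_triangle[of g "cocycle_sum \<alpha> \<Psi> N u" "cocycle_sum \<alpha> \<Phi> N u"]
        by (simp add: cs r0 dist_norm)
      then show "u \<in> return_set \<alpha> \<Psi> A N U" using uA r(2) by (auto simp: return_set_def A'_def)
    qed
    then have "measure torus (return_set \<alpha> \<Phi> (A' j) N (ball g (r/2))) \<le> measure torus (return_set \<alpha> \<Psi> A N U)"
      using \<Psi> UA by (intro torus.finite_measure_mono_AE) (auto intro!: sets_return_set)
    then show "\<exists>N. 0 < measure torus (return_set \<alpha> \<Psi> A N U)" using N by (intro exI[of _ N]) linarith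
  qed
qed

text \<open>Almost everywhere \<open>\<Phi>\<^sub>n\<close> is congruent to \<open>n v\<close>
  modulo the essential values. When \<open>n \<alpha>\<close> is near an integer, part of
  \<open>A\<close> returns, and the value there is near \<open>g\<close> modulo essential values.
  This provides the hypothesis \<open>lim\<close> of
  \<open>rotation_number_in_subgroup\<close>.\<close>

lemma essential_value_if_constant_mod:
  fixes \<Phi> :: "real \<Rightarrow> 'a::euclidean_space"
  assumes \<Phi>: "\<Phi> \<in> borel_measurable torus"
    and ae: "AE x in torus. \<Phi> x - v \<in> essential_values \<alpha> \<Phi>"
    and lim: "(\<lambda>k. of_int (n k) * \<alpha> + of_int (m k)) \<longlonglongrightarrow> 0"
    and h: "\<And>k. h k \<in> essential_values \<alpha> \<Phi>" "(\<lambda>k. of_int (n k) *\<^sub>R v + h k) \<longlonglongrightarrow> g"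
  shows "g \<in> essential_values \<alpha> \<Phi>"
proof (rule essential_value_if_returns_mod[OF \<Phi>])
  fix r :: real and A assume r: "0 < r" and A: "A \<in> sets torus" "0 < measure torus A"
  have H: "closed_subgroup (essential_values \<alpha> \<Phi>)" by (rule closed_subgroup_essential_values[OF \<Phi>])
  obtain \<delta> where \<delta>: "\<delta> > 0" "\<And>t. \<bar>t\<bar> < \<delta> \<Longrightarrow> measure torus (A - rot_vimage t A) < measure torus A"
    using rot_small[OF A] by blast
  have "\<forall>\<^sub>F k in sequentially. dist (of_int (n k) * \<alpha> + of_int (m k)) 0 < \<delta> \<and> dist (of_int (n k) *\<^sub>R v + h k) g < r"
    by (intro eventually_conj tendstoD[OF lim \<delta>(1)] tendstoD[OF h(2) r])
  then obtain k where k: "\<bar>of_int (n k) * \<alpha> + of_int (m k)\<bar> < \<delta>" "dist (of_int (n k) *\<^sub>R v + h k) g < r"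
    by (auto simp: eventually_sequentially dist_real_def)
  define U where "U = (\<Union>e\<in>essential_values \<alpha> \<Phi>. ball (g + e) r)"
  have mU: "return_set \<alpha> \<Phi> A (n k) U \<in> sets torus"
    unfolding U_def by (intro sets_return_set \<Phi> A borel_open open_UN ballI open_ball)
  have "rot_vimage (of_int (n k) * \<alpha>) A = rot_vimage (of_int (n k) * \<alpha> + of_int (m k)) A"
    by (simp add: rot_vimage_def)
  then have "measure torus (A - rot_vimage (of_int (n k) * \<alpha>) A) < measure torus A" using \<delta>(2)[OF k(1)] by simp
  moreover have "measure torus A \<le> measure torus ((A - rot_vimage (of_int (n k) * \<alpha>) A) \<union> return_set \<alpha> \<Phi> A (n k) U)"
  proof (rule torus.finite_measure_mono_AE)
    show "AE x in torus. x \<in> A \<longrightarrow> x \<in> (A - rot_vimage (of_int (n k) * \<alpha>) A) \<union> return_set \<alpha> \<Phi> A (n k) U"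
      using AE_rot[OF ae, of \<alpha>]
    proof (eventually_elim, intro impI)
      fix u assume ae: "\<forall>k::int. \<Phi> (rot (of_int k * \<alpha>) u) - v \<in> essential_values \<alpha> \<Phi>" and u: "u \<in> A"
      have e: "cocycle_sum \<alpha> \<Phi> (n k) u - of_int (n k) *\<^sub>R v - h k \<in> essential_values \<alpha> \<Phi>"
        using ae by (intro closed_subgroup_diff[OF H cocycle_sum_mod_subgroup[OF H] h(1)]) auto
      have "dist (g + (cocycle_sum \<alpha> \<Phi> (n k) u - of_int (n k) *\<^sub>R v - h k)) (cocycle_sum \<alpha> \<Phi> (n k) u) < r"
        using k(2) by (simp add: dist_norm norm_minus_commute algebra_simps)
      then have "cocycle_sum \<alpha> \<Phi> (n k) u \<in> U" unfolding U_def using e by (intro UN_I) auto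
      then show "u \<in> (A - rot_vimage (of_int (n k) * \<alpha>) A) \<union> return_set \<alpha> \<Phi> A (n k) U"
        using u by (auto simp: return_set_def rot_vimage_def)
    qed
  qed (use mU A in auto)
  moreover have "measure torus ((A - rot_vimage (of_int (n k) * \<alpha>) A) \<union> return_set \<alpha> \<Phi> A (n k) U)
     \<le> measure torus (A - rot_vimage (of_int (n k) * \<alpha>) A) + measure torus (return_set \<alpha> \<Phi> A (n k) U)"
    using mU A by (intro measure_Un_le) auto
  ultimately show "\<exists>N. 0 < measure torus (return_set \<alpha> \<Phi> A N (\<Union>e\<in>essential_values \<alpha> \<Phi>. ball (g + e) r))"
    unfolding U_def[symmetric] by (intro exI[of _ "n k"]) linarith
qed

lemma regularizing_cocycle:
  fixes \<Phi> :: "real \<Rightarrow> 'a::euclidean_space"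
  assumes irr: "\<alpha> \<notin> \<rat>" and step: "step_function \<Phi>" and int0: "(\<integral>v. \<Phi> v \<partial>torus) = 0"
    and find: "finite (discontinuities \<Phi>)"
    and jump: "\<And>d. d \<in> discontinuities \<Phi> \<Longrightarrow> jump \<Phi> d \<in> essential_values \<alpha> \<Phi>"
    and Q: "infinite Q" "Q \<subseteq> range (conv_denom \<alpha>)"
  obtains \<Psi> where "\<Psi> \<in> borel_measurable torus" "\<And>x. \<Psi> x \<in> essential_values \<alpha> \<Phi>"
    "cohomologous \<alpha> \<Phi> \<Psi>" "essential_values \<alpha> \<Phi> \<subseteq> essential_values \<alpha> \<Psi>"
proof -
  define H where "H = essential_values \<alpha> \<Phi>"
  have \<Phi>: "\<Phi> \<in> borel_measurable torus" by (rule step_function_measurable[OF step])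
  have H: "closed_subgroup H" unfolding H_def by (rule closed_subgroup_essential_values[OF \<Phi>])
  obtain \<epsilon> where e: "0 < \<epsilon>" "\<And>t. \<bar>t - 0\<bar> < \<epsilon> \<Longrightarrow> t \<noteq> 0 \<Longrightarrow> frac t \<notin> discontinuities \<Phi>"
    using punctured_nbhd_no_disc[OF find] by blast
  \<comment> \<open>The value at a point off the discontinuities; by
    \<open>step_mod_subgroup\<close> another such point changes \<open>v\<close> only by an element
    of \<open>H\<close>.\<close>
  define v where "v = \<Phi> (frac (\<epsilon> / 2))"
  have nd: "frac (\<epsilon> / 2) \<notin> discontinuities \<Phi>" using e(1) by (intro e(2)) auto
  have "AE x in torus. x \<in> {0..<1} \<and> x \<notin> discontinuities \<Phi>"
    using AE_torus_finite[OF find] AE_space[of torus] by eventually_elim simp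
  then have ae: "AE x in torus. \<Phi> x - v \<in> H"
  proof eventually_elim
    fix u assume u: "u \<in> {0..<1} \<and> u \<notin> discontinuities \<Phi>"
    then have fu: "frac u = u" by (simp add: frac_eq)
    show "\<Phi> u - v \<in> H"
      using step_mod_subgroup[OF step find H, of u "\<epsilon> / 2"] jump u nd by (simp add: v_def H_def fu)
  qed
  obtain q :: "nat \<Rightarrow> nat" and p :: "nat \<Rightarrow> int" where qQ: "\<And>n. q n \<in> Q" and q1: "\<And>n. 1 \<le> q n"
    and cop: "\<And>n. coprime (p n) (int (q n))" and app: "\<And>n. \<bar>real (q n) * \<alpha> - of_int (p n)\<bar> < 1 / real (q n)"
    and lim: "(\<lambda>n. real (q n) * \<alpha> - of_int (p n)) \<longlonglongrightarrow> 0"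
    using conv_denom_sequence[OF irr Q] by blast
  have finR: "finite (\<Phi> ` {0..<1})" by (rule step_function_finite_range[OF step])
  obtain M where M: "\<And>y. y \<in> \<Phi> ` {0..<1} \<Longrightarrow> norm y \<le> M"
    using finite_imp_bounded[OF finR] by (auto simp: bounded_iff)
  define C where "C = 6 * real (card (discontinuities \<Phi>)) * M"
  have DK: "norm (cocycle_sum \<alpha> \<Phi> (int (q n)) u) \<le> C" for n u
    unfolding C_def by (rule denjoy_koksma_step[OF step int0 find _ cop q1 app]) (auto intro!: M simp: frac_lt_1)
  \<comment> \<open>The Denjoy-Koksma bound holds at every point, so one orbit with all terms
    congruent to \<open>v\<close> suffices.\<close>
  obtain x0 where x0: "\<And>k::int. \<Phi> (rot (of_int k * \<alpha>) x0) - v \<in> H"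
  proof -
    have "\<not> (AE x in torus. False)"
    proof
      assume "AE x in torus. False"
      then have "emeasure torus (space torus) = 0" by (subst (asm) AE_iff_measurable[of "space torus"]) auto
      then show False using measure_torus_space by (simp add: measure_def)
    qed
    then show thesis using AE_rot[OF ae, of \<alpha>] that by (metis (mono_tags, lifting) eventually_mono)
  qed
  obtain w where w: "w \<in> H" "\<alpha> *\<^sub>R w - v \<in> H"
  proof (rule rotation_number_in_subgroup[OF H])
    show "g \<in> H" if "(\<lambda>k. of_int (n k) * \<alpha> + of_int (m k)) \<longlonglongrightarrow> 0" "\<And>k. h k \<in> H" "(\<lambda>k. of_int (n k) *\<^sub>R v + h k) \<longlonglongrightarrow> g"
      for n m :: "nat \<Rightarrow> int" and h g
      using essential_value_if_constant_mod[OF \<Phi> ae[unfolded H_def] that(1)] that(2,3) unfolding H_def by blast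
    show "real (q k) * \<alpha> - of_int (p k) \<noteq> 0" for k
    proof
      assume "real (q k) * \<alpha> - of_int (p k) = 0"
      then have "\<alpha> = of_int (p k) / real (q k)" using q1[of k] by (simp add: field_simps)
      then show False using irr by simp
    qed
    show "cocycle_sum \<alpha> \<Phi> (int (q k)) x0 - real (q k) *\<^sub>R v \<in> H" for k
      using cocycle_sum_mod_subgroup[of H \<Phi> \<alpha> x0 v "int (q k)", OF H x0] by simp
  qed (use lim DK in auto)
  define \<Psi>0 where "\<Psi>0 u = \<Phi> u - (rot \<alpha> u - u) *\<^sub>R w" for u
  \<comment> \<open>The exceptional null set is given the value 0, since regularity asks for values
    in \<open>H\<close> at every point.\<close>
  define \<Psi> where "\<Psi> u = (if \<Psi>0 u \<in> H then \<Psi>0 u else 0)" for u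
  have idm: "(\<lambda>u. u) \<in> borel_measurable torus" unfolding torus_def by (intro measurable_restrict_space1) simp
  have rm: "rot \<alpha> \<in> borel_measurable torus" using measurable_compose[OF measurable_rot idm] .
  have m0: "\<Psi>0 \<in> borel_measurable torus" unfolding \<Psi>0_def using \<Phi> idm rm by measurable
  have Hb[measurable]: "H \<in> sets borel" using H by (simp add: closed_subgroup_def borel_closed)
  have m: "\<Psi> \<in> borel_measurable torus" unfolding \<Psi>_def using m0 by measurable
  have eq: "AE u in torus. \<Psi> u = \<Psi>0 u"
    using ae AE_space[of torus]
  proof eventually_elim
    fix u assume u: "\<Phi> u - v \<in> H"
    have d: "rot \<alpha> u - u = \<alpha> - of_int \<lfloor>u + \<alpha>\<rfloor>" by (simp add: rot_def frac_def)
    \<comment> \<open>The rotation displaces \<open>u\<close> by \<open>\<alpha>\<close> minus an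
      integer, so each of the three summands lies in \<open>H\<close>.\<close>
    have "\<Psi>0 u = (\<Phi> u - v) - (\<alpha> *\<^sub>R w - v) + of_int \<lfloor>u + \<alpha>\<rfloor> *\<^sub>R w"
      unfolding \<Psi>0_def d by (simp add: scaleR_left_diff_distrib)
    also have "\<dots> \<in> H"
      by (intro closed_subgroup_add[OF H] closed_subgroup_diff[OF H] u w closed_subgroup_scaleR_int[OF H])
    finally show "\<Psi> u = \<Psi>0 u" by (simp add: \<Psi>_def)
  qed
  show thesis
  proof (rule that[OF m])
    show "\<Psi> u \<in> essential_values \<alpha> \<Phi>" for u
      using closed_subgroup_zero[OF H] by (auto simp: \<Psi>_def H_def)
    show "essential_values \<alpha> \<Phi> \<subseteq> essential_values \<alpha> \<Psi>"
      by (rule essential_values_coboundary[OF \<Phi> m eq[unfolded \<Psi>0_def]])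
    show "cohomologous \<alpha> \<Phi> \<Psi>"
      unfolding cohomologous_def
    proof (rule bexI[of _ "\<lambda>u. - (u *\<^sub>R w)"])
      show "AE u in torus. \<Phi> u - \<Psi> u = - (u *\<^sub>R w) - - (rot \<alpha> u *\<^sub>R w)"
        using eq by eventually_elim (simp add: \<Psi>0_def algebra_simps)
      show "(\<lambda>u. - (u *\<^sub>R w)) \<in> borel_measurable torus" using idm by measurable
    qed
  qed
qed

section \<open>Haar measure on a closed subgroup\<close>

text \<open>Otherwise arbitrarily small elements orthogonal to \<open>line_space H\<close> would
  produce a line of \<open>H\<close> orthogonal to all lines of \<open>H\<close>.\<close>

lemma closed_subgroup_discrete_normal:
  fixes H :: "'a::euclidean_space set"
  assumes H: "closed_subgroup H"
  shows "\<exists>\<rho>>0. \<forall>h\<in>H. (\<forall>v\<in>line_space H. h \<bullet> v = 0) \<longrightarrow> norm h < \<rho> \<longrightarrow> h = 0"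
proof (rule ccontr)
  \<comment> \<open>The orthogonal part is itself a closed subgroup, so the line found by
    \<open>closed_subgroup_line\<close> stays in it.\<close>
  define K where "K = H \<inter> {z. \<forall>v\<in>line_space H. z \<bullet> v = 0}"
  assume neg: "\<not> ?thesis"
  have "\<exists>h. h \<in> K \<and> norm h < inverse (real (Suc n)) \<and> h \<noteq> 0" for n
  proof -
    have "0 < inverse (real (Suc n))" by simp
    then show ?thesis using neg unfolding K_def by blast
  qed
  then obtain u where u: "\<And>n. u n \<in> K" "\<And>n. norm (u n) < inverse (real (Suc n))" "\<And>n. u n \<noteq> 0" by metis
  have u0: "u \<longlonglongrightarrow> 0"
    by (rule Lim_null_comparison[OF _ LIMSEQ_inverse_real_of_nat]) (use u(2) in \<open>simp add: less_imp_le del: of_nat_Suc\<close>)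
  have "closed {z. \<forall>v\<in>line_space H. z \<bullet> v = 0}"
    unfolding Collect_ball_eq by (intro closed_INT ballI closed_Collect_eq continuous_intros)
  then have "closed_subgroup K"
    using H unfolding closed_subgroup_def K_def by (auto simp: inner_add_left)
  then obtain d s where d: "norm d = 1" "\<And>r::real. r *\<^sub>R d \<in> K"
    using closed_subgroup_line[OF _ u(1) u(3) u0] by blast
  then have "d \<in> line_space H" by (simp add: line_space_def K_def)
  moreover have "\<forall>v\<in>line_space H. d \<bullet> v = 0" using d(2)[of 1] by (simp add: K_def)
  ultimately have "d \<bullet> d = 0" by blast
  then show False using d(1) by simp
qed

text \<open>A compact cross-section \<open>B\<close> turns Lebesgue measure on \<open>H + B\<close> into a Haar measure on \<open>H\<close>.\<close>

locale cross_section =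
  fixes H B :: "'a::euclidean_space set"
  assumes subgroup: "closed_subgroup H" and compact_B: "compact B"
    and unique: "\<And>h b h' b'. h \<in> H \<Longrightarrow> b \<in> B \<Longrightarrow> h' \<in> H \<Longrightarrow> b' \<in> B \<Longrightarrow> h + b = h' + b' \<Longrightarrow> h = h'"
    and thick: "\<exists>r>0. ball 0 r \<subseteq> {h + b | h b. h \<in> H \<and> b \<in> B}"

text \<open>Take the ball of radius \<open>\<rho>/3\<close> in the orthogonal complement of
  \<open>line_space H\<close>. Two of its points differ by at most
  \<open>2 \<rho>/3 < \<rho>\<close>, so discreteness gives uniqueness; adding
  \<open>line_space H\<close> covers a ball around 0.\<close>

lemma cross_section_exists:
  fixes H :: "'a::euclidean_space set"
  assumes H: "closed_subgroup H"
  obtains B where "cross_section H B"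
proof -
  obtain \<rho> where \<rho>: "0 < \<rho>" "\<And>h. h \<in> H \<Longrightarrow> (\<And>v. v \<in> line_space H \<Longrightarrow> h \<bullet> v = 0) \<Longrightarrow> norm h < \<rho> \<Longrightarrow> h = 0"
    using closed_subgroup_discrete_normal[OF H] by blast
  define B where "B = {z. \<forall>v\<in>line_space H. z \<bullet> v = 0} \<inter> cball 0 (\<rho>/3)"
  have "cross_section H B"
  proof
    have "closed {z. \<forall>v\<in>line_space H. z \<bullet> v = 0}"
      unfolding Collect_ball_eq by (intro closed_INT ballI closed_Collect_eq continuous_intros)
    then show "compact B" unfolding B_def by (intro closed_Int_compact compact_cball)
    show "h = h'" if hb: "h \<in> H" "b \<in> B" "h' \<in> H" "b' \<in> B" "h + b = h' + b'" for h b h' b'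
    proof -
      have eq: "h - h' = b' - b" using hb(5) by (simp add: algebra_simps)
      have "norm (b' - b) \<le> \<rho>/3 + \<rho>/3" using hb(2,4) norm_triangle_ineq4[of b' b] by (auto simp: B_def)
      then have "norm (h - h') < \<rho>" using \<rho>(1) by (simp add: eq)
      moreover have "(h - h') \<bullet> v = 0" if "v \<in> line_space H" for v
        using hb(2,4) that by (simp add: eq B_def inner_diff_left)
      ultimately have "h - h' = 0" using closed_subgroup_diff[OF H hb(1,3)] by (intro \<rho>(2)) auto
      then show ?thesis by simp
    qed
    have "x \<in> {h + b | h b. h \<in> H \<and> b \<in> B}" if x: "x \<in> ball 0 (\<rho>/3)" for x
    proof -
      obtain v z where vz: "x = v + z" "v \<in> line_space H" "\<And>w. w \<in> line_space H \<Longrightarrow> z \<bullet> w = 0" "norm z \<le> norm x"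
        using line_space_decomp[OF H] by metis
      then have "v \<in> H" "z \<in> B" using x line_space_subset[of H] by (auto simp: B_def)
      then show ?thesis using vz(1) by blast
    qed
    then show "\<exists>r>0. ball 0 r \<subseteq> {h + b | h b. h \<in> H \<and> b \<in> B}" using \<rho>(1) by (intro exI[of _ "\<rho>/3"]) auto
  qed (rule H)
  then show thesis by (rule that)
qed

context cross_section
begin

definition slab :: "'a set" where "slab = {h + b | h b. h \<in> H \<and> b \<in> B}"

text \<open>The component in \<open>H\<close> of a point of \<open>slab\<close>. The value 0
  elsewhere keeps the map \<open>H\<close>-valued and Borel on the whole space.\<close>

definition proj :: "'a \<Rightarrow> 'a" where "proj z = (if z \<in> slab then (THE h. h \<in> H \<and> z - h \<in> B) else 0)"

definition haar :: "'a measure" where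
  "haar = distr (restrict_space lborel slab) (restrict_space borel H) proj"

lemma closed_H: "closed H" using subgroup by (simp add: closed_subgroup_def)

lemma H_borel [measurable]: "H \<in> sets borel" using closed_H by simp

lemma proj_add: "h \<in> H \<Longrightarrow> b \<in> B \<Longrightarrow> proj (h + b) = h"
proof -
  assume hb: "h \<in> H" "b \<in> B"
  then have "(THE h'. h' \<in> H \<and> (h + b) - h' \<in> B) = h"
    by (intro the_equality) (use unique[OF hb] in \<open>fastforce+\<close>)
  moreover have "h + b \<in> slab" using hb by (auto simp: slab_def)
  ultimately show "proj (h + b) = h" by (simp add: proj_def)
qed

lemma slabE:
  assumes "z \<in> slab"
  obtains b where "z = proj z + b" "b \<in> B" "proj z \<in> H"
  using assms proj_add by (auto simp: slab_def)

lemma proj_in [simp]: "proj z \<in> H"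
proof (cases "z \<in> slab")
  case True
  then show ?thesis by (rule slabE)
next
  case False
  then show ?thesis by (simp add: proj_def closed_subgroup_zero[OF subgroup])
qed

lemma slab_translate: "z \<in> slab \<Longrightarrow> u \<in> H \<Longrightarrow> z + u \<in> slab \<and> proj (z + u) = proj z + u"
proof -
  assume z: "z \<in> slab" and u: "u \<in> H"
  obtain b where b: "z = proj z + b" "b \<in> B" "proj z \<in> H" using slabE[OF z] .
  have "z + u = (proj z + u) + b" using b(1) by (simp add: algebra_simps)
  moreover have "proj z + u \<in> H" using b(3) u by (rule closed_subgroup_add[OF subgroup])
  ultimately show ?thesis using b(2) proj_add[of "proj z + u" b] unfolding slab_def
    by (metis (mono_tags, lifting) mem_Collect_eq)
qed

lemma slab_translate_iff: "u \<in> H \<Longrightarrow> z + u \<in> slab \<longleftrightarrow> z \<in> slab"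
  using slab_translate[of z u] slab_translate[of "z + u" "- u"] closed_subgroup_uminus[OF subgroup, of u] by auto

lemma proj_vimage: "{z \<in> slab. proj z \<in> C} = {h + b | h b. h \<in> H \<inter> C \<and> b \<in> B}" (is "?L = ?R")
proof
  show "?L \<subseteq> ?R" by (auto elim!: slabE)
  show "?R \<subseteq> ?L" by (auto simp: proj_add) (auto simp: slab_def)
qed

text \<open>The sum of a closed and a compact set is closed; through this, compactness of
  \<open>B\<close> makes \<open>proj\<close> measurable.\<close>

lemma closed_proj_vimage: "closed C \<Longrightarrow> closed {z \<in> slab. proj z \<in> C}"
proof -
  assume "closed C"
  then have "closed (\<Union>x\<in>H \<inter> C. \<Union>y\<in>B. {x + y})"
    using closed_H compact_B by (intro closed_compact_sums) auto
  moreover have "(\<Union>x\<in>H \<inter> C. \<Union>y\<in>B. {x + y}) = {z \<in> slab. proj z \<in> C}" unfolding proj_vimage by blast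
  ultimately show ?thesis by simp
qed

lemma compact_proj_vimage: "compact C \<Longrightarrow> C \<subseteq> H \<Longrightarrow> compact {z \<in> slab. proj z \<in> C}"
proof -
  assume C: "compact C" "C \<subseteq> H"
  then have "compact {x + y | x y. x \<in> C \<and> y \<in> B}" using compact_B by (intro compact_sums)
  moreover have "{x + y | x y. x \<in> C \<and> y \<in> B} = {z \<in> slab. proj z \<in> C}" unfolding proj_vimage using C(2) by blast
  ultimately show ?thesis by simp
qed

lemma slab_borel [measurable]: "slab \<in> sets borel"
  using closed_proj_vimage[of UNIV] by simp

lemma proj_borel: "proj \<in> borel_measurable borel"
proof (rule borel_measurableI)
  fix S :: "'a set" assume "open S"
  then have 1: "{z \<in> slab. proj z \<in> - S} \<in> sets borel" using closed_proj_vimage[of "- S"] by (simp add: closed_Compl)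
  have "proj -` S \<inter> space borel = (slab - {z \<in> slab. proj z \<in> - S}) \<union> (if 0 \<in> S then - slab else {})"
    by (auto simp: proj_def split: if_splits)
  then show "proj -` S \<inter> space borel \<in> sets borel" using 1 by auto
qed

lemma proj_measurable [measurable]: "proj \<in> measurable borel (restrict_space borel H)"
  by (intro measurable_restrict_space2 proj_borel) auto

lemma sets_haar [measurable_cong]: "sets haar = sets (restrict_space borel H)"
  by (simp add: haar_def)

lemma space_haar [simp]: "space haar = H"
  by (simp add: haar_def space_restrict_space)

lemma sets_haar_iff: "A \<in> sets haar \<longleftrightarrow> A \<in> sets borel \<and> A \<subseteq> H"
  unfolding sets_haar by (subst sets_restrict_space_iff) auto

lemma emeasure_haar:
  assumes "A \<in> sets haar"
  shows "emeasure haar A = emeasure lborel {z \<in> slab. proj z \<in> A}"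
proof -
  have pm: "proj \<in> measurable (restrict_space lborel slab) (restrict_space borel H)"
    by (rule measurable_restrict_space1) simp
  have "emeasure haar A = emeasure (restrict_space lborel slab) (proj -` A \<inter> space (restrict_space lborel slab))"
    unfolding haar_def using assms by (intro emeasure_distr pm) (simp add: sets_haar)
  also have "proj -` A \<inter> space (restrict_space lborel slab) = {z \<in> slab. proj z \<in> A}"
    by (auto simp: space_restrict_space)
  also have "emeasure (restrict_space lborel slab) {z \<in> slab. proj z \<in> A} = emeasure lborel {z \<in> slab. proj z \<in> A}"
    by (rule emeasure_restrict_space) auto
  finally show ?thesis .
qed

text \<open>Translation by an element of \<open>H\<close> preserves \<open>slab\<close> and commutes
  with \<open>proj\<close>, so invariance is inherited from Lebesgue measure.\<close>

lemma haar_translate: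
  assumes A: "A \<in> sets haar" and g: "g \<in> H"
  shows "emeasure haar {y \<in> H. y + g \<in> A} = emeasure haar A" and "{y \<in> H. y + g \<in> A} \<in> sets haar"
proof -
  have [measurable]: "A \<in> sets borel" using A by (simp add: sets_haar_iff)
  have "{y \<in> H. y + g \<in> A} \<in> sets borel" by measurable
  then show m: "{y \<in> H. y + g \<in> A} \<in> sets haar" by (simp add: sets_haar_iff)
  have [measurable]: "{z \<in> slab. proj z \<in> A} \<in> sets borel"
  proof -
    have "{z \<in> slab. proj z \<in> A} = slab \<inter> (proj -` A \<inter> space borel)" by auto
    then show ?thesis using measurable_sets[OF proj_borel \<open>A \<in> sets borel\<close>] by auto
  qed
  have "emeasure haar {y \<in> H. y + g \<in> A} = emeasure lborel {z \<in> slab. proj z \<in> {y \<in> H. y + g \<in> A}}"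
    by (rule emeasure_haar[OF m])
  also have "{z \<in> slab. proj z \<in> {y \<in> H. y + g \<in> A}} = {z. z + g \<in> {z \<in> slab. proj z \<in> A}}"
    using slab_translate[OF _ g] slab_translate_iff[OF g] by auto
  also have "emeasure lborel \<dots> = emeasure lborel {z \<in> slab. proj z \<in> A}"
    by (rule emeasure_lborel_translate) simp
  finally show "emeasure haar {y \<in> H. y + g \<in> A} = emeasure haar A" by (simp add: emeasure_haar[OF A])
qed

lemma haar_compact_finite:
  assumes "compact K" "K \<subseteq> H"
  shows "emeasure haar K < \<infinity>"
proof -
  have "K \<in> sets haar" using assms by (simp add: sets_haar_iff compact_imp_closed)
  then show ?thesis
    using emeasure_compact_finite[OF compact_proj_vimage[OF assms]] emeasure_haar by simp
qed

lemma haar_measure_on_haar: "haar_measure_on H haar"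
  unfolding haar_measure_on_def
proof (intro conjI ballI allI impI)
  obtain r where r: "r > 0" "ball 0 r \<subseteq> slab" using thick by (auto simp: slab_def)
  have HH: "H \<in> sets haar" by (simp add: sets_haar_iff)
  \<comment> \<open>By \<open>thick\<close> the slab contains a ball, whose Lebesgue measure bounds
    that of \<open>H\<close> from below.\<close>
  have "0 < emeasure lborel (ball (0::'a) r)"
    using content_ball_pos[OF r(1), of "0 :: 'a"] by (simp add: measure_def enn2real_positive_iff)
  also have "\<dots> \<le> emeasure lborel {z \<in> slab. proj z \<in> H}"
    using r(2) by (intro emeasure_mono) auto
  finally show "emeasure haar H \<noteq> 0" using emeasure_haar[OF HH] by auto
next
  fix h A assume h: "h \<in> H" and A: "A \<in> sets haar"
  have "(\<lambda>y. h + y) ` A = {y \<in> H. y + (- h) \<in> A}"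
  proof (intro equalityI subsetI)
    fix y assume "y \<in> (\<lambda>y. h + y) ` A"
    then show "y \<in> {y \<in> H. y + (- h) \<in> A}"
      using A h closed_subgroup_add[OF subgroup h] by (auto simp: sets_haar_iff)
  next
    fix y assume "y \<in> {y \<in> H. y + (- h) \<in> A}"
    then show "y \<in> (\<lambda>y. h + y) ` A" by (intro image_eqI[of _ _ "y + (- h)"]) auto
  qed
  then show "emeasure haar ((\<lambda>y. h + y) ` A) = emeasure haar A"
    using haar_translate(1)[OF A closed_subgroup_uminus[OF subgroup h]] by simp
qed (use haar_compact_finite in \<open>simp_all add: sets_haar\<close>)

lemma sigma_finite_haar: "sigma_finite_measure haar"
proof
  define D where "D n = H \<inter> cball 0 (real n)" for n :: nat
  have D: "compact (D n)" "D n \<subseteq> H" for n unfolding D_def using closed_H by (auto intro: closed_Int_compact)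
  have "H \<subseteq> (\<Union>n. D n)"
  proof
    fix y assume "y \<in> H"
    moreover obtain n where "norm y \<le> real n" using real_arch_simple by blast
    ultimately show "y \<in> (\<Union>n. D n)" by (auto simp: D_def)
  qed
  then have "(\<Union>n. D n) = H" using D(2) by blast
  moreover have "D n \<in> sets haar" for n using D by (simp add: sets_haar_iff compact_imp_closed)
  ultimately show "\<exists>A. countable A \<and> A \<subseteq> sets haar \<and> \<Union> A = space haar \<and> (\<forall>a\<in>A. emeasure haar a \<noteq> \<infinity>)"
    using haar_compact_finite[OF D] by (intro exI[of _ "range D"]) (auto simp: less_top[symmetric])
qed

end

text \<open>Finite unions from a countable base. Countability matters: it allows one test set
  \<open>E\<close> to be shared by the fibres over a set of base points of positive measure.\<close>

lemma countable_dense_approximation: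
  obtains \<E> :: "'a::euclidean_space set set" where "countable \<E>" "\<And>E. E \<in> \<E> \<Longrightarrow> open E"
    "\<And>W e. W \<in> sets borel \<Longrightarrow> 0 < emeasure lborel W \<Longrightarrow> 0 < (e::real) \<Longrightarrow>
       \<exists>E\<in>\<E>. 0 < emeasure lborel E \<and> emeasure lborel E < \<infinity> \<and> emeasure lborel (E - W) < ennreal e * emeasure lborel E"
proof -
  obtain \<B> :: "'a set set" where B: "countable \<B>" "\<And>C. C \<in> \<B> \<Longrightarrow> open C" "\<And>S. open S \<Longrightarrow> \<exists>U. U \<subseteq> \<B> \<and> S = \<Union>U"
    using univ_second_countable by blast
  define \<E> where "\<E> = {\<Union>F | F. finite F \<and> F \<subseteq> \<B>}"
  have "\<E> = Union ` {F. finite F \<and> F \<subseteq> \<B>}" by (auto simp: \<E>_def)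
  moreover have "countable {F. finite F \<and> F \<subseteq> \<B>}" using countable_Collect_finite_subset[OF B(1)] by (simp add: conj_commute)
  ultimately have cE: "countable \<E>" by simp
  have oE: "open E" if "E \<in> \<E>" for E using that B(2) by (auto simp: \<E>_def intro!: open_Union)
  have main: "\<exists>E\<in>\<E>. 0 < emeasure lborel E \<and> emeasure lborel E < \<infinity> \<and> emeasure lborel (E - W) < ennreal e * emeasure lborel E"
    if W[measurable]: "W \<in> sets borel" "0 < emeasure lborel W" and e: "0 < (e::real)" for W e
  proof -
    have "(\<lambda>n. emeasure lborel (W \<inter> cball 0 (real n))) \<longlonglongrightarrow> emeasure lborel (\<Union>n. W \<inter> cball 0 (real n))"
      by (rule Lim_emeasure_incseq) (auto simp: incseq_def)
    also have "(\<Union>n. W \<inter> cball 0 (real n)) = W" using real_arch_simple by auto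
    finally have "\<forall>\<^sub>F n in sequentially. 0 < emeasure lborel (W \<inter> cball 0 (real n))"
      using W(2) by (rule order_tendstoD)
    then obtain n where n: "0 < emeasure lborel (W \<inter> cball 0 (real n))" by (auto simp: eventually_sequentially)
    define W' where "W' = W \<inter> cball 0 (real n)"
    have [measurable]: "W' \<in> sets borel" by (simp add: W'_def)
    have "emeasure lborel W' \<le> emeasure lborel (cball (0::'a) (real n))" unfolding W'_def by (intro emeasure_mono) auto
    then have "emeasure lborel W' < \<infinity>" using emeasure_compact_finite[of "cball (0::'a) (real n)"] by (simp add: order.strict_trans1)
    then obtain m where m: "emeasure lborel W' = ennreal m" "m \<ge> 0" by (cases "emeasure lborel W'") auto
    have m0: "m > 0" using n m unfolding W'_def[symmetric] by simp
    \<comment> \<open>The slack \<open>e * m\<close> is relative to the measure \<open>m\<close> of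
      \<open>W'\<close>: the excess of \<open>U\<close> is a fraction below \<open>e\<close> of that
      measure.\<close>
    obtain U where U: "open U" "W' \<subseteq> U" "emeasure lborel (U - W') < ennreal (e * m)"
      using outer_regular_lborel[of W' "e * m"] e m0 by auto
    have [measurable]: "U \<in> sets borel" using U by simp
    obtain C where C: "C \<subseteq> \<B>" "U = \<Union>C" using B(3)[OF U(1)] by blast
    have "W' \<noteq> {}" using m m0 by (auto simp: ennreal_eq_0_iff)
    then have Cne: "C \<noteq> {}" using U(2) C(2) by auto
    have Cc: "countable C" using C(1) B(1) countable_subset by blast
    define E where "E k = (\<Union>i\<le>k. from_nat_into C i)" for k :: nat
    have EE: "E k \<in> \<E>" for k
    proof -
      have "E k = \<Union>(from_nat_into C ` {..k})" by (simp add: E_def)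
      moreover have "from_nat_into C ` {..k} \<subseteq> \<B>" using from_nat_into[OF Cne] C(1) by blast
      ultimately show ?thesis unfolding \<E>_def by blast
    qed
    have [measurable]: "E k \<in> sets borel" for k using oE[OF EE] by simp
    have EU: "(\<Union>k. E k) = U"
    proof -
      have "(\<Union>k. E k) = \<Union>(range (from_nat_into C))" by (auto simp: E_def)
      then show ?thesis using range_from_nat_into[OF Cne Cc] C(2) by simp
    qed
    have "(\<lambda>k. emeasure lborel (E k)) \<longlonglongrightarrow> emeasure lborel (\<Union>k. E k)"
    proof (rule Lim_emeasure_incseq)
      show "range E \<subseteq> sets lborel" by auto
      show "incseq E" unfolding incseq_def E_def by (intro allI impI UN_mono) auto
    qed
    moreover obtain t where t: "emeasure lborel (U - W') = ennreal t" "0 \<le> t" "t < e * m"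
      using U(3) by (cases "emeasure lborel (U - W')") (auto simp: ennreal_less_iff)
    \<comment> \<open>The excess \<open>t\<close> satisfies \<open>t / e < m\<close>, so the finite
      unions \<open>E k\<close> increasing to \<open>U\<close> eventually exceed
      \<open>t / e\<close>; then \<open>t\<close> is less than \<open>e\<close> times the measure of
      \<open>E k\<close>.\<close>
    moreover have "ennreal (t / e) < emeasure lborel (\<Union>k. E k)"
    proof -
      have "ennreal (t / e) < ennreal m" using t e by (intro ennreal_lessI) (auto simp: field_simps m0)
      also have "\<dots> \<le> emeasure lborel U" unfolding m(1)[symmetric] using U(2) by (intro emeasure_mono) auto
      finally show ?thesis by (simp add: EU)
    qed
    ultimately have "\<forall>\<^sub>F k in sequentially. ennreal (t / e) < emeasure lborel (E k)"
      by (intro order_tendstoD)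
    then obtain k where k: "ennreal (t / e) < emeasure lborel (E k)"
      by (auto simp: eventually_sequentially)
    have "emeasure lborel (E k - W) \<le> emeasure lborel (U - W')"
      using EU by (intro emeasure_mono) (auto simp: W'_def)
    also have "emeasure lborel (U - W') = ennreal e * ennreal (t / e)"
      using e t by (simp flip: ennreal_mult'')
    also have "\<dots> < ennreal e * emeasure lborel (E k)"
      using k e by (intro ennreal_mult_strict_left_mono) auto
    finally have 1: "emeasure lborel (E k - W) < ennreal e * emeasure lborel (E k)" .
    have 2: "0 < emeasure lborel (E k)" using k by (rule le_less_trans[OF zero_le])
    have "emeasure lborel (E k) \<le> emeasure lborel U" using EU by (intro emeasure_mono) auto
    also have "\<dots> \<le> emeasure lborel W' + emeasure lborel (U - W')"
      using U(2) by (subst plus_emeasure) (auto simp: Un_absorb1)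
    also have "\<dots> < \<infinity>" using m U(3) by (simp add: less_top[symmetric]) (metis ennreal_less_top less_trans not_less_iff_gr_or_eq top.not_eq_extremum)
    finally show ?thesis using EE 1 2 by blast
  qed
  show thesis by (rule that[OF cE oE main])
qed

section \<open>Ergodicity of the skew product\<close>

text \<open>The situation after the reduction: a cocycle with values in \<open>H\<close> that has
  all of \<open>H\<close> among its essential values.\<close>

locale ergodic_extension = cross_section H B for H B :: "'a::euclidean_space set" +
  fixes \<alpha> :: real and \<Psi> :: "real \<Rightarrow> 'a"
  assumes irr: "\<alpha> \<notin> \<rat>" and \<Psi>_meas [measurable]: "\<Psi> \<in> borel_measurable torus" and \<Psi>_in: "\<And>x. \<Psi> x \<in> H"
    and ess: "H \<subseteq> essential_values \<alpha> \<Psi>"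
begin

abbreviation "M \<equiv> torus \<Otimes>\<^sub>M haar"

lemma space_M: "space M = {0..<1} \<times> H"
  by (simp add: space_pair_measure)

lemma id_haar_borel: "(\<lambda>h. h) \<in> borel_measurable haar"
  unfolding measurable_cong_sets[OF sets_haar refl] by (rule measurable_restrict_space1) simp

lemma measurable_haarI:
  assumes "f \<in> borel_measurable N" "\<And>x. x \<in> space N \<Longrightarrow> f x \<in> H"
  shows "f \<in> measurable N haar"
  unfolding measurable_cong_sets[OF refl sets_haar] using assms by (intro measurable_restrict_space2) auto

lemma skew_measurable: "skew_product \<alpha> \<Psi> \<in> measurable M M"
proof -
  have "(\<lambda>p. rot \<alpha> (fst p)) \<in> measurable M torus"
    by (rule measurable_compose[OF measurable_fst measurable_rot])
  moreover have "(\<lambda>p. snd p + \<Psi> (fst p)) \<in> measurable M haar"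
  proof (rule measurable_haarI)
    show "(\<lambda>p. snd p + \<Psi> (fst p)) \<in> borel_measurable M"
      by (intro borel_measurable_add measurable_compose[OF measurable_snd id_haar_borel]
          measurable_compose[OF measurable_fst \<Psi>_meas])
  qed (auto simp: space_M intro!: closed_subgroup_add[OF subgroup] \<Psi>_in)
  ultimately show ?thesis unfolding skew_product_def case_prod_unfold by (rule measurable_Pair)
qed

lemma translate_measurable:
  assumes h: "h \<in> H"
  shows "(\<lambda>p. (fst p, snd p + h)) \<in> measurable M M"
proof -
  have "(\<lambda>p. snd p + h) \<in> measurable M haar"
  proof (rule measurable_haarI)
    show "(\<lambda>p. snd p + h) \<in> borel_measurable M"
      by (intro borel_measurable_add measurable_compose[OF measurable_snd id_haar_borel]) simp
  qed (auto simp: space_M intro!: closed_subgroup_add[OF subgroup] h)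
  then show ?thesis by (intro measurable_Pair measurable_fst)
qed

lemma sets_section: "X \<in> sets M \<Longrightarrow> Pair x -` X \<in> sets haar"
  by (rule sets_Pair1)

lemma section_skew:
  assumes X: "X \<in> sets M" and x: "x \<in> {0..<1}"
  shows "emeasure haar (Pair x -` (skew_product \<alpha> \<Psi> -` X \<inter> space M)) = emeasure haar (Pair (rot \<alpha> x) -` X)"
proof -
  have "Pair x -` (skew_product \<alpha> \<Psi> -` X \<inter> space M) = {y \<in> H. y + \<Psi> x \<in> Pair (rot \<alpha> x) -` X}"
    using x by (auto simp: skew_product_def space_M)
  then show ?thesis using haar_translate(1)[OF sets_section[OF X] \<Psi>_in] by simp
qed

lemma measurable_section: "X \<in> sets M \<Longrightarrow> (\<lambda>x. emeasure haar (Pair x -` X)) \<in> borel_measurable torus"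
  by (rule sigma_finite_measure.measurable_emeasure_Pair[OF sigma_finite_haar])

lemma emeasure_M: "X \<in> sets M \<Longrightarrow> emeasure M X = (\<integral>\<^sup>+x. emeasure haar (Pair x -` X) \<partial>torus)"
  by (rule sigma_finite_measure.emeasure_pair_measure_alt[OF sigma_finite_haar])

text \<open>The base is rotated and each fibre is translated by an element of \<open>H\<close>; both
  operations preserve measure.\<close>

lemma skew_measure_preserving: "distr M M (skew_product \<alpha> \<Psi>) = M"
proof (rule measure_eqI)
  fix X assume "X \<in> sets (distr M M (skew_product \<alpha> \<Psi>))"
  then have X: "X \<in> sets M" by simp
  have "emeasure (distr M M (skew_product \<alpha> \<Psi>)) X = emeasure M (skew_product \<alpha> \<Psi> -` X \<inter> space M)"
    using X by (rule emeasure_distr[OF skew_measurable])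
  also have "\<dots> = (\<integral>\<^sup>+x. emeasure haar (Pair x -` (skew_product \<alpha> \<Psi> -` X \<inter> space M)) \<partial>torus)"
    by (rule emeasure_M[OF measurable_sets[OF skew_measurable X]])
  also have "\<dots> = (\<integral>\<^sup>+x. emeasure haar (Pair (rot \<alpha> x) -` X) \<partial>torus)"
    by (rule nn_integral_cong) (simp only: space_torus section_skew[OF X])
  also have "\<dots> = (\<integral>\<^sup>+x. emeasure haar (Pair x -` X) \<partial>distr torus torus (rot \<alpha>))"
    by (subst nn_integral_distr[OF measurable_rot]) (simp_all add: measurable_section[OF X])
  also have "\<dots> = emeasure M X" by (simp add: distr_rot emeasure_M[OF X])
  finally show "emeasure (distr M M (skew_product \<alpha> \<Psi>)) X = emeasure M X" .
qed simp

lemma cocycle_sum_in: "cocycle_sum \<alpha> \<Psi> N x \<in> H"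
  using cocycle_sum_mod_subgroup[OF subgroup, of \<Psi> \<alpha> x 0 N] \<Psi>_in by simp

text \<open>Strict invariance is an equivalence at every step, so negative \<open>N\<close>, which
  essential values permit, are covered too.\<close>

lemma invariant_iterate:
  assumes inv: "skew_product \<alpha> \<Psi> -` A \<inter> space M = A" and x: "x \<in> {0..<1}" and y: "y \<in> H"
  shows "(rot (of_int N * \<alpha>) x, y + cocycle_sum \<alpha> \<Psi> N x) \<in> A \<longleftrightarrow> (x, y) \<in> A"
proof -
  have step: "(rot (of_int (N + 1) * \<alpha>) x, y + cocycle_sum \<alpha> \<Psi> (N + 1) x) \<in> A
      \<longleftrightarrow> (rot (of_int N * \<alpha>) x, y + cocycle_sum \<alpha> \<Psi> N x) \<in> A" for N :: int
  proof -
    have "(rot (of_int N * \<alpha>) x, y + cocycle_sum \<alpha> \<Psi> N x) \<in> space M"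
      by (auto simp: space_M intro!: closed_subgroup_add[OF subgroup] y cocycle_sum_in)
    moreover have "skew_product \<alpha> \<Psi> (rot (of_int N * \<alpha>) x, y + cocycle_sum \<alpha> \<Psi> N x)
        = (rot (of_int (N + 1) * \<alpha>) x, y + cocycle_sum \<alpha> \<Psi> (N + 1) x)"
      unfolding cocycle_sum_Suc skew_product_def by (simp add: rot_rot algebra_simps)
    moreover have "p \<in> A \<longleftrightarrow> skew_product \<alpha> \<Psi> p \<in> A" if "p \<in> space M" for p
      using inv that by blast
    ultimately show ?thesis by (simp only:)
  qed
  show ?thesis
  proof (induction N rule: int_induct[where k = 0])
    case base
    then show ?case using x by simp
  next
    case (step1 i)
    then show ?case using step[of i] by simp
  next
    case (step2 i)
    then show ?case using step[of "i - 1"] by simp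
  qed
qed

text \<open>If an invariant set were not invariant under the translation by \<open>h\<close>, its sections would look alike
  on some \<open>E\<close> for all \<open>x\<close> in a set of positive measure; a return to that set with \<open>\<Psi>\<^sub>N \<approx> h\<close>
  contradicts this, since small translations move \<open>E\<close> only a little.\<close>

lemma invariant_translate:
  assumes A: "A \<in> sets M" and inv: "skew_product \<alpha> \<Psi> -` A \<inter> space M = A" and h: "h \<in> H"
  shows "AE p in M. \<not> (p \<in> A \<and> (fst p, snd p + h) \<notin> A)"
proof (rule ccontr)
  assume notAE: "\<not> ?thesis"
  define Z where "Z = A - ((\<lambda>p. (fst p, snd p + h)) -` A \<inter> space M)"
  have Z: "Z \<in> sets M" unfolding Z_def using A measurable_sets[OF translate_measurable[OF h] A] by auto
  have Zin: "(x, y) \<in> A" "(x, y + h) \<notin> A" "y \<in> H" if "(x, y) \<in> Z" for x y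
    using that sets.sets_into_space[OF A] unfolding space_M by (auto simp: Z_def space_M)
  \<comment> \<open>The sections of \<open>Z\<close> are moved to the ambient space, where they have
    the same measure and can be tested against open sets.\<close>
  define Zs where "Zs x = {z \<in> slab. proj z \<in> Pair x -` Z}" for x
  have Zs_borel: "Zs x \<in> sets borel" for x
  proof -
    have "Pair x -` Z \<in> sets borel" using sets_section[OF Z, of x] by (simp add: sets_haar_iff)
    then have "proj -` (Pair x -` Z) \<inter> space borel \<in> sets borel" by (rule measurable_sets[OF proj_borel])
    moreover have "Zs x = slab \<inter> (proj -` (Pair x -` Z) \<inter> space borel)" by (auto simp: Zs_def)
    ultimately show ?thesis by auto
  qed
  have Zs_measure: "emeasure lborel (Zs x) = emeasure haar (Pair x -` Z)" for x
    unfolding Zs_def by (rule emeasure_haar[OF sets_section[OF Z], symmetric])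
  obtain \<E> :: "'a set set" where \<E>: "countable \<E>" "\<And>E. E \<in> \<E> \<Longrightarrow> open E"
    "\<And>W e. W \<in> sets borel \<Longrightarrow> 0 < emeasure lborel W \<Longrightarrow> 0 < (e::real) \<Longrightarrow>
       \<exists>E\<in>\<E>. 0 < emeasure lborel E \<and> emeasure lborel E < \<infinity> \<and> emeasure lborel (E - W) < ennreal e * emeasure lborel E"
    using countable_dense_approximation by blast
  \<comment> \<open>The set with sections \<open>E - Zs x\<close>, written so that joint
    measurability is evident.\<close>
  define Y where "Y E = {0..<1} \<times> E - ({0..<1} \<times> slab \<inter> ((\<lambda>p. (fst p, proj (snd p))) -` Z \<inter> space (torus \<Otimes>\<^sub>M lborel)))" for E
  have Y: "Y E \<in> sets (torus \<Otimes>\<^sub>M lborel)" if "E \<in> \<E>" for E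
  proof -
    have "(\<lambda>p. proj (snd p)) \<in> measurable (torus \<Otimes>\<^sub>M lborel) haar"
      by (intro measurable_haarI measurable_compose[OF measurable_snd]) (simp_all add: proj_borel)
    then have "(\<lambda>p. (fst p, proj (snd p))) \<in> measurable (torus \<Otimes>\<^sub>M lborel) M"
      by (intro measurable_Pair measurable_fst)
    then have 1: "(\<lambda>p. (fst p, proj (snd p))) -` Z \<inter> space (torus \<Otimes>\<^sub>M lborel) \<in> sets (torus \<Otimes>\<^sub>M lborel)"
      using Z by (rule measurable_sets)
    have "E \<in> sets lborel" "slab \<in> sets lborel" using \<E>(2)[OF that] by simp_all
    then have "{0..<1} \<times> E \<in> sets (torus \<Otimes>\<^sub>M lborel)" "{0..<1} \<times> slab \<in> sets (torus \<Otimes>\<^sub>M lborel)"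
      by (auto intro!: pair_measureI)
    then show ?thesis unfolding Y_def by (intro sets.Diff sets.Int[OF _ 1])
  qed
  have Y_section: "Pair x -` Y E = E - Zs x" if "x \<in> {0..<1}" for x E
    using that by (auto simp: Y_def Zs_def space_pair_measure)
  \<comment> \<open>The base points whose section misses less than a quarter of \<open>E\<close>. If
    all \<open>G E\<close> were null, countability would make almost every section of
    \<open>Z\<close> null.\<close>
  define G where "G E = {x \<in> space torus. emeasure lborel (Pair x -` Y E) < ennreal (1/4) * emeasure lborel E}" for E
  have G: "G E \<in> sets torus" if "E \<in> \<E>" for E
    unfolding G_def using sigma_finite_measure.measurable_emeasure_Pair[OF sigma_finite_lborel Y[OF that]] by measurable
  have "\<exists>E\<in>\<E>. 0 < emeasure lborel E \<and> emeasure lborel E < \<infinity> \<and> 0 < measure torus (G E)"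
  proof (rule ccontr)
    assume neg: "\<not> ?thesis"
    define \<E>' where "\<E>' = {E \<in> \<E>. 0 < emeasure lborel E \<and> emeasure lborel E < \<infinity>}"
    have "(\<Union>E\<in>\<E>'. G E) \<in> null_sets torus"
    proof (rule null_sets_UN')
      show "countable \<E>'" using \<E>(1) by (rule countable_subset[rotated]) (auto simp: \<E>'_def)
      fix E assume E: "E \<in> \<E>'"
      then have "measure torus (G E) = 0" using neg by (auto simp: \<E>'_def zero_less_measure_iff)
      then show "G E \<in> null_sets torus" using G E by (intro null_setsI) (auto simp: torus.emeasure_eq_measure \<E>'_def)
    qed
    then have "AE x in torus. x \<notin> (\<Union>E\<in>\<E>'. G E)" by (rule AE_not_in)
    then have "AE x in torus. emeasure haar (Pair x -` Z) = 0"
      using AE_space[of torus]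
    proof eventually_elim
      fix x assume x: "x \<notin> (\<Union>E\<in>\<E>'. G E)" "x \<in> space torus"
      show "emeasure haar (Pair x -` Z) = 0"
      proof (rule ccontr)
        assume "emeasure haar (Pair x -` Z) \<noteq> 0"
        then have "0 < emeasure lborel (Zs x)" by (simp add: Zs_measure zero_less_iff_neq_zero)
        then obtain E where E: "E \<in> \<E>" "0 < emeasure lborel E" "emeasure lborel E < \<infinity>"
          "emeasure lborel (E - Zs x) < ennreal (1/4) * emeasure lborel E"
          using \<E>(3)[OF Zs_borel, of x "1/4"] by auto
        then have "x \<in> G E" using x(2) by (simp add: G_def Y_section)
        then show False using x(1) E by (auto simp: \<E>'_def)
      qed
    qed
    then have "emeasure M Z = 0"
      unfolding emeasure_M[OF Z] by (subst nn_integral_0_iff_AE[OF measurable_section[OF Z]]) 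
    then have "AE p in M. p \<notin> Z" using Z by (intro AE_not_in null_setsI)
    then have "AE p in M. \<not> (p \<in> A \<and> (fst p, snd p + h) \<notin> A)"
      by eventually_elim (auto simp: Z_def)
    then show False using notAE by simp
  qed
  then obtain E where E: "E \<in> \<E>" "0 < emeasure lborel E" "emeasure lborel E < \<infinity>" "0 < measure torus (G E)" by blast
  obtain m where m: "emeasure lborel E = ennreal m" "0 < m" using E(2,3) by (cases "emeasure lborel E") auto
  have [measurable]: "E \<in> sets borel" using \<E>(2)[OF E(1)] by simp
  obtain \<delta> where d: "\<delta> > 0" "\<And>u. norm u < \<delta> \<Longrightarrow> emeasure lborel {z \<in> E. z + u \<notin> E} < ennreal (m / 4)"
    using small_translation_open[OF \<E>(2)[OF E(1)] E(3), of "m/4"] m(2) by auto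
  have "h \<in> essential_values \<alpha> \<Psi>" using ess h by blast
  then obtain N where N: "0 < measure torus (return_set \<alpha> \<Psi> (G E) N (ball h \<delta>))"
    by (rule essential_valuesD[OF _ open_ball[of h \<delta>] _ G[OF E(1)] E(4)]) (use d(1) in auto)
  then have "return_set \<alpha> \<Psi> (G E) N (ball h \<delta>) \<noteq> {}" by auto
  then obtain x where x: "x \<in> G E" "rot (of_int N * \<alpha>) x \<in> G E" "cocycle_sum \<alpha> \<Psi> N x \<in> ball h \<delta>"
    by (auto simp: return_set_def)
  define x' u where "x' = rot (of_int N * \<alpha>) x" and "u = cocycle_sum \<alpha> \<Psi> N x - h"
  have u: "norm u < \<delta>" "u \<in> H"
    using x(3) closed_subgroup_diff[OF subgroup cocycle_sum_in h] by (auto simp: u_def dist_norm norm_minus_commute)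
  have small: "emeasure lborel (E - Zs x) < ennreal (m / 4)" "emeasure lborel (E - Zs x') < ennreal (m / 4)"
    using x(1,2) m by (auto simp: G_def Y_section x'_def simp flip: ennreal_mult'')
  \<comment> \<open>A point outside all three sets has \<open>z\<close> in \<open>Zs x\<close> and
    \<open>z + u\<close> in \<open>Zs x'\<close>. Invariance puts
    \<open>(x', proj z + u + h)\<close> into \<open>A\<close>, while membership in \<open>Z\<close>
    excludes it. Each of the three sets is smaller than \<open>m / 4\<close>, too little to cover
    \<open>E\<close>.\<close>
  have "E \<subseteq> (E - Zs x) \<union> {z \<in> E. z + u \<notin> E} \<union> {z. z + u \<in> E - Zs x'}"
  proof
    fix z assume z: "z \<in> E"
    show "z \<in> (E - Zs x) \<union> {z \<in> E. z + u \<notin> E} \<union> {z. z + u \<in> E - Zs x'}"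
    proof (rule ccontr)
      assume "\<not> ?thesis"
      then have zz: "z \<in> Zs x" "z + u \<in> Zs x'" using z by auto
      have slab: "z \<in> slab" "(x, proj z) \<in> Z" "(x', proj (z + u)) \<in> Z" using zz by (auto simp: Zs_def)
      have "proj (z + u) = proj z + u" using slab_translate[OF slab(1) u(2)] by simp
      then have "(x', proj z + u + h) \<notin> A" using Zin(2)[OF slab(3)] by simp
      moreover have "(x', proj z + cocycle_sum \<alpha> \<Psi> N x) \<in> A"
        using invariant_iterate[OF inv, of x "proj z" N] x(1) Zin(1)[OF slab(2)] by (simp add: x'_def G_def)
      ultimately show False by (simp add: u_def algebra_simps)
    qed
  qed
  note [measurable] = Zs_borel
  have tm: "{z. z + u \<in> E - Zs x'} \<in> sets borel"
    using Zs_borel[of x'] by measurable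
  have "ennreal m \<le> emeasure lborel ((E - Zs x) \<union> {z \<in> E. z + u \<notin> E} \<union> {z. z + u \<in> E - Zs x'})"
    unfolding m(1)[symmetric] by (rule emeasure_mono[OF \<open>E \<subseteq> _\<close>]) (use tm in measurable)
  also have "\<dots> \<le> emeasure lborel ((E - Zs x) \<union> {z \<in> E. z + u \<notin> E}) + emeasure lborel {z. z + u \<in> E - Zs x'}"
    using tm by (intro emeasure_subadditive) auto
  also have "\<dots> \<le> (emeasure lborel (E - Zs x) + emeasure lborel {z \<in> E. z + u \<notin> E}) + emeasure lborel (E - Zs x')"
    using emeasure_lborel_translate[of "E - Zs x'" u] by (intro add_mono emeasure_subadditive) auto
  also have "\<dots> \<le> (ennreal (m / 4) + ennreal (m / 4)) + ennreal (m / 4)"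
    by (intro add_mono less_imp_le[OF small(1)] less_imp_le[OF small(2)] less_imp_le[OF d(2)[OF u(1)]])
  also have "\<dots> = ennreal (3 * m / 4)" using m(2) by (simp flip: ennreal_plus)
  finally show False using m(2) by (simp add: ennreal_le_iff)
qed

text \<open>Fubini exchanges "every \<open>h\<close>, almost every point" for "almost every point,
  almost every \<open>h\<close>". One \<open>y\<close> in the section with \<open>y + h\<close> in
  it for almost all \<open>h\<close> makes the section conull by translation invariance; if there is
  no such \<open>y\<close>, the section is null.\<close>

lemma sections_trivial:
  assumes A: "A \<in> sets M" and inv: "skew_product \<alpha> \<Psi> -` A \<inter> space M = A"
  shows "AE x in torus. emeasure haar (Pair x -` A) = 0 \<or> emeasure haar (H - Pair x -` A) = 0"
proof -
  interpret haar: sigma_finite_measure haar by (rule sigma_finite_haar)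
  interpret P: pair_sigma_finite torus haar ..
  interpret MM: sigma_finite_measure M by (rule P.P.sigma_finite_measure_axioms)
  interpret Q: pair_sigma_finite M haar ..
  have add_haar: "(\<lambda>q. snd (fst q) + snd q) \<in> measurable (M \<Otimes>\<^sub>M haar) haar"
  proof (rule measurable_haarI)
    show "(\<lambda>q. snd (fst q) + snd q) \<in> borel_measurable (M \<Otimes>\<^sub>M haar)"
      by (intro borel_measurable_add measurable_compose[OF measurable_fst measurable_compose[OF measurable_snd id_haar_borel]]
         measurable_compose[OF measurable_snd id_haar_borel])
  qed (auto simp: space_pair_measure intro!: closed_subgroup_add[OF subgroup])
  have am: "(\<lambda>q. (fst (fst q), snd (fst q) + snd q)) \<in> measurable (M \<Otimes>\<^sub>M haar) M"
    by (intro measurable_Pair measurable_compose[OF measurable_fst measurable_fst] add_haar)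
  have "{q \<in> space (M \<Otimes>\<^sub>M haar). fst q \<in> A \<and> (fst (fst q), snd (fst q) + snd q) \<notin> A} \<in> sets (M \<Otimes>\<^sub>M haar)"
    using am A by measurable
  moreover have "{q \<in> space (M \<Otimes>\<^sub>M haar). \<not> (fst q \<in> A \<and> (fst (fst q), snd (fst q) + snd q) \<notin> A)}
      = space (M \<Otimes>\<^sub>M haar) - {q \<in> space (M \<Otimes>\<^sub>M haar). fst q \<in> A \<and> (fst (fst q), snd (fst q) + snd q) \<notin> A}" by auto
  ultimately have sm: "{q \<in> space (M \<Otimes>\<^sub>M haar). \<not> (fst q \<in> A \<and> (fst (fst q), snd (fst q) + snd q) \<notin> A)} \<in> sets (M \<Otimes>\<^sub>M haar)"
    by (simp only: sets.compl_sets)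
  have "AE h in haar. AE p in M. \<not> (p \<in> A \<and> (fst p, snd p + h) \<notin> A)"
    using AE_space[of haar] by eventually_elim (simp only: space_haar invariant_translate[OF A inv])
  then have "AE p in M. AE h in haar. \<not> (p \<in> A \<and> (fst p, snd p + h) \<notin> A)"
    by (rule Q.AE_commute[THEN iffD2, OF sm])
  then have "AE x in torus. AE y in haar. AE h in haar. \<not> ((x, y) \<in> A \<and> (x, y + h) \<notin> A)"
    using P.AE_pair by fastforce
  then show ?thesis
  proof eventually_elim
    fix x assume ae: "AE y in haar. AE h in haar. \<not> ((x, y) \<in> A \<and> (x, y + h) \<notin> A)"
    have s: "Pair x -` A \<in> sets haar" by (rule sets_section[OF A])
    have HA: "H - Pair x -` A \<in> sets haar" using sets.compl_sets[OF s] by simp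
    show "emeasure haar (Pair x -` A) = 0 \<or> emeasure haar (H - Pair x -` A) = 0"
    proof (cases "\<exists>y\<in>H. (x, y) \<in> A \<and> (AE h in haar. (x, y + h) \<in> A)")
      case True
      then obtain y where y: "y \<in> H" "(x, y) \<in> A" "AE h in haar. (x, y + h) \<in> A" by blast
      have t: "{h \<in> H. h + y \<in> H - Pair x -` A} \<in> sets haar"
        "emeasure haar {h \<in> H. h + y \<in> H - Pair x -` A} = emeasure haar (H - Pair x -` A)"
        using haar_translate[OF HA y(1)] by auto
      have "AE h in haar. h \<notin> {h \<in> H. h + y \<in> H - Pair x -` A}"
        using y(3) by eventually_elim (auto simp: add.commute)
      then have "emeasure haar {h \<in> H. h + y \<in> H - Pair x -` A} = 0"
        using t(1) sets.sets_into_space[OF t(1)]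
        by (subst (asm) AE_iff_measurable[OF t(1)]) auto
      then show ?thesis using t(2) by simp
    next
      case False
      have "AE y in haar. y \<notin> Pair x -` A"
        using ae AE_space[of haar] by eventually_elim (use False in auto)
      then have "emeasure haar (Pair x -` A) = 0"
        using s sets.sets_into_space[OF s] by (subst (asm) AE_iff_measurable[OF s]) auto
      then show ?thesis by simp
    qed
  qed
qed

lemma null_if_sections_null:
  assumes X: "X \<in> sets M" and "AE x in torus. emeasure haar (Pair x -` X) = 0"
  shows "X \<in> null_sets M"
  using assms by (intro null_setsI) (simp_all add: emeasure_M nn_integral_0_iff_AE[OF measurable_section])

text \<open>The measure of a section is exactly constant along base orbits, so the base points with
  null section form a strictly invariant set. Ergodicity of the rotation makes it null or full, and
  \<open>sections_trivial\<close> decides the rest.\<close>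

lemma ergodic_skew: "ergodic_on M (skew_product \<alpha> \<Psi>)"
  unfolding ergodic_on_def
proof (intro conjI ballI impI)
  show "skew_product \<alpha> \<Psi> \<in> measurable M M" by (rule skew_measurable)
  show "distr M M (skew_product \<alpha> \<Psi>) = M" by (rule skew_measure_preserving)
  fix A assume A: "A \<in> sets M" and inv: "skew_product \<alpha> \<Psi> -` A \<inter> space M = A"
  define R where "R = {x \<in> space torus. emeasure haar (Pair x -` A) = 0}"
  have R: "R \<in> sets torus" unfolding R_def using measurable_section[OF A] by measurable
  have "emeasure haar (Pair (rot \<alpha> x) -` A) = emeasure haar (Pair x -` A)" if "x \<in> {0..<1}" for x
    using section_skew[OF A that] by (simp add: inv)
  then have "rot_vimage \<alpha> R = R" by (auto simp: rot_vimage_def R_def)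
  then consider "measure torus R = 0" | "measure torus R = 1" using rot_ergodic[OF irr R] by blast
  then show "A \<in> null_sets M \<or> space M - A \<in> null_sets M"
  proof cases
    case 1
    then have "R \<in> null_sets torus" using R by (intro null_setsI) (simp_all add: torus.emeasure_eq_measure)
    then have "AE x in torus. x \<notin> R" by (rule AE_not_in)
    then have "AE x in torus. emeasure haar (Pair x -` (space M - A)) = 0"
      using sections_trivial[OF A inv] AE_space[of torus]
    proof eventually_elim
      fix x assume "x \<notin> R" "emeasure haar (Pair x -` A) = 0 \<or> emeasure haar (H - Pair x -` A) = 0" "x \<in> space torus"
      moreover from this have "Pair x -` (space M - A) = H - Pair x -` A" by (auto simp: space_M)
      ultimately show "emeasure haar (Pair x -` (space M - A)) = 0" by (auto simp: R_def)
    qed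
    then show ?thesis using A by (intro disjI2 null_if_sections_null) auto
  next
    case 2
    have "AE x in torus. x \<in> R"
    proof -
      have "measure torus (space torus - R) = 0" using torus.finite_measure_compl[OF R] 2 by simp
      then have "space torus - R \<in> null_sets torus" using R by (intro null_setsI) (auto simp: torus.emeasure_eq_measure)
      then have "AE x in torus. x \<notin> space torus - R" by (rule AE_not_in)
      then show ?thesis using AE_space[of torus] by eventually_elim simp
    qed
    then have "AE x in torus. emeasure haar (Pair x -` A) = 0" by eventually_elim (simp add: R_def)
    then show ?thesis using A by (intro disjI1 null_if_sections_null) auto
  qed
qed

end

theorem theorem3p8:
  fixes \<alpha> :: real and \<Phi> :: "real \<Rightarrow> real ^ 'd" and x :: "nat \<Rightarrow> real" and D :: nat
  assumes "0 < \<alpha>" "\<alpha> < 1" "\<alpha> \<notin> \<rat>"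
    and "step_function \<Phi>"
    and "\<And>j. (\<integral>t. \<Phi> t $ j \<partial>torus) = 0"
    and "bij_betw x {1..D} (discontinuities \<Phi>)"
    and "\<And>n. n \<ge> 1 \<Longrightarrow> distinct (disc_orbit \<alpha> x D n)"
    and "well_separated \<alpha> x D"
  shows "{jump \<Phi> (x i) | i. i \<in> {1..D}} \<subseteq> essential_values \<alpha> \<Phi> \<and> regular_cocycle \<alpha> \<Phi>"
proof -
  have \<Phi>: "\<Phi> \<in> borel_measurable torus" by (rule step_function_measurable[OF assms(4)])
  obtain M where M: "\<And>y. y \<in> \<Phi> ` {0..<1} \<Longrightarrow> norm y \<le> M"
    using finite_imp_bounded[OF step_function_finite_range[OF assms(4)]] by (auto simp: bounded_iff)
  have "integrable torus \<Phi>"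
    by (rule torus.integrable_const_bound[of _ M]) (use M \<Phi> in auto)
  then have "(\<integral>t. \<Phi> t \<partial>torus) $ j = (\<integral>t. \<Phi> t $ j \<partial>torus)" for j
    using integral_bounded_linear[OF bounded_linear_vec_nth, of torus \<Phi>] by simp
  then have int0: "(\<integral>t. \<Phi> t \<partial>torus) = 0" using assms(5) by (simp add: vec_eq_iff)
  have jump: "jump \<Phi> (x i) \<in> essential_values \<alpha> \<Phi>" if "i \<in> {1..D}" for i
    using that by (intro jump_essential_value[OF assms(3,4) int0 assms(6,7,8)])
  have "d \<in> x ` {1..D}" if "d \<in> discontinuities \<Phi>" for d
    using that assms(6) by (simp add: bij_betw_def)
  then have jump': "jump \<Phi> d \<in> essential_values \<alpha> \<Phi>" if "d \<in> discontinuities \<Phi>" for d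
    using that jump by blast
  have find: "finite (discontinuities \<Phi>)" using assms(6) bij_betw_finite by blast
  obtain Q where Q: "infinite Q" "Q \<subseteq> range (conv_denom \<alpha>)"
    using assms(8) by (auto simp: well_separated_def)
  obtain \<Psi> where \<Psi>: "\<Psi> \<in> borel_measurable torus" "\<And>x. \<Psi> x \<in> essential_values \<alpha> \<Phi>"
    "cohomologous \<alpha> \<Phi> \<Psi>" "essential_values \<alpha> \<Phi> \<subseteq> essential_values \<alpha> \<Psi>"
    using regularizing_cocycle[OF assms(3,4) int0 find jump' Q] by blast
  have H: "closed_subgroup (essential_values \<alpha> \<Phi>)" by (rule closed_subgroup_essential_values[OF \<Phi>])
  obtain B where "cross_section (essential_values \<alpha> \<Phi>) B" using cross_section_exists[OF H] .
  then interpret cross_section "essential_values \<alpha> \<Phi>" B .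
  interpret ergodic_extension "essential_values \<alpha> \<Phi>" B \<alpha> \<Psi>
    by unfold_locales (use assms(3) \<Psi> in auto)
  have "regular_cocycle \<alpha> \<Phi>"
    unfolding regular_cocycle_def using \<Psi> H haar_measure_on_haar ergodic_skew by blast
  then show ?thesis using jump by auto
qed

end
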